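(* Consider a triangular array (indexed by $T$) of stationary Gaussian VARs as in the context and an equation index $i=i_T\in\{1,\dots,k_T\}$. Assume that there is a $\tilde c_i>0$ (not depending on $T$) such that $\kappa_i\ge\tilde c_i$ for all $T$, and that $\sup_T\sigma_T<\infty$ and $\sup_T\|\Gamma\|\sum_{j=0}^T\|F^j\|<\infty$. Assume further that $k,p\in O(e^{T^a})$ and $s_i\in O(T^b)$ for some $a,b\ge0$ with $15a+4b<1$, and that $\beta_{\min,i}\in\Omega(\ln(T)[a_T\vee b_T])$, where $$a_T=T^{2b}T^{(15/2)a-1/2}\ln(T)^{1+5/2},\qquad b_T=T^{b/4}T^{(7/4)a-1/4}\ln(T)^{5/4}.$$ Let $\tilde\beta_i$ be the adaptive LASSO estimator defined in the context with $\lambda_T=\sqrt{8\ln(1+T)^5\ln(1+k)^4\ln(1+p)^2\ln(k^2p)\,\sigma_T^4/T}$. Then $P(\operatorname{sign}(\tilde\beta_i)=\operatorname{sign}(\beta_i^* ))\to1$ as $T\to\infty$.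
   Context: Setting (VAR model). $T\ge1$ is the sample size; $k=k_T\ge1$ and $p=p_T\ge1$ are integers that may depend on $T$. For each $T$, the $\mathbb{R}^k$-valued data $y_t=(y_{t,1},\dots,y_{t,k})'$, $t=1-p,\dots,T$, satisfy $y_t=\sum_{l=1}^p\Phi_l y_{t-l}+\epsilon_t$ for $t=1,\dots,T$, where $\Phi_1,\dots,\Phi_p$ are $k\times k$ matrices (possibly depending on $T$ but not on $t$), $\epsilon_t$ are i.i.d. $N_k(0,\Sigma)$, all roots of $\det(I_k-\sum_{j=1}^p\Phi_jz^j)$ lie outside the unit disc, and $(y_t)$ is the stationary causal solution (so $y_t$ is centered Gaussian and $\epsilon_t$ is independent of $y_s$, $s<t$). All parameters and dimensions may vary with $T$. $\sigma_{i,y}^2$ is the variance of $y_{t,i}$, $\sigma_{i,\epsilon}^2$ the variance of $\epsilon_{t,i}$, and $\sigma_T=\max_{1\le i\le k}(\sigma_{i,y}\vee\sigma_{i,\epsilon})$. $F$ is the $kp\times kp$ companion matrix of the VAR. Stacked form: $Z_t=(y_{t-1}',\dots,y_{t-p}')'\in\mathbb{R}^{kp}$, $X=(Z_T,\dots,Z_1)'$ ($T\times kp$), $y_i=(y_{T,i},\dots,y_{1,i})'$, $\epsilon_i=(\epsilon_{T,i},\dots,\epsilon_{1,i})'$, so $y_i=X\beta_i^*+\epsilon_i$, where $\beta_i^*\in\mathbb{R}^{kp}$ is the true parameter vector of equation $i$. $J_i=\{j:\beta^*_{i,j}\neq0\}$, $s_i=|J_i|\ge1$, $\beta_{\min,i}=\min\{|\beta^*_{i,j}|:j\in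 J_i\}$. $\|\cdot\|$ is the Euclidean norm of a vector or the spectral norm of a matrix; $\|\cdot\|_{\ell_1}$ is the $\ell_1$ norm; $\delta_R$ is the subvector of $\delta$ indexed by $R$; $\operatorname{sign}$ is applied componentwise. Estimators. The LASSO estimator $\hat\beta_i$ is a minimizer over $\beta\in\mathbb{R}^{kp}$ of $\frac1T\|y_i-X\beta\|^2+2\lambda_T\|\beta\|_{\ell_1}$; put $J(\hat\beta_i)=\{j:\hat\beta_{i,j}\neq0\}$. The adaptive LASSO estimator $\tilde\beta_i\in\mathbb{R}^{kp}$ has $\tilde\beta_{i,j}=0$ for $j\notin J(\hat\beta_i)$, and its remaining coordinates minimize $$\frac1T\|y_i-X_{J(\hat\beta_i)}\beta_{J(\hat\beta_i)}\|^2+2\lambda_T\sum_{j\in J(\hat\beta_i)}\frac{|\beta_j|}{|\hat\beta_{i,j}|},$$ where $X_R$ is the submatrix of columns of $X$ indexed by $R$. $\Gamma=E(Z_tZ_t')$ and $\kappa_i=\kappa_\Gamma(s_i)$, where for $1\le r\le kp$ $$\kappa_\Gamma^2(r)=\min_{R\subseteq\{1,\dots,kp\},\,|R|\le r}\ \min_{\delta\in\mathbb{R}^{kp}\setminus\{0\},\ \|\delta_{R^c}\|_{\ell_1}\le3\|\delta_R\|_{\ell_1}}\frac{\delta'\Gamma\delta}{\|\delta_R\|^2}.$$ $f(T)\in\Omega(g(T))$ means that there are a constant $c>0$ and a $T_0$ such that $f(T)\ge c\,g(T)$ for all $T\ge T_0$. *)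

theory Defs
  imports
    "HOL-Probability.Probability"
    "HOL-Library.Landau_Symbols"
    "Jordan_Normal_Form.Determinant"
begin

text \<open>
  All coordinates are numbered from 0, so equations are indexed by \<open>{..<k}\<close> and regressors by
  \<open>{..<k * p}\<close>; lags keep their natural numbering \<open>1..p\<close>. Matrices and vectors with
  variable dimensions are those of \<open>Jordan_Normal_Form\<close>. The regressor with index \<open>c\<close> is
  component \<open>c mod k\<close> of the lag \<open>Suc (c div k)\<close>.
\<close>

section \<open>Norms and the restricted eigenvalue\<close>

definition l1_on :: "nat set \<Rightarrow> real vec \<Rightarrow> real" where
  "l1_on R v = (\<Sum>j\<in>R. \<bar>v $ j\<bar>)"

definition l2_on :: "nat set \<Rightarrow> real vec \<Rightarrow> real" where
  "l2_on R v = L2_set (\<lambda>j. v $ j) R"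

definition vnorm :: "real vec \<Rightarrow> real" where
  "vnorm v = l2_on {..<dim_vec v} v"

definition spectral_norm :: "real mat \<Rightarrow> real" where
  "spectral_norm A = (SUP v\<in>{v \<in> carrier_vec (dim_col A). vnorm v \<le> 1}. vnorm (A *\<^sub>v v))"

text \<open>
  The two nested minima are taken jointly. The constraints force \<open>\<delta>\<close> to be nonzero on \<open>R\<close>, so the
  quotients are well defined and \<open>R = {}\<close> contributes nothing.
\<close>

definition kappa :: "real mat \<Rightarrow> nat \<Rightarrow> real" where
  "kappa G r = sqrt (Inf {(\<delta> \<bullet> (G *\<^sub>v \<delta>)) / (l2_on R \<delta>)\<^sup>2 | R \<delta>.
      R \<subseteq> {..<dim_row G} \<and> card R \<le> r \<and>
      \<delta> \<in> carrier_vec (dim_row G) \<and> \<delta> \<noteq> 0\<^sub>v (dim_row G) \<and>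
      l1_on ({..<dim_row G} - R) \<delta> \<le> 3 * l1_on R \<delta>})"

section \<open>Stationary Gaussian vector autoregressions\<close>

text \<open>The univariate law with mean 0 and variance \<open>v\<close>, degenerate if \<open>v = 0\<close>.\<close>

definition centered_normal :: "'a measure \<Rightarrow> ('a \<Rightarrow> real) \<Rightarrow> real \<Rightarrow> bool" where
  "centered_normal M X v \<longleftrightarrow>
     v > 0 \<and> distributed M lborel X (\<lambda>x. ennreal (normal_density 0 (sqrt v) x)) \<or>
     v = 0 \<and> X \<in> borel_measurable M \<and> (AE \<omega> in M. X \<omega> = 0)"

text \<open>
  A random vector is \<open>N\<^sub>k(0, S)\<close> if every linear combination \<open>a \<bullet> X\<close> is \<open>N(0, a \<bullet> (S a))\<close>; the
  covariance matrix \<open>S\<close> may be singular. Positive semidefiniteness of \<open>S\<close> is implied.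
\<close>

definition centered_gaussian_vector ::
    "'a measure \<Rightarrow> nat \<Rightarrow> real mat \<Rightarrow> (nat \<Rightarrow> 'a \<Rightarrow> real) \<Rightarrow> bool" where
  "centered_gaussian_vector M k S X \<longleftrightarrow>
     S \<in> carrier_mat k k \<and> transpose_mat S = S \<and>
     (\<forall>a \<in> carrier_vec k. centered_normal M (\<lambda>\<omega>. \<Sum>j<k. a $ j * X j \<omega>) (a \<bullet> (S *\<^sub>v a)))"

definition var_char_mat :: "nat \<Rightarrow> nat \<Rightarrow> (nat \<Rightarrow> real mat) \<Rightarrow> complex \<Rightarrow> complex mat" where
  "var_char_mat k p \<Phi> z = mat k k (\<lambda>(a, b).
     (if a = b then 1 else 0) - (\<Sum>l=1..p. complex_of_real (\<Phi> l $$ (a, b)) * z ^ l))"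

definition companion :: "nat \<Rightarrow> nat \<Rightarrow> (nat \<Rightarrow> real mat) \<Rightarrow> real mat" where
  "companion k p \<Phi> = mat (k * p) (k * p) (\<lambda>(r, c).
     if r < k then \<Phi> (Suc (c div k)) $$ (r, c mod k) else if r = c + k then 1 else 0)"

text \<open>
  The innovations \<open>\<epsilon> t j\<close> and the process \<open>y t j\<close> are indexed by all times \<open>t :: int\<close>, since
  the causal solution involves the whole past of the innovations.
\<close>

locale gaussian_var = prob_space M
  for M :: "'a measure"
    and k p :: nat
    and \<Phi> :: "nat \<Rightarrow> real mat"
    and S :: "real mat"
    and \<epsilon> y :: "int \<Rightarrow> nat \<Rightarrow> 'a \<Rightarrow> real" +
  assumes k_pos: "k \<ge> 1"
    and p_pos: "p \<ge> 1"
    and \<Phi>_carrier: "\<And>l. l \<in> {1..p} \<Longrightarrow> \<Phi> l \<in> carrier_mat k k"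
    and roots_outside: "\<And>z. det (var_char_mat k p \<Phi> z) = 0 \<Longrightarrow> cmod z > 1"
    and innovations_indep:
      "indep_vars (\<lambda>_. PiM {..<k} (\<lambda>_. borel)) (\<lambda>t \<omega>. \<lambda>j\<in>{..<k}. \<epsilon> t j \<omega>) UNIV"
    and innovations_gaussian: "\<And>t. centered_gaussian_vector M k S (\<epsilon> t)"
    and y_measurable: "\<And>t j. j < k \<Longrightarrow> y t j \<in> borel_measurable M"
    and var_equation: "\<And>t i. i < k \<Longrightarrow> AE \<omega> in M.
      y t i \<omega> = (\<Sum>l=1..p. \<Sum>j<k. \<Phi> l $$ (i, j) * y (t - int l) j \<omega>) + \<epsilon> t i \<omega>"
    and strictly_stationary: "\<And>h.
      distr M (PiM (UNIV \<times> {..<k}) (\<lambda>_. borel))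
        (\<lambda>\<omega>. \<lambda>tj\<in>UNIV \<times> {..<k}. y (fst tj + h) (snd tj) \<omega>) =
      distr M (PiM (UNIV \<times> {..<k}) (\<lambda>_. borel))
        (\<lambda>\<omega>. \<lambda>tj\<in>UNIV \<times> {..<k}. y (fst tj) (snd tj) \<omega>)"
    and causal: "\<exists>\<Psi> :: nat \<Rightarrow> real mat.
      (\<forall>h. \<Psi> h \<in> carrier_mat k k) \<and>
      (\<forall>i<k. \<forall>j<k. summable (\<lambda>h. \<bar>\<Psi> h $$ (i, j)\<bar>)) \<and>
      (\<forall>t. \<forall>i<k. AE \<omega> in M.
         (\<lambda>h. \<Sum>j<k. \<Psi> h $$ (i, j) * \<epsilon> (t - int h) j \<omega>) sums y t i \<omega>)"

text \<open>
  \<open>Z\<^sub>t\<close>, \<open>X\<close> and \<open>y\<^sub>i\<close>; row \<open>r\<close> of the sample quantities belongs to the time \<open>T - r\<close>.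
\<close>

definition regressor :: "nat \<Rightarrow> nat \<Rightarrow> (int \<Rightarrow> nat \<Rightarrow> 'a \<Rightarrow> real) \<Rightarrow> int \<Rightarrow> 'a \<Rightarrow> real vec" where
  "regressor k p y t \<omega> = vec (k * p) (\<lambda>c. y (t - int (Suc (c div k))) (c mod k) \<omega>)"

definition design :: "nat \<Rightarrow> nat \<Rightarrow> nat \<Rightarrow> (int \<Rightarrow> nat \<Rightarrow> 'a \<Rightarrow> real) \<Rightarrow> 'a \<Rightarrow> real mat" where
  "design T k p y \<omega> = mat T (k * p) (\<lambda>(r, c). regressor k p y (int T - int r) \<omega> $ c)"

definition response :: "nat \<Rightarrow> (int \<Rightarrow> nat \<Rightarrow> 'a \<Rightarrow> real) \<Rightarrow> nat \<Rightarrow> 'a \<Rightarrow> real vec" where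
  "response T y i \<omega> = vec T (\<lambda>r. y (int T - int r) i \<omega>)"

definition true_param :: "nat \<Rightarrow> nat \<Rightarrow> (nat \<Rightarrow> real mat) \<Rightarrow> nat \<Rightarrow> real vec" where
  "true_param k p \<Phi> i = vec (k * p) (\<lambda>c. \<Phi> (Suc (c div k)) $$ (i, c mod k))"

text \<open>By stationarity the moments below do not depend on the time; they are taken at time 1.\<close>

definition regressor_cov ::
    "'a measure \<Rightarrow> nat \<Rightarrow> nat \<Rightarrow> (int \<Rightarrow> nat \<Rightarrow> 'a \<Rightarrow> real) \<Rightarrow> real mat" where
  "regressor_cov M k p y = mat (k * p) (k * p) (\<lambda>(a, b).
     prob_space.expectation M (\<lambda>\<omega>. regressor k p y 1 \<omega> $ a * regressor k p y 1 \<omega> $ b))"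

definition max_sd ::
    "'a measure \<Rightarrow> nat \<Rightarrow> (int \<Rightarrow> nat \<Rightarrow> 'a \<Rightarrow> real) \<Rightarrow> (int \<Rightarrow> nat \<Rightarrow> 'a \<Rightarrow> real) \<Rightarrow> real" where
  "max_sd M k \<epsilon> y = (MAX i\<in>{..<k}.
     max (sqrt (prob_space.variance M (y 1 i))) (sqrt (prob_space.variance M (\<epsilon> 1 i))))"

section \<open>LASSO and adaptive LASSO\<close>

definition support :: "real vec \<Rightarrow> nat set" where
  "support v = {j. j < dim_vec v \<and> v $ j \<noteq> 0}"

definition beta_min :: "real vec \<Rightarrow> real" where
  "beta_min v = (MIN j\<in>support v. \<bar>v $ j\<bar>)"

text \<open>The number of rows of \<open>X\<close> is the sample size.\<close>

definition is_lasso :: "real mat \<Rightarrow> real vec \<Rightarrow> real \<Rightarrow> real vec \<Rightarrow> bool" where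
  "is_lasso X v lam \<beta> \<longleftrightarrow>
     is_arg_min
       (\<lambda>\<gamma>. (vnorm (v - X *\<^sub>v \<gamma>))\<^sup>2 / real (dim_row X) + 2 * lam * l1_on {..<dim_col X} \<gamma>)
       (\<lambda>\<gamma>. \<gamma> \<in> carrier_vec (dim_col X)) \<beta>"

text \<open>
  \<open>b\<close> is the first-step estimate. Vectors indexed by its support are identified with vectors
  vanishing off that support, on which the submatrix of selected columns acts as \<open>X\<close> itself.
\<close>

definition is_adaptive_lasso ::
    "real mat \<Rightarrow> real vec \<Rightarrow> real \<Rightarrow> real vec \<Rightarrow> real vec \<Rightarrow> bool" where
  "is_adaptive_lasso X v lam b \<beta> \<longleftrightarrow>
     is_arg_min
       (\<lambda>\<gamma>. (vnorm (v - X *\<^sub>v \<gamma>))\<^sup>2 / real (dim_row X) +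
            2 * lam * (\<Sum>j\<in>support b. \<bar>\<gamma> $ j\<bar> / \<bar>b $ j\<bar>))
       (\<lambda>\<gamma>. \<gamma> \<in> carrier_vec (dim_col X) \<and> support \<gamma> \<subseteq> support b) \<beta>"

end

theory Submission
  imports Defs "HOL-Real_Asymp.Real_Asymp"
begin

text \<open>
  The adaptive LASSO finds the signs because, with probability tending to one, two quantities of the
  regression are small simultaneously: the entrywise distance between the sample Gram matrix
  \<open>X'X / T\<close> and \<open>\<Gamma>\<close>, and the maximum of the score \<open>X'\<epsilon>\<^sub>i / T\<close>.
  Given these two bounds, everything else is deterministic.

  Let \<open>\<delta>\<close> be the error of an \<open>\<ell>\<^sub>1\<close>-penalised estimator. Minimality along the
  segment to the true parameter gives
  \<open>\<delta>'(X'X/T)\<delta> \<le> \<delta>'(X'\<epsilon>\<^sub>i/T) + \<lambda> \<Sum>w\<^sub>j(\<bar>\<beta>\<^sup>*\<^sub>j\<bar> - \<bar>\<beta>\<^sub>j\<bar>)\<close>, so that \<open>\<delta>\<close> lies in the cone of the restricted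
  eigenvalue as soon as the score is at most \<open>\<lambda>/2\<close>; the restricted eigenvalue of \<open>\<Gamma>\<close> is inherited by \<open>X'X/T\<close>
  if the entrywise distance is at most a small multiple of \<open>1/s\<close>. One lemma (\<open>weighted_lasso_error\<close>) therefore bounds the
  errors of both estimators. The first step has \<open>\<ell>\<^sub>1\<close>-error \<open>r\<close> of order \<open>\<lambda>s\<close>, which is much smaller than
  \<open>\<beta>\<^sub>m\<^sub>i\<^sub>n\<close>. Hence no relevant regressor is lost, and the second step has
  weights at most \<open>2/\<beta>\<^sub>m\<^sub>i\<^sub>n\<close> on relevant and at least \<open>1/r\<close> on irrelevant regressors. By the first-order
  condition, a nonzero coefficient of an irrelevant regressor would need a residual correlation of at least \<open>\<lambda>/r\<close>,
  more than is available (\<open>adaptive_lasso_sign_recovery\<close>).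

  All variables involved are almost sure limits of finite linear combinations of the
  innovations, and such limits form a linear space of centered normal variables in which variances pass to the limit.
  For \<open>w\<^sub>1, \<dots>, w\<^sub>n\<close> in such a space whose covariance matrix has absolute row sums at most \<open>\<rho>\<close>, the sum
  of squares concentrates (\<open>square_sum_concentration\<close>):
  Jensen's inequality reduces both tails to the product of
  the two Laplace transforms at \<open>\<theta>\<close> and \<open>-\<theta>\<close>; linearising the squares by a standard normal vector turns
  this product into the expectation of \<open>exp (\<theta>(g'Cg - h'Ch))\<close> for independent standard normal \<open>g\<close> and \<open>h\<close>; a rotation
  by 45 degrees factors the difference of the two quadratic forms into \<open>2u'Cv\<close>, and integrating one factor
  at a time leaves \<open>(1 - 4\<theta>\<^sup>2\<rho>\<^sup>2)\<^sup>-\<^sup>n\<^sup>/\<^sup>2\<close>. Products \<open>u\<^sub>t v\<^sub>t\<close> follow by polarisation.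

  For the autoregression the row sums are controlled by \<open>\<parallel>\<Gamma>\<parallel> \<Sum>\<parallel>F\<^sup>j\<parallel>\<close>: a variable \<open>Y\<close> that is
  orthogonal to all innovations from time \<open>t\<close> on satisfies \<open>E(Y Z\<^sub>t\<^sub>+\<^sub>h) = F\<^sup>h E(Y Z\<^sub>t)\<close>. This applies to the
  regressors of time \<open>t\<close> and to the innovation of time \<open>t - 1\<close>, and a union bound controls all
  \<open>(kp)\<^sup>2\<close> entries of the Gram matrix and all \<open>kp\<close> entries of the score (\<open>good_event_prob\<close>). For
  the Gram matrix a level of order \<open>1/s\<close> can be afforded because \<open>ln (kp)\<close> grows more slowly
  than \<open>T\<^sup>1\<^sup>-\<^sup>2\<^sup>b\<close> (\<open>gram_error_tendsto_0\<close>). For the score a level of order \<open>\<surd>(ln T ln (kp) / T)\<close>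
  suffices, which is eventually below \<open>\<lambda>/2\<close> (\<open>score_error_tendsto_0\<close>, \<open>score_level_le_penalty_level\<close>).

  The hypotheses on the rates imply that \<open>\<lambda>s\<^sup>3\<^sup>/\<^sup>2\<close>, its quotient by
  \<open>\<beta>\<^sub>m\<^sub>i\<^sub>n\<close>, and \<open>\<lambda>s\<^sup>1\<^sup>/\<^sup>2\<close> divided by the square of \<open>\<beta>\<^sub>m\<^sub>i\<^sub>n\<close> tend to zero (\<open>tuning_limits\<close>), which suffices for the
  deterministic conditions. A special case is \<open>k = p = 1\<close>: there \<open>ln (k\<^sup>2p) = 0\<close>, the penalty vanishes, and
  the least squares estimator has the right sign because the score is of smaller order than \<open>\<beta>\<^sub>m\<^sub>i\<^sub>n\<close>.
\<close>


section \<open>Centered normal laws\<close>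

text \<open>
  Degenerate and nondegenerate laws are treated together as images of the standard normal law
  under multiplication by the standard deviation.
\<close>

lemma (in prob_space) centered_normalD:
  assumes "centered_normal M X v"
  shows "v \<ge> 0" "X \<in> borel_measurable M"
    "distr M borel X = distr std_normal_distribution borel (\<lambda>x. sqrt v * x)"
proof -
  interpret N: real_distribution std_normal_distribution by (rule real_dist_normal_dist)
  have cases: "(v > 0 \<and> distributed M lborel X (\<lambda>x. ennreal (normal_density 0 (sqrt v) x))) \<or>
     (v = 0 \<and> X \<in> borel_measurable M \<and> (AE \<omega> in M. X \<omega> = 0))"
    using assms unfolding centered_normal_def by blast
  then show v: "v \<ge> 0" by auto
  show m: "X \<in> borel_measurable M"
    using cases by (auto dest: distributed_measurable)
  show "distr M borel X = distr std_normal_distribution borel (\<lambda>x. sqrt v * x)"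
    using cases
  proof
    assume a: "v > 0 \<and> distributed M lborel X (\<lambda>x. ennreal (normal_density 0 (sqrt v) x))"
    have "distributed std_normal_distribution lborel (\<lambda>x. x) (\<lambda>x. ennreal (normal_density 0 1 x))"
      unfolding distributed_def by (auto simp: distr_id2 intro!: measurable_ident_sets)
    from N.normal_density_affine[OF this, of "sqrt v" 0] a
    have "distributed std_normal_distribution lborel (\<lambda>x. sqrt v * x)
        (\<lambda>x. ennreal (normal_density 0 (sqrt v) x))" by simp
    then have "distr std_normal_distribution lborel (\<lambda>x. sqrt v * x) = distr M lborel X"
      using a by (simp add: distributed_def)
    then show ?thesis by (metis distr_cong sets_lborel)
  next
    assume a: "v = 0 \<and> X \<in> borel_measurable M \<and> (AE \<omega> in M. X \<omega> = 0)"
    have "distr M borel X = distr M borel (\<lambda>_. 0)"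
      using a by (intro distr_cong_AE) auto
    also have "\<dots> = distr std_normal_distribution borel (\<lambda>x. sqrt v * x)"
      using a by (simp add: distr_const N.distr_const)
    finally show ?thesis .
  qed
qed

lemma char_scaled_std_normal:
  "char (distr std_normal_distribution borel (\<lambda>x. c * x)) = (\<lambda>t. of_real (exp (- (c * t)\<^sup>2 / 2)))"
proof
  fix t
  have "char (distr std_normal_distribution borel (\<lambda>x. c * x)) t = char std_normal_distribution (c * t)"
    unfolding char_def by (subst integral_distr) (auto simp: mult_ac)
  then show "char (distr std_normal_distribution borel (\<lambda>x. c * x)) t = of_real (exp (- (c * t)\<^sup>2 / 2))"
    by (simp add: char_std_normal_distribution)
qed

text \<open>
  In this form normality is visibly stable under independent sums and under limits.
\<close>

lemma (in prob_space) centered_normal_iff_char: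
  "centered_normal M X v \<longleftrightarrow> v \<ge> 0 \<and> X \<in> borel_measurable M \<and>
     (\<forall>t. char (distr M borel X) t = of_real (exp (- (v * t\<^sup>2) / 2)))"
proof safe
  interpret N: real_distribution std_normal_distribution by (rule real_dist_normal_dist)
  assume a: "centered_normal M X v"
  show "v \<ge> 0" "X \<in> borel_measurable M" using centered_normalD[OF a] by auto
  show "char (distr M borel X) t = of_real (exp (- (v * t\<^sup>2) / 2))" for t
    unfolding centered_normalD(3)[OF a] char_scaled_std_normal
    using centered_normalD(1)[OF a] by (simp add: power_mult_distrib)
next
  interpret N: real_distribution std_normal_distribution by (rule real_dist_normal_dist)
  assume v: "v \<ge> 0" and m: "X \<in> borel_measurable M"
    and c: "\<forall>t. char (distr M borel X) t = of_real (exp (- (v * t\<^sup>2) / 2))"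
  have eq: "distr M borel X = distr std_normal_distribution borel (\<lambda>x. sqrt v * x)"
  proof (rule Levy_uniqueness)
    show "real_distribution (distr M borel X)" using m by (rule real_distribution_distr)
    show "real_distribution (distr std_normal_distribution borel (\<lambda>x. sqrt v * x))"
      by (rule N.real_distribution_distr) simp
    show "char (distr M borel X) = char (distr std_normal_distribution borel (\<lambda>x. sqrt v * x))"
      unfolding char_scaled_std_normal using c v by (auto simp: fun_eq_iff power_mult_distrib)
  qed
  show "centered_normal M X v"
  proof (cases "v = 0")
    case True
    have "AE x in distr M borel X. x = 0"
      unfolding eq using True by (subst AE_distr_iff) auto
    then have "AE \<omega> in M. X \<omega> = 0" using m by (subst (asm) AE_distr_iff) auto
    with True m show ?thesis unfolding centered_normal_def by auto
  next
    case False
    with v have v: "v > 0" by auto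
    have "distributed std_normal_distribution lborel (\<lambda>x. x) (\<lambda>x. ennreal (normal_density 0 1 x))"
      unfolding distributed_def by (auto simp: distr_id2 intro!: measurable_ident_sets)
    from N.normal_density_affine[OF this, of "sqrt v" 0] v
    have d: "distributed std_normal_distribution lborel (\<lambda>x. sqrt v * x)
        (\<lambda>x. ennreal (normal_density 0 (sqrt v) x))" by simp
    have "distr M lborel X = distr std_normal_distribution lborel (\<lambda>x. sqrt v * x)"
      using eq by (metis distr_cong sets_lborel)
    with d have "distributed M lborel X (\<lambda>x. ennreal (normal_density 0 (sqrt v) x))"
      using m by (simp add: distributed_def)
    with v show ?thesis unfolding centered_normal_def by auto
  qed
qed

lemma (in prob_space) centered_normal_integral:
  fixes f :: "real \<Rightarrow> 'b :: {banach, second_countable_topology}"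
  assumes "centered_normal M X v" and [measurable]: "f \<in> borel_measurable borel"
  shows "(\<integral>\<omega>. f (X \<omega>) \<partial>M) = (\<integral>x. f (sqrt v * x) \<partial>std_normal_distribution)"
    and "integrable M (\<lambda>\<omega>. f (X \<omega>)) \<longleftrightarrow> integrable std_normal_distribution (\<lambda>x. f (sqrt v * x))"
proof -
  note c = centered_normalD[OF assms(1)]
  have [measurable]: "X \<in> borel_measurable M" by (rule c)
  have "(\<integral>\<omega>. f (X \<omega>) \<partial>M) = (\<integral>x. f x \<partial>distr M borel X)"
    by (subst integral_distr) auto
  also have "\<dots> = (\<integral>x. f (sqrt v * x) \<partial>std_normal_distribution)"
    unfolding c(3) by (subst integral_distr) auto
  finally show "(\<integral>\<omega>. f (X \<omega>) \<partial>M) = (\<integral>x. f (sqrt v * x) \<partial>std_normal_distribution)" .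
  have "integrable M (\<lambda>\<omega>. f (X \<omega>)) \<longleftrightarrow> integrable (distr M borel X) f"
    by (subst integrable_distr_eq) auto
  also have "\<dots> \<longleftrightarrow> integrable std_normal_distribution (\<lambda>x. f (sqrt v * x))"
    unfolding c(3) by (subst integrable_distr_eq) auto
  finally show "integrable M (\<lambda>\<omega>. f (X \<omega>)) \<longleftrightarrow> integrable std_normal_distribution (\<lambda>x. f (sqrt v * x))" .
qed

lemma (in prob_space) centered_normal_moments:
  assumes "centered_normal M X v"
  shows "integrable M (\<lambda>\<omega>. (X \<omega>)\<^sup>2)" "expectation (\<lambda>\<omega>. (X \<omega>)\<^sup>2) = v"
    "integrable M X" "expectation X = 0"
proof -
  have v: "v \<ge> 0" using centered_normalD(1)[OF assms] .
  have i: "integrable std_normal_distribution (\<lambda>x. x ^ k)" for k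
    by (rule integrable_std_normal_distribution_moment)
  have sq: "(\<lambda>x. (sqrt v * x)\<^sup>2) = (\<lambda>x. v * x\<^sup>2)" using v by (auto simp: power_mult_distrib)
  show "integrable M (\<lambda>\<omega>. (X \<omega>)\<^sup>2)"
    using centered_normal_integral(2)[OF assms, of "\<lambda>x. x\<^sup>2"] i[of 2] sq by simp
  show "expectation (\<lambda>\<omega>. (X \<omega>)\<^sup>2) = v"
    using centered_normal_integral(1)[OF assms, of "\<lambda>x. x\<^sup>2"] sq
      std_normal_distribution_even_moments(1)[of 1] by (simp add: numeral_2_eq_2)
  show "integrable M X"
    using centered_normal_integral(2)[OF assms, of "\<lambda>x. x"] i[of 1] by simp
  show "expectation X = 0"
    using centered_normal_integral(1)[OF assms, of "\<lambda>x. x"]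
      integral_std_normal_distribution_moment_odd[of 1] by simp
qed

lemma nn_integral_exp_std_normal:
  "(\<integral>\<^sup>+x. ennreal (exp (c * x)) \<partial>std_normal_distribution) = ennreal (exp (c\<^sup>2 / 2))"
proof -
  have *: "std_normal_density x * exp (c * x) = exp (c\<^sup>2 / 2) * normal_density c 1 x" for x
    by (simp add: normal_density_def exp_add[symmetric] power2_diff field_simps)
  have "(\<integral>\<^sup>+x. ennreal (exp (c * x)) \<partial>std_normal_distribution)
      = (\<integral>\<^sup>+x. ennreal (exp (c\<^sup>2 / 2)) * ennreal (normal_density c 1 x) \<partial>lborel)"
    by (subst nn_integral_density)
      (auto intro!: nn_integral_cong simp: ennreal_mult[symmetric] *)
  also have "\<dots> = ennreal (exp (c\<^sup>2 / 2)) * (\<integral>\<^sup>+x. ennreal (normal_density c 1 x) \<partial>lborel)"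
    by (rule nn_integral_cmult) auto
  also have "(\<integral>\<^sup>+x. ennreal (normal_density c 1 x) \<partial>lborel) = 1"
    by (subst nn_integral_eq_integral) auto
  finally show ?thesis by simp
qed

lemma (in prob_space) centered_normal_nn_integral_exp:
  assumes "centered_normal M X v"
  shows "(\<integral>\<^sup>+\<omega>. ennreal (exp (c * X \<omega>)) \<partial>M) = ennreal (exp (c\<^sup>2 * v / 2))"
proof -
  note c = centered_normalD[OF assms]
  have [measurable]: "X \<in> borel_measurable M" by (rule c)
  have "(\<integral>\<^sup>+\<omega>. ennreal (exp (c * X \<omega>)) \<partial>M) = (\<integral>\<^sup>+x. ennreal (exp (c * x)) \<partial>distr M borel X)"
    by (subst nn_integral_distr) auto
  also have "\<dots> = (\<integral>\<^sup>+x. ennreal (exp ((c * sqrt v) * x)) \<partial>std_normal_distribution)"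
    unfolding c(3) by (subst nn_integral_distr) (auto simp: mult_ac)
  finally show ?thesis using c(1) unfolding nn_integral_exp_std_normal
    by (simp add: power_mult_distrib)
qed

text \<open>
  The characteristic functions converge pointwise. The limit is positive at some nonzero point, and
  there its logarithm shows that the variances converge.
\<close>

lemma (in prob_space) centered_normal_limit:
  assumes X: "\<And>n. centered_normal M (X n) (v n)"
    and [measurable]: "Y \<in> borel_measurable M"
    and lim: "AE \<omega> in M. (\<lambda>n. X n \<omega>) \<longlonglongrightarrow> Y \<omega>"
  shows "\<exists>w. centered_normal M Y w \<and> v \<longlonglongrightarrow> w"
proof -
  have [measurable]: "X n \<in> borel_measurable M" for n using centered_normalD(2)[OF X] .
  define \<phi> where "\<phi> t = char (distr M borel Y) t" for t
  have char_lim: "(\<lambda>n. char (distr M borel (X n)) t) \<longlonglongrightarrow> \<phi> t" for t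
  proof -
    have "(\<lambda>n. \<integral>\<omega>. iexp (t * X n \<omega>) \<partial>M) \<longlonglongrightarrow> (\<integral>\<omega>. iexp (t * Y \<omega>) \<partial>M)"
    proof (rule integral_dominated_convergence[where w="\<lambda>_. 1"])
      show "AE \<omega> in M. (\<lambda>n. iexp (t * X n \<omega>)) \<longlonglongrightarrow> iexp (t * Y \<omega>)"
        using lim by eventually_elim (intro tendsto_intros)
    qed auto
    then show ?thesis unfolding \<phi>_def char_def by (simp add: integral_distr)
  qed
  have lim_exp: "(\<lambda>n. exp (- (v n * t\<^sup>2) / 2)) \<longlonglongrightarrow> Re (\<phi> t)" for t
    using tendsto_Re[OF char_lim[of t]] X centered_normal_iff_char by simp
  \<comment> \<open>near the origin the limit is close to 1, so that its logarithm gives the limit variance\<close>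
  interpret dY: real_distribution "distr M borel Y" by (rule real_distribution_distr) simp
  have "isCont \<phi> 0" unfolding \<phi>_def by (rule dY.isCont_char)
  then have "isCont (\<lambda>t. Re (\<phi> t)) 0" by (rule continuous_Re)
  moreover have "Re (\<phi> 0) = 1" unfolding \<phi>_def by (simp add: dY.char_zero)
  ultimately have "((\<lambda>t. Re (\<phi> t)) \<longlongrightarrow> 1) (at 0)" by (simp add: isCont_def)
  then have "eventually (\<lambda>t. Re (\<phi> t) > 0) (at 0)"
    by (rule order_tendstoD) simp
  moreover have "eventually (\<lambda>t::real. t \<noteq> 0) (at 0)" by (simp add: eventually_at_filter)
  ultimately have "eventually (\<lambda>t. Re (\<phi> t) > 0 \<and> t \<noteq> 0) (at (0::real))"
    by (rule eventually_conj)
  then obtain t where t: "Re (\<phi> t) > 0" "t \<noteq> 0"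
    by (metis (mono_tags, lifting) eventually_happens trivial_limit_at)
  define w where "w = - 2 * ln (Re (\<phi> t)) / t\<^sup>2"
  have "(\<lambda>n. - 2 * ln (exp (- (v n * t\<^sup>2) / 2)) / t\<^sup>2) \<longlonglongrightarrow> w"
    unfolding w_def using t by (intro tendsto_intros lim_exp) auto
  then have vw: "v \<longlonglongrightarrow> w" using t by simp
  have w0: "w \<ge> 0" using vw centered_normalD(1)[OF X] by (metis LIMSEQ_le_const)
  have "char (distr M borel Y) s = of_real (exp (- (w * s\<^sup>2) / 2))" for s
  proof -
    have "(\<lambda>n. complex_of_real (exp (- (v n * s\<^sup>2) / 2))) \<longlonglongrightarrow> of_real (exp (- (w * s\<^sup>2) / 2))"
      by (intro tendsto_intros vw) simp
    moreover have "(\<lambda>n. complex_of_real (exp (- (v n * s\<^sup>2) / 2))) \<longlonglongrightarrow> \<phi> s"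
      using char_lim[of s] X centered_normal_iff_char by simp
    ultimately show ?thesis unfolding \<phi>_def by (metis LIMSEQ_unique)
  qed
  then have "centered_normal M Y w" using w0 by (subst centered_normal_iff_char) auto
  with vw show ?thesis by blast
qed

section \<open>Rotation invariance of standard normal vectors\<close>

lemma nn_integral_std_normal:
  "f \<in> borel_measurable borel \<Longrightarrow> (\<integral>\<^sup>+x. f x \<partial>std_normal_distribution)
     = (\<integral>\<^sup>+x. ennreal (std_normal_density x) * f x \<partial>lborel)"
  by (subst nn_integral_density) auto

text \<open>
  The change of variables is done one coordinate at a time, so that only the affine
  invariance of the Lebesgue measure on the line enters.
\<close>

lemma std_normal_rotation:
  fixes f :: "real \<Rightarrow> real \<Rightarrow> ennreal"
  assumes [measurable]: "(\<lambda>z. f (fst z) (snd z)) \<in> borel_measurable borel"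
  shows "(\<integral>\<^sup>+a. \<integral>\<^sup>+b. f ((a - b) / sqrt 2) ((a + b) / sqrt 2) \<partial>std_normal_distribution
      \<partial>std_normal_distribution) =
    (\<integral>\<^sup>+a. \<integral>\<^sup>+b. f a b \<partial>std_normal_distribution \<partial>std_normal_distribution)" (is "?L = ?R")
proof -
  let ?\<phi> = "\<lambda>x. ennreal (std_normal_density x)"
  have [measurable]: "(\<lambda>z. f (fst z) (snd z)) \<in> borel_measurable (borel \<Otimes>\<^sub>M borel)"
    using assms by (simp add: borel_prod)
  have mf [measurable]: "(\<lambda>x. f (g x) (h x)) \<in> borel_measurable N"
    if [measurable]: "g \<in> borel_measurable N" "h \<in> borel_measurable N" for N :: "'x measure" and g h
  proof -
    have "(\<lambda>x. (\<lambda>z. f (fst z) (snd z)) (g x, h x)) \<in> borel_measurable N" by measurable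
    then show ?thesis by simp
  qed
  have "?L = (\<integral>\<^sup>+a. \<integral>\<^sup>+b. ?\<phi> a * (?\<phi> b * f ((a - b) / sqrt 2) ((a + b) / sqrt 2)) \<partial>lborel \<partial>lborel)"
    by (simp add: nn_integral_std_normal nn_integral_cmult)
  also have "\<dots> = (\<integral>\<^sup>+b. \<integral>\<^sup>+a. ?\<phi> a * (?\<phi> b * f ((a - b) / sqrt 2) ((a + b) / sqrt 2)) \<partial>lborel \<partial>lborel)"
    by (rule lborel_pair.Fubini'[symmetric]) measurable
  \<comment> \<open>substitute \<open>a = b + sqrt 2 * u\<close>, and after exchanging the integrals \<open>b = (v - u) / sqrt 2\<close>\<close>
  also have "\<dots> = (\<integral>\<^sup>+b. \<integral>\<^sup>+u. ennreal (sqrt 2) * (?\<phi> (b + sqrt 2 * u) * (?\<phi> b * f u (u + sqrt 2 * b))) \<partial>lborel \<partial>lborel)"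
  proof (rule nn_integral_cong)
    fix b :: real
    have e: "(2 * b + sqrt 2 * u) / sqrt 2 = u + sqrt 2 * b" for u
      by (simp add: field_simps)
    show "(\<integral>\<^sup>+a. ?\<phi> a * (?\<phi> b * f ((a - b) / sqrt 2) ((a + b) / sqrt 2)) \<partial>lborel)
      = (\<integral>\<^sup>+u. ennreal (sqrt 2) * (?\<phi> (b + sqrt 2 * u) * (?\<phi> b * f u (u + sqrt 2 * b))) \<partial>lborel)"
      by (subst nn_integral_real_affine[where c="sqrt 2" and t=b])
        (auto simp: nn_integral_cmult e)
  qed
  also have "\<dots> = (\<integral>\<^sup>+u. \<integral>\<^sup>+b. ennreal (sqrt 2) * (?\<phi> (b + sqrt 2 * u) * (?\<phi> b * f u (u + sqrt 2 * b))) \<partial>lborel \<partial>lborel)"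
    by (rule lborel_pair.Fubini') measurable
  also have "\<dots> = (\<integral>\<^sup>+u. \<integral>\<^sup>+v. ?\<phi> u * (?\<phi> v * f u v) \<partial>lborel \<partial>lborel)"
  proof (rule nn_integral_cong)
    fix u :: real
    have e1: "- u / sqrt 2 + v / sqrt 2 + sqrt 2 * u = (u + v) / sqrt 2" for v
      by (simp add: field_simps)
    have e2: "u + sqrt 2 * (- u / sqrt 2 + v / sqrt 2) = v" for v
      by (simp add: field_simps)
    have dens: "std_normal_density ((u + v) / sqrt 2) * std_normal_density (- u / sqrt 2 + v / sqrt 2)
        = std_normal_density u * std_normal_density v" for v
    proof -
      have "- ((u + v) / sqrt 2)\<^sup>2 / 2 + - (- u / sqrt 2 + v / sqrt 2)\<^sup>2 / 2 = - u\<^sup>2 / 2 + - v\<^sup>2 / 2"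
        by (simp add: power_divide add_divide_distrib[symmetric]) (simp add: power2_eq_square field_simps)
      then have "exp (- ((u + v) / sqrt 2)\<^sup>2 / 2) * exp (- (- u / sqrt 2 + v / sqrt 2)\<^sup>2 / 2)
          = exp (- u\<^sup>2 / 2) * exp (- v\<^sup>2 / 2)"
        unfolding exp_add[symmetric] by simp
      then show ?thesis unfolding std_normal_density_def by (simp add: mult_ac)
    qed
    have "(\<integral>\<^sup>+b. ennreal (sqrt 2) * (?\<phi> (b + sqrt 2 * u) * (?\<phi> b * f u (u + sqrt 2 * b))) \<partial>lborel)
      = ennreal (1 / sqrt 2) * (\<integral>\<^sup>+v. ennreal (sqrt 2) *
        (?\<phi> ((u + v) / sqrt 2) * (?\<phi> (- u / sqrt 2 + v / sqrt 2) * f u v)) \<partial>lborel)"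
      by (subst nn_integral_real_affine[where c="1 / sqrt 2" and t="- u / sqrt 2"])
        (auto simp: e1[simplified] e2[simplified])
    also have "\<dots> = (\<integral>\<^sup>+v. ennreal (1 / sqrt 2) * (ennreal (sqrt 2) *
        (?\<phi> ((u + v) / sqrt 2) * (?\<phi> (- u / sqrt 2 + v / sqrt 2) * f u v))) \<partial>lborel)"
      by (subst nn_integral_cmult) auto
    also have "\<dots> = (\<integral>\<^sup>+v. ?\<phi> u * (?\<phi> v * f u v) \<partial>lborel)"
    proof (rule nn_integral_cong)
      fix v :: real
      have "ennreal (1 / sqrt 2) * (ennreal (sqrt 2) *
        (?\<phi> ((u + v) / sqrt 2) * (?\<phi> (- u / sqrt 2 + v / sqrt 2) * f u v)))
        = (ennreal (1 / sqrt 2) * ennreal (sqrt 2)) * 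
          ((?\<phi> ((u + v) / sqrt 2) * ?\<phi> (- u / sqrt 2 + v / sqrt 2)) * f u v)"
        by (simp only: mult_ac)
      also have "\<dots> = ennreal (1 / sqrt 2 * sqrt 2) *
          (ennreal (std_normal_density u * std_normal_density v) * f u v)"
        by (simp only: ennreal_mult[symmetric] dens normal_density_nonneg) (simp add: ennreal_mult[symmetric])
      also have "\<dots> = ?\<phi> u * (?\<phi> v * f u v)"
        by (simp add: ennreal_mult mult_ac)
      finally show "ennreal (1 / sqrt 2) * (ennreal (sqrt 2) *
        (?\<phi> ((u + v) / sqrt 2) * (?\<phi> (- u / sqrt 2 + v / sqrt 2) * f u v))) = ?\<phi> u * (?\<phi> v * f u v)" .
    qed
    finally show "(\<integral>\<^sup>+b. ennreal (sqrt 2) * (?\<phi> (b + sqrt 2 * u) * (?\<phi> b * f u (u + sqrt 2 * b))) \<partial>lborel)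
      = (\<integral>\<^sup>+v. ?\<phi> u * (?\<phi> v * f u v) \<partial>lborel)" .
  qed
  also have "\<dots> = ?R"
    by (simp add: nn_integral_std_normal nn_integral_cmult)
  finally show ?thesis .
qed

abbreviation std_normal_vec :: "'i set \<Rightarrow> ('i \<Rightarrow> real) measure" where
  "std_normal_vec I \<equiv> PiM I (\<lambda>_. std_normal_distribution)"

lemma prob_space_std_normal_vec: "prob_space (std_normal_vec I)"
  by (rule prob_space_PiM) (rule prob_space_normal_density, simp)

text \<open>
  By induction on the index set: splitting off one coordinate of both vectors reduces the claim to the planar case.
\<close>

lemma std_normal_vec_rotation:
  assumes "finite I"
    and "(\<lambda>z. f (fst z) (snd z)) \<in> borel_measurable (std_normal_vec I \<Otimes>\<^sub>M std_normal_vec I)"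
  shows "(\<integral>\<^sup>+g. \<integral>\<^sup>+h. f (\<lambda>i\<in>I. (g i - h i) / sqrt 2) (\<lambda>i\<in>I. (g i + h i) / sqrt 2)
      \<partial>std_normal_vec I \<partial>std_normal_vec I) =
    (\<integral>\<^sup>+g. \<integral>\<^sup>+h. (f g h :: ennreal) \<partial>std_normal_vec I \<partial>std_normal_vec I)"
  using assms
proof (induction I arbitrary: f)
  case empty
  show ?case by (simp add: PiM_empty nn_integral_count_space_finite)
next
  case (insert j I)
  let ?N = "std_normal_distribution" and ?D = "std_normal_vec I" and ?E = "std_normal_vec (insert j I)"
  interpret N: real_distribution ?N by (rule real_dist_normal_dist)
  interpret D: prob_space ?D by (rule prob_space_std_normal_vec)
  interpret E: prob_space ?E by (rule prob_space_std_normal_vec)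
  interpret P: product_sigma_finite "\<lambda>_. ?N" ..
  interpret DN: pair_sigma_finite ?N ?D ..
  have mf [measurable]: "(\<lambda>x. f (g x) (h x)) \<in> borel_measurable Q"
    if [measurable]: "g \<in> measurable Q ?E" "h \<in> measurable Q ?E" for Q :: "'x measure" and g h
  proof -
    have "(\<lambda>x. (\<lambda>z. f (fst z) (snd z)) (g x, h x)) \<in> borel_measurable Q"
      using insert.prems by measurable
    then show ?thesis by simp
  qed
  have split: "(\<integral>\<^sup>+g. \<integral>\<^sup>+h. F g h \<partial>?E \<partial>?E) = (\<integral>\<^sup>+g. \<integral>\<^sup>+h. \<integral>\<^sup>+a. \<integral>\<^sup>+b. F (g(j:=a)) (h(j:=b)) \<partial>?N \<partial>?N \<partial>?D \<partial>?D)"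
    if m: "\<And>Q::(('a \<Rightarrow> real) \<times> ('a \<Rightarrow> real)) measure. \<And>g h. g \<in> measurable Q ?E \<Longrightarrow> h \<in> measurable Q ?E \<Longrightarrow> (\<lambda>x. F (g x) (h x)) \<in> borel_measurable Q"
    for F :: "('a \<Rightarrow> real) \<Rightarrow> ('a \<Rightarrow> real) \<Rightarrow> ennreal"
  proof -
    have mp: "(\<lambda>z. F (fst z) (snd z)) \<in> borel_measurable (?E \<Otimes>\<^sub>M ?E)"
      by (rule m) auto
    have m' [measurable]: "(\<lambda>x. F (g x) (h x)) \<in> borel_measurable Q"
      if [measurable]: "g \<in> measurable Q ?E" "h \<in> measurable Q ?E" for Q :: "'x measure" and g h
    proof -
      have "(\<lambda>x. (\<lambda>z. F (fst z) (snd z)) (g x, h x)) \<in> borel_measurable Q"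
        using mp by measurable
      then show ?thesis by simp
    qed
    have "(\<integral>\<^sup>+g. \<integral>\<^sup>+h. F g h \<partial>?E \<partial>?E) = (\<integral>\<^sup>+g. \<integral>\<^sup>+a. \<integral>\<^sup>+h. F (g(j:=a)) h \<partial>?E \<partial>?N \<partial>?D)"
      using insert by (subst P.product_nn_integral_insert) auto
    also have "\<dots> = (\<integral>\<^sup>+g. \<integral>\<^sup>+a. \<integral>\<^sup>+h. \<integral>\<^sup>+b. F (g(j:=a)) (h(j:=b)) \<partial>?N \<partial>?D \<partial>?N \<partial>?D)"
    proof (rule nn_integral_cong, rule nn_integral_cong)
      fix g a
      assume "g \<in> space ?D"
      then have g: "g(j:=a) \<in> space ?E" by (auto simp: space_PiM PiE_def extensional_def)
      have "(\<lambda>h. F (g(j:=a)) h) \<in> borel_measurable ?E"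
        using m'[OF measurable_const[OF g] measurable_ident_sets[OF refl]] by simp
      then show "(\<integral>\<^sup>+h. F (g(j:=a)) h \<partial>?E) = (\<integral>\<^sup>+h. \<integral>\<^sup>+b. F (g(j:=a)) (h(j:=b)) \<partial>?N \<partial>?D)"
        using insert.hyps by (subst P.product_nn_integral_insert) auto
    qed
    also have "\<dots> = (\<integral>\<^sup>+g. \<integral>\<^sup>+h. \<integral>\<^sup>+a. \<integral>\<^sup>+b. F (g(j:=a)) (h(j:=b)) \<partial>?N \<partial>?N \<partial>?D \<partial>?D)"
      by (rule nn_integral_cong, rule DN.Fubini'[symmetric]) measurable
    finally show ?thesis .
  qed
  let ?A = "\<lambda>g h. \<integral>\<^sup>+a. \<integral>\<^sup>+b. f (g(j:=a)) (h(j:=b)) \<partial>?N \<partial>?N"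
  let ?m = "\<lambda>I g h. \<lambda>i\<in>I. (g i - h i) / sqrt 2" and ?p = "\<lambda>I g h. \<lambda>i\<in>I. (g i + h i) / sqrt 2"
  have "(\<integral>\<^sup>+g. \<integral>\<^sup>+h. f (?m (insert j I) g h) (?p (insert j I) g h) \<partial>?E \<partial>?E)
    = (\<integral>\<^sup>+g. \<integral>\<^sup>+h. \<integral>\<^sup>+a. \<integral>\<^sup>+b. f (?m (insert j I) (g(j:=a)) (h(j:=b))) (?p (insert j I) (g(j:=a)) (h(j:=b))) \<partial>?N \<partial>?N \<partial>?D \<partial>?D)"
  proof (rule split)
    fix Q :: "(('a \<Rightarrow> real) \<times> ('a \<Rightarrow> real)) measure" and g h
    assume [measurable]: "g \<in> measurable Q ?E" "h \<in> measurable Q ?E"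
    have [measurable]: "(\<lambda>x. w x i) \<in> borel_measurable Q" if w: "w \<in> measurable Q ?E" and i: "i \<in> insert j I" for i w
      using measurable_compose[OF w measurable_component_singleton[OF i]] by simp
    show "(\<lambda>x. f (?m (insert j I) (g x) (h x)) (?p (insert j I) (g x) (h x))) \<in> borel_measurable Q"
      by (intro mf measurable_restrict) simp_all
  qed
  also have "\<dots> = (\<integral>\<^sup>+g. \<integral>\<^sup>+h. \<integral>\<^sup>+a. \<integral>\<^sup>+b. f ((?m I g h)(j:=(a - b) / sqrt 2)) ((?p I g h)(j:=(a + b) / sqrt 2)) \<partial>?N \<partial>?N \<partial>?D \<partial>?D)"
  proof -
    have "?m (insert j I) (g(j:=a)) (h(j:=b)) = (?m I g h)(j:=(a - b) / sqrt 2)"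
      "?p (insert j I) (g(j:=a)) (h(j:=b)) = (?p I g h)(j:=(a + b) / sqrt 2)" for g h a b
      using insert.hyps by (auto simp: fun_eq_iff restrict_def)
    then show ?thesis by simp
  qed
  also have "\<dots> = (\<integral>\<^sup>+g. \<integral>\<^sup>+h. ?A (?m I g h) (?p I g h) \<partial>?D \<partial>?D)"
  proof (rule nn_integral_cong, rule nn_integral_cong)
    fix g h
    have u: "(\<lambda>z. (restrict w I)(j := fst z)) \<in> measurable borel ?E" 
       "(\<lambda>z. (restrict w I)(j := snd z)) \<in> measurable borel ?E" for w :: "'a \<Rightarrow> real"
      by (rule measurable_fun_upd[where J=I], auto simp: space_PiM borel_measurable_continuous_onI
          continuous_on_fst continuous_on_snd continuous_on_id)+
    show "(\<integral>\<^sup>+a. \<integral>\<^sup>+b. f ((?m I g h)(j:=(a - b) / sqrt 2)) ((?p I g h)(j:=(a + b) / sqrt 2)) \<partial>?N \<partial>?N)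
       = ?A (?m I g h) (?p I g h)"
      by (rule std_normal_rotation[where f="\<lambda>a b. f ((?m I g h)(j:=a)) ((?p I g h)(j:=b))"])
        (intro mf u)
  qed
  also have "\<dots> = (\<integral>\<^sup>+g. \<integral>\<^sup>+h. ?A g h \<partial>?D \<partial>?D)"
  proof (rule insert.IH[of "?A"])
    show "(\<lambda>z. ?A (fst z) (snd z)) \<in> borel_measurable (?D \<Otimes>\<^sub>M ?D)"
      by measurable
  qed
  also have "\<dots> = (\<integral>\<^sup>+g. \<integral>\<^sup>+h. f g h \<partial>?E \<partial>?E)"
    by (rule split[symmetric]) (rule mf)
  finally show ?case .
qed

section \<open>Gaussian linear spaces and concentration of quadratic forms\<close>

lemma nn_integral_exp_square_std_normal:
  assumes "c < 1 / 2"
  shows "(\<integral>\<^sup>+x. ennreal (exp (c * x\<^sup>2)) \<partial>std_normal_distribution) = ennreal (1 / sqrt (1 - 2 * c))"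
proof -
  define s where "s = 1 / sqrt (1 - 2 * c)"
  have s: "s > 0" "s\<^sup>2 = 1 / (1 - 2 * c)"
    using assms by (simp_all add: s_def power_divide)
  have e: "- x\<^sup>2 / 2 + c * x\<^sup>2 = - (x - 0)\<^sup>2 / (2 * s\<^sup>2)" for x
    unfolding s(2) using assms by (simp add: field_simps)
  have *: "std_normal_density x * exp (c * x\<^sup>2) = s * normal_density 0 s x" for x
  proof -
    have "std_normal_density x * exp (c * x\<^sup>2) = 1 / sqrt (2 * pi) * exp (- x\<^sup>2 / 2 + c * x\<^sup>2)"
      by (simp add: std_normal_density_def exp_add[symmetric])
    also have "\<dots> = s * normal_density 0 s x"
      unfolding e normal_density_def using s(1) by (simp add: real_sqrt_mult)
    finally show ?thesis .
  qed
  have "(\<integral>\<^sup>+x. ennreal (exp (c * x\<^sup>2)) \<partial>std_normal_distribution)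
      = (\<integral>\<^sup>+x. ennreal s * ennreal (normal_density 0 s x) \<partial>lborel)"
    by (subst nn_integral_density)
      (use s in \<open>auto intro!: nn_integral_cong simp: ennreal_mult[symmetric] *\<close>)
  also have "\<dots> = ennreal s * (\<integral>\<^sup>+x. ennreal (normal_density 0 s x) \<partial>lborel)"
    by (rule nn_integral_cmult) auto
  also have "(\<integral>\<^sup>+x. ennreal (normal_density 0 s x) \<partial>lborel) = 1"
    using s by (subst nn_integral_eq_integral) auto
  finally show ?thesis by (simp add: s_def)
qed

text \<open>
  Jensen's inequality for the exponential function; the right-hand side may be infinite.
\<close>

lemma (in prob_space) exp_expectation_le:
  assumes "integrable M Y"
  shows "ennreal (exp (expectation Y)) \<le> (\<integral>\<^sup>+\<omega>. ennreal (exp (Y \<omega>)) \<partial>M)"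
proof -
  have [measurable]: "Y \<in> borel_measurable M" using assms by auto
  show ?thesis
  proof (cases "integrable M (\<lambda>\<omega>. exp (Y \<omega>))")
    case True
    let ?m = "expectation Y"
    have tangent: "exp ?m * (1 + (y - ?m)) \<le> exp y" for y
    proof -
      have "exp ?m * (1 + (y - ?m)) \<le> exp ?m * exp (y - ?m)"
        by (intro mult_left_mono exp_ge_add_one_self) auto
      then show ?thesis by (simp add: exp_add[symmetric])
    qed
    have "exp ?m = expectation (\<lambda>\<omega>. exp ?m * (1 + (Y \<omega> - ?m)))"
      using assms by (simp add: prob_space)
    also have "\<dots> \<le> expectation (\<lambda>\<omega>. exp (Y \<omega>))"
      using True assms tangent by (intro integral_mono) auto
    finally show ?thesis using True by (subst nn_integral_eq_integral) auto
  next
    case False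
    then have "(\<integral>\<^sup>+\<omega>. ennreal (exp (Y \<omega>)) \<partial>M) = \<infinity>"
      by (subst (asm) integrable_iff_bounded) (auto simp: less_top[symmetric])
    then show ?thesis by simp
  qed
qed

text \<open>
  Being closed under linear combinations, such a space encodes joint normality of its members
  without reference to multivariate laws.
\<close>

definition gaussian_space :: "'a measure \<Rightarrow> ('a \<Rightarrow> real) set \<Rightarrow> bool" where
  "gaussian_space M L \<longleftrightarrow> (\<lambda>_. 0) \<in> L \<and>
     (\<forall>X\<in>L. \<forall>Y\<in>L. \<forall>c. (\<lambda>\<omega>. X \<omega> + c * Y \<omega>) \<in> L) \<and>
     (\<forall>X\<in>L. \<exists>v. centered_normal M X v)"

locale gaussian_linear_space = prob_space M for M :: "'a measure" and L :: "('a \<Rightarrow> real) set" +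
  assumes gaussian_space: "gaussian_space M L"
begin

lemma zero_mem: "(\<lambda>_. 0) \<in> L"
  and lin_mem: "X \<in> L \<Longrightarrow> Y \<in> L \<Longrightarrow> (\<lambda>\<omega>. X \<omega> + c * Y \<omega>) \<in> L"
  using gaussian_space unfolding gaussian_space_def by auto

lemma normal: "X \<in> L \<Longrightarrow> centered_normal M X (expectation (\<lambda>\<omega>. (X \<omega>)\<^sup>2))"
  using gaussian_space centered_normal_moments(2) unfolding gaussian_space_def by metis

lemma mem_measurable: "X \<in> L \<Longrightarrow> X \<in> borel_measurable M"
  using normal centered_normalD(2) by blast

lemma add_mem: "X \<in> L \<Longrightarrow> Y \<in> L \<Longrightarrow> (\<lambda>\<omega>. X \<omega> + Y \<omega>) \<in> L"
  using lin_mem[of X Y 1] by simp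

lemma sum_mem: "finite I \<Longrightarrow> (\<And>i. i \<in> I \<Longrightarrow> X i \<in> L) \<Longrightarrow> (\<lambda>\<omega>. \<Sum>i\<in>I. c i * X i \<omega>) \<in> L"
proof (induction I rule: finite_induct)
  case (insert i I)
  then have "(\<lambda>\<omega>. (\<Sum>i\<in>I. c i * X i \<omega>) + c i * X i \<omega>) \<in> L" by (intro lin_mem) auto
  then show ?case using insert by (simp add: add.commute)
qed (simp add: zero_mem)

lemma integrable_square: "X \<in> L \<Longrightarrow> integrable M (\<lambda>\<omega>. (X \<omega>)\<^sup>2)"
  using normal centered_normal_moments(1) by blast

lemma integrable_mult:
  assumes "X \<in> L" "Y \<in> L" shows "integrable M (\<lambda>\<omega>. X \<omega> * Y \<omega>)"
proof -
  have "(\<lambda>\<omega>. X \<omega> * Y \<omega>) = (\<lambda>\<omega>. ((X \<omega> + Y \<omega>)\<^sup>2 - (X \<omega>)\<^sup>2 - (Y \<omega>)\<^sup>2) / 2)"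
    by (auto simp: power2_eq_square algebra_simps)
  then show ?thesis
    using assms by (simp only:) (intro Bochner_Integration.integrable_diff integrable_divide integrable_square add_mem)
qed

lemma expectation_lin_mult:
  assumes "finite I" "\<And>i. i \<in> I \<Longrightarrow> X i \<in> L" "Y \<in> L"
  shows "expectation (\<lambda>\<omega>. (\<Sum>i\<in>I. c i * X i \<omega>) * Y \<omega>) = (\<Sum>i\<in>I. c i * expectation (\<lambda>\<omega>. X i \<omega> * Y \<omega>))"
proof -
  have "expectation (\<lambda>\<omega>. (\<Sum>i\<in>I. c i * X i \<omega>) * Y \<omega>) = expectation (\<lambda>\<omega>. \<Sum>i\<in>I. c i * (X i \<omega> * Y \<omega>))"
    by (simp add: sum_distrib_right mult.assoc)
  also have "\<dots> = (\<Sum>i\<in>I. c i * expectation (\<lambda>\<omega>. X i \<omega> * Y \<omega>))"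
    using assms by (subst Bochner_Integration.integral_sum) (auto intro!: integrable_mult)
  finally show ?thesis .
qed

lemma expectation_lin_square:
  assumes "finite I" "\<And>i. i \<in> I \<Longrightarrow> X i \<in> L"
  shows "expectation (\<lambda>\<omega>. (\<Sum>i\<in>I. c i * X i \<omega>)\<^sup>2)
    = (\<Sum>i\<in>I. \<Sum>j\<in>I. c i * c j * expectation (\<lambda>\<omega>. X i \<omega> * X j \<omega>))"
proof -
  have "expectation (\<lambda>\<omega>. (\<Sum>i\<in>I. c i * X i \<omega>)\<^sup>2)
    = (\<Sum>i\<in>I. c i * expectation (\<lambda>\<omega>. X i \<omega> * (\<Sum>j\<in>I. c j * X j \<omega>)))"
    unfolding power2_eq_square using assms by (intro expectation_lin_mult sum_mem) auto
  also have "\<dots> = (\<Sum>i\<in>I. c i * expectation (\<lambda>\<omega>. (\<Sum>j\<in>I. c j * X j \<omega>) * X i \<omega>))"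
    by (simp add: mult.commute)
  also have "\<dots> = (\<Sum>i\<in>I. c i * (\<Sum>j\<in>I. c j * expectation (\<lambda>\<omega>. X j \<omega> * X i \<omega>)))"
    using assms by (intro sum.cong refl arg_cong2[of _ _ _ _ "(*)"] expectation_lin_mult) auto
  finally show ?thesis by (simp add: sum_distrib_left mult_ac)
qed

end

definition cov_form :: "'i set \<Rightarrow> ('i \<Rightarrow> 'i \<Rightarrow> real) \<Rightarrow> ('i \<Rightarrow> real) \<Rightarrow> real" where
  "cov_form I C g = (\<Sum>i\<in>I. \<Sum>j\<in>I. g i * g j * C i j)"

text \<open>
  The Cauchy--Schwarz inequality with weights \<open>\<bar>C i j\<bar>\<close>; symmetry turns the bound on row sums into one on column sums.
\<close>

lemma schur_test:
  fixes C :: "'i \<Rightarrow> 'i \<Rightarrow> real"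
  assumes "finite I" and sym: "\<And>i j. i \<in> I \<Longrightarrow> j \<in> I \<Longrightarrow> C i j = C j i"
    and row: "\<And>i. i \<in> I \<Longrightarrow> (\<Sum>j\<in>I. \<bar>C i j\<bar>) \<le> \<rho>"
  shows "(\<Sum>i\<in>I. (\<Sum>j\<in>I. C i j * g j)\<^sup>2) \<le> \<rho>\<^sup>2 * (\<Sum>i\<in>I. (g i)\<^sup>2)"
proof (cases "I = {}")
  case False
  then have \<rho>: "\<rho> \<ge> 0" using row by (metis all_not_in_conv abs_ge_zero order_trans sum_nonneg)
  have "(\<Sum>i\<in>I. (\<Sum>j\<in>I. C i j * g j)\<^sup>2) \<le> (\<Sum>i\<in>I. \<rho> * (\<Sum>j\<in>I. \<bar>C i j\<bar> * (g j)\<^sup>2))"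
  proof (rule sum_mono)
    fix i assume i: "i \<in> I"
    have "(\<Sum>j\<in>I. C i j * g j)\<^sup>2 \<le> (\<Sum>j\<in>I. sqrt \<bar>C i j\<bar> * (sqrt \<bar>C i j\<bar> * \<bar>g j\<bar>))\<^sup>2"
    proof (rule power2_le_iff_abs_le[THEN iffD2])
      show "\<bar>\<Sum>j\<in>I. C i j * g j\<bar> \<le> (\<Sum>j\<in>I. sqrt \<bar>C i j\<bar> * (sqrt \<bar>C i j\<bar> * \<bar>g j\<bar>))"
        by (rule order_trans[OF sum_abs]) (simp add: abs_mult mult.assoc[symmetric])
    qed (simp add: sum_nonneg)
    also have "\<dots> \<le> (\<Sum>j\<in>I. (sqrt \<bar>C i j\<bar>)\<^sup>2) * (\<Sum>j\<in>I. (sqrt \<bar>C i j\<bar> * \<bar>g j\<bar>)\<^sup>2)"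
      by (rule Cauchy_Schwarz_ineq_sum)
    also have "\<dots> = (\<Sum>j\<in>I. \<bar>C i j\<bar>) * (\<Sum>j\<in>I. \<bar>C i j\<bar> * (g j)\<^sup>2)"
      by (simp add: power_mult_distrib)
    also have "\<dots> \<le> \<rho> * (\<Sum>j\<in>I. \<bar>C i j\<bar> * (g j)\<^sup>2)"
      using row[OF i] by (intro mult_right_mono sum_nonneg) auto
    finally show "(\<Sum>j\<in>I. C i j * g j)\<^sup>2 \<le> \<rho> * (\<Sum>j\<in>I. \<bar>C i j\<bar> * (g j)\<^sup>2)" .
  qed
  also have "\<dots> = \<rho> * (\<Sum>j\<in>I. (\<Sum>i\<in>I. \<bar>C j i\<bar>) * (g j)\<^sup>2)"
    by (subst sum_distrib_left[symmetric], subst sum.swap) (simp add: sum_distrib_right sym)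
  also have "\<dots> \<le> \<rho> * (\<Sum>j\<in>I. \<rho> * (g j)\<^sup>2)"
    using \<rho> row by (intro mult_left_mono sum_mono mult_right_mono) auto
  also have "\<dots> = \<rho>\<^sup>2 * (\<Sum>i\<in>I. (g i)\<^sup>2)"
    by (simp add: sum_distrib_left power2_eq_square mult_ac)
  finally show ?thesis .
qed simp

context
  fixes I :: "'i set"
  assumes fin: "finite I"
begin

interpretation N: real_distribution std_normal_distribution by (rule real_dist_normal_dist)
interpretation D: prob_space "std_normal_vec I" by (rule prob_space_std_normal_vec)
interpretation P: product_sigma_finite "\<lambda>_::'i. std_normal_distribution" ..

lemma std_normal_vec_component [measurable]:
  "i \<in> I \<Longrightarrow> (\<lambda>g. g i) \<in> borel_measurable (std_normal_vec I)"
  using measurable_component_singleton[of i I "\<lambda>_. std_normal_distribution"] by simp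

lemma std_normal_vec_nn_integral_exp:
  "(\<integral>\<^sup>+g. ennreal (exp (\<Sum>i\<in>I. c i * g i)) \<partial>std_normal_vec I) = ennreal (exp ((\<Sum>i\<in>I. (c i)\<^sup>2) / 2))"
proof -
  have "(\<integral>\<^sup>+g. ennreal (exp (\<Sum>i\<in>I. c i * g i)) \<partial>std_normal_vec I)
    = (\<integral>\<^sup>+g. (\<Prod>i\<in>I. ennreal (exp (c i * g i))) \<partial>std_normal_vec I)"
    by (simp add: exp_sum[OF fin] prod_ennreal)
  also have "\<dots> = (\<Prod>i\<in>I. ennreal (exp ((c i)\<^sup>2 / 2)))"
    by (subst P.product_nn_integral_prod[OF fin]) (auto simp: nn_integral_exp_std_normal)
  also have "\<dots> = ennreal (exp ((\<Sum>i\<in>I. (c i)\<^sup>2) / 2))"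
    by (simp add: exp_sum[OF fin] prod_ennreal sum_divide_distrib)
  finally show ?thesis .
qed

lemma std_normal_vec_nn_integral_exp_square:
  assumes "c < 1 / 2"
  shows "(\<integral>\<^sup>+g. ennreal (exp (c * (\<Sum>i\<in>I. (g i)\<^sup>2))) \<partial>std_normal_vec I)
    = ennreal ((1 / sqrt (1 - 2 * c)) ^ card I)"
proof -
  have "(\<integral>\<^sup>+g. ennreal (exp (c * (\<Sum>i\<in>I. (g i)\<^sup>2))) \<partial>std_normal_vec I)
    = (\<integral>\<^sup>+g. (\<Prod>i\<in>I. ennreal (exp (c * (g i)\<^sup>2))) \<partial>std_normal_vec I)"
    by (simp add: exp_sum[OF fin] prod_ennreal sum_distrib_left)
  also have "\<dots> = ennreal ((1 / sqrt (1 - 2 * c)) ^ card I)"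
    using assms by (subst P.product_nn_integral_prod[OF fin])
      (auto simp: nn_integral_exp_square_std_normal ennreal_power)
  finally show ?thesis .
qed

lemma std_normal_vec_char:
  "(\<integral>g. iexp (\<Sum>i\<in>I. c i * g i) \<partial>std_normal_vec I) = of_real (exp (- (\<Sum>i\<in>I. (c i)\<^sup>2) / 2))"
proof -
  have "(\<integral>g. iexp (\<Sum>i\<in>I. c i * g i) \<partial>std_normal_vec I)
    = (\<integral>g. (\<Prod>i\<in>I. iexp (c i * g i)) \<partial>std_normal_vec I)"
    by (simp add: exp_sum[OF fin] sum_distrib_left)
  also have "\<dots> = (\<Prod>i\<in>I. char std_normal_distribution (c i))"
    unfolding char_def
    by (subst P.product_integral_prod[OF fin]) (auto intro!: N.integrable_const_bound[where B=1])
  also have "\<dots> = of_real (exp (- (\<Sum>i\<in>I. (c i)\<^sup>2) / 2))"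
    by (simp add: char_std_normal_distribution exp_sum[OF fin, symmetric] sum_negf sum_divide_distrib flip: of_real_prod)
  finally show ?thesis .
qed

text \<open>
  The left-hand side is the expectation of \<open>exp (\<theta>(g'Cg - h'Ch))\<close> for independent \<open>g\<close> and \<open>h\<close>. Since
  \<open>g'Cg - h'Ch = (g - h)'C(g + h)\<close>, a rotation makes the exponent bilinear in two independent vectors. Integrating
  out one of them produces \<open>2\<theta>\<^sup>2\<close> times the squared length of the image of the other, which the Schur test bounds.
\<close>

lemma std_normal_vec_form_difference:
  fixes C :: "'i \<Rightarrow> 'i \<Rightarrow> real"
  assumes sym: "\<And>i j. i \<in> I \<Longrightarrow> j \<in> I \<Longrightarrow> C i j = C j i"
    and row: "\<And>i. i \<in> I \<Longrightarrow> (\<Sum>j\<in>I. \<bar>C i j\<bar>) \<le> \<rho>"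
    and \<theta>: "4 * \<theta>\<^sup>2 * \<rho>\<^sup>2 < 1"
  shows "(\<integral>\<^sup>+g. ennreal (exp (\<theta> * cov_form I C g)) \<partial>std_normal_vec I) *
      (\<integral>\<^sup>+h. ennreal (exp (- \<theta> * cov_form I C h)) \<partial>std_normal_vec I)
    \<le> ennreal ((1 / sqrt (1 - 4 * \<theta>\<^sup>2 * \<rho>\<^sup>2)) ^ card I)"
proof -
  let ?D = "std_normal_vec I"
  define f where "f u v = ennreal (exp (\<Sum>j\<in>I. (2 * \<theta> * (\<Sum>i\<in>I. C j i * u i)) * v j))"
    for u v :: "'i \<Rightarrow> real"
  have [measurable]: "(\<lambda>g. cov_form I C g) \<in> borel_measurable ?D"
    unfolding cov_form_def by measurable
  have diff: "\<theta> * cov_form I C g - \<theta> * cov_form I C h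
      = (\<Sum>j\<in>I. (2 * \<theta> * (\<Sum>i\<in>I. C j i * ((g i - h i) / sqrt 2))) * ((g j + h j) / sqrt 2))" for g h
  proof -
    have sw: "(\<Sum>j\<in>I. \<Sum>i\<in>I. C j i * (g i * h j)) = (\<Sum>j\<in>I. \<Sum>i\<in>I. C j i * (h i * g j))"
      by (subst sum.swap) (auto intro!: sum.cong simp: sym mult_ac)
    have half: "(2 * \<theta> * (\<Sum>i\<in>I. C j i * ((g i - h i) / sqrt 2))) * ((g j + h j) / sqrt 2)
      = \<theta> * (\<Sum>i\<in>I. C j i * ((g i - h i) * (g j + h j)))" for j
    proof -
      have "(\<Sum>i\<in>I. C j i * ((g i - h i) / sqrt 2)) = (\<Sum>i\<in>I. C j i * (g i - h i)) / sqrt 2"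
        by (simp add: sum_divide_distrib)
      moreover have "2 * \<theta> * (a / sqrt 2) * (b / sqrt 2) = \<theta> * (a * b)" for a b :: real
        by simp
      ultimately show ?thesis by (simp add: sum_distrib_right mult.assoc)
    qed
    have "(\<Sum>j\<in>I. (2 * \<theta> * (\<Sum>i\<in>I. C j i * ((g i - h i) / sqrt 2))) * ((g j + h j) / sqrt 2))
      = \<theta> * (\<Sum>j\<in>I. \<Sum>i\<in>I. C j i * ((g i - h i) * (g j + h j)))"
      unfolding half by (rule sum_distrib_left[symmetric])
    also have "(\<Sum>j\<in>I. \<Sum>i\<in>I. C j i * ((g i - h i) * (g j + h j)))
       = (\<Sum>j\<in>I. \<Sum>i\<in>I. C j i * (g i * g j)) + (\<Sum>j\<in>I. \<Sum>i\<in>I. C j i * (g i * h j))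
         - (\<Sum>j\<in>I. \<Sum>i\<in>I. C j i * (h i * g j)) - (\<Sum>j\<in>I. \<Sum>i\<in>I. C j i * (h i * h j))"
      by (simp add: sum.distrib[symmetric] sum_subtractf[symmetric] algebra_simps)
    also have "\<dots> = cov_form I C g - cov_form I C h"
      unfolding sw cov_form_def by (simp add: mult_ac sym cong: sum.cong)
    finally show ?thesis by (simp add: right_diff_distrib)
  qed
  have "(\<integral>\<^sup>+g. ennreal (exp (\<theta> * cov_form I C g)) \<partial>?D) * (\<integral>\<^sup>+h. ennreal (exp (- \<theta> * cov_form I C h)) \<partial>?D)
    = (\<integral>\<^sup>+g. \<integral>\<^sup>+h. ennreal (exp (\<theta> * cov_form I C g)) * ennreal (exp (- \<theta> * cov_form I C h)) \<partial>?D \<partial>?D)"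
    by (simp add: nn_integral_cmult nn_integral_multc)
  also have "\<dots> = (\<integral>\<^sup>+g. \<integral>\<^sup>+h. f (\<lambda>i\<in>I. (g i - h i) / sqrt 2) (\<lambda>i\<in>I. (g i + h i) / sqrt 2) \<partial>?D \<partial>?D)"
  proof -
    have "f (\<lambda>i\<in>I. (g i - h i) / sqrt 2) (\<lambda>i\<in>I. (g i + h i) / sqrt 2)
      = ennreal (exp (\<theta> * cov_form I C g - \<theta> * cov_form I C h))" for g h
      unfolding f_def diff by (simp only: restrict_apply' cong: sum.cong)
    then show ?thesis by (simp add: ennreal_mult[symmetric] exp_add[symmetric])
  qed
  also have "\<dots> = (\<integral>\<^sup>+u. \<integral>\<^sup>+v. f u v \<partial>?D \<partial>?D)"
    by (rule std_normal_vec_rotation[OF fin]) (unfold f_def, measurable)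
  also have "\<dots> = (\<integral>\<^sup>+u. ennreal (exp ((\<Sum>j\<in>I. (2 * \<theta> * (\<Sum>i\<in>I. C j i * u i))\<^sup>2) / 2)) \<partial>?D)"
    unfolding f_def by (simp only: std_normal_vec_nn_integral_exp)
  also have "\<dots> \<le> (\<integral>\<^sup>+u. ennreal (exp ((2 * \<theta>\<^sup>2 * \<rho>\<^sup>2) * (\<Sum>i\<in>I. (u i)\<^sup>2))) \<partial>?D)"
  proof (intro nn_integral_mono ennreal_leI)
    fix u :: "'i \<Rightarrow> real"
    have "(\<Sum>j\<in>I. (2 * \<theta> * (\<Sum>i\<in>I. C j i * u i))\<^sup>2) / 2 = 2 * \<theta>\<^sup>2 * (\<Sum>j\<in>I. (\<Sum>i\<in>I. C j i * u i)\<^sup>2)"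
      unfolding power_mult_distrib sum_distrib_left[symmetric] by simp
    also have "\<dots> \<le> 2 * \<theta>\<^sup>2 * (\<rho>\<^sup>2 * (\<Sum>i\<in>I. (u i)\<^sup>2))"
      by (intro mult_left_mono schur_test[OF fin sym row]) auto
    finally show "exp ((\<Sum>j\<in>I. (2 * \<theta> * (\<Sum>i\<in>I. C j i * u i))\<^sup>2) / 2)
      \<le> exp ((2 * \<theta>\<^sup>2 * \<rho>\<^sup>2) * (\<Sum>i\<in>I. (u i)\<^sup>2))" by (simp add: mult_ac)
  qed
  also have "\<dots> = ennreal ((1 / sqrt (1 - 2 * (2 * \<theta>\<^sup>2 * \<rho>\<^sup>2))) ^ card I)"
    using \<theta> by (intro std_normal_vec_nn_integral_exp_square) simp
  finally show ?thesis by (simp add: mult_ac)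
qed

end

text \<open>
  For the optimal \<open>\<theta>\<close> the exponent \<open>4\<theta>\<^sup>2\<rho>\<^sup>2 - \<theta>x\<close> equals \<open>-x\<^sup>2/(16\<rho>\<^sup>2)\<close>. The bound \<open>x \<le> 2\<rho>\<close> keeps
  \<open>4\<theta>\<^sup>2\<rho>\<^sup>2\<close> below \<open>1/4\<close>, where \<open>(1 - u)\<^sup>-\<^sup>1\<^sup>/\<^sup>2 \<le> exp u\<close>.
\<close>

lemma chernoff_factor:
  assumes "0 \<le> x" "x \<le> 2 * \<rho>" "\<rho> > 0" "\<theta> = x / (8 * \<rho>\<^sup>2)"
  shows "4 * \<theta>\<^sup>2 * \<rho>\<^sup>2 < 1"
    "exp (- \<theta> * (real n * x)) * (1 / sqrt (1 - 4 * \<theta>\<^sup>2 * \<rho>\<^sup>2)) ^ n \<le> exp (- real n * x\<^sup>2 / (16 * \<rho>\<^sup>2))"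
proof -
  define u where "u = 4 * \<theta>\<^sup>2 * \<rho>\<^sup>2"
  have u_eq: "u = x\<^sup>2 / (16 * \<rho>\<^sup>2)"
    using assms(3) unfolding u_def assms(4) by (simp add: power_divide power2_eq_square field_simps)
  have "x\<^sup>2 \<le> (2 * \<rho>)\<^sup>2" using assms by (intro power_mono) auto
  then have u: "0 \<le> u" "u \<le> 1 / 4" using assms unfolding u_eq by (simp_all add: field_simps power2_eq_square)
  then show "4 * \<theta>\<^sup>2 * \<rho>\<^sup>2 < 1" by (simp add: u_def[symmetric])
  have "1 / sqrt (1 - u) \<le> exp u"
  proof -
    have "exp (- 2 * u) = 1 / exp (2 * u)" by (simp add: exp_minus inverse_eq_divide)
    also have "\<dots> \<le> 1 / (1 + 2 * u)"
      using exp_ge_add_one_self[of "2 * u"] u by (intro divide_left_mono) auto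
    also have "\<dots> \<le> 1 - u"
    proof -
      have "0 \<le> u * (1 - 2 * u)" using u by simp
      then have "1 \<le> (1 - u) * (1 + 2 * u)" by (simp add: algebra_simps)
      then show ?thesis using u by (simp add: field_simps)
    qed
    finally have "(exp (- u))\<^sup>2 \<le> 1 - u" by (simp add: power2_eq_square exp_add[symmetric])
    then have "exp (- u) \<le> sqrt (1 - u)" by (simp add: real_le_rsqrt)
    then have "1 / sqrt (1 - u) \<le> 1 / exp (- u)"
      using u by (intro divide_left_mono) auto
    then show ?thesis by (simp add: exp_minus inverse_eq_divide)
  qed
  then have "(1 / sqrt (1 - u)) ^ n \<le> exp u ^ n" using u by (intro power_mono) auto
  then have "exp (- \<theta> * (real n * x)) * (1 / sqrt (1 - u)) ^ n \<le> exp (- \<theta> * (real n * x)) * exp u ^ n"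
    by (intro mult_left_mono) auto
  also have "\<dots> = exp (- real n * x\<^sup>2 / (16 * \<rho>\<^sup>2))"
  proof -
    have "- \<theta> * (real n * x) + real n * u = - real n * x\<^sup>2 / (16 * \<rho>\<^sup>2)"
      unfolding u_eq using assms by (simp add: field_simps power2_eq_square)
    then show ?thesis by (simp add: exp_of_nat_mult[symmetric] exp_add[symmetric])
  qed
  finally show "exp (- \<theta> * (real n * x)) * (1 / sqrt (1 - 4 * \<theta>\<^sup>2 * \<rho>\<^sup>2)) ^ n
    \<le> exp (- real n * x\<^sup>2 / (16 * \<rho>\<^sup>2))" by (simp add: u_def)
qed

context gaussian_linear_space
begin

text \<open>
  The Gaussian integral \<open>exp (\<theta>\<bar>w\<bar>\<^sup>2) = E exp (sqrt (2\<theta>) g \<bullet> w)\<close> makes the exponent linear in \<open>w\<close>, so that only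
  the laws of linear combinations are used after exchanging the integrals. The characteristic function
  plays the same part for the negative sign.
\<close>

lemma laplace_square_sum:
  assumes fin: "finite I" and w: "\<And>i. i \<in> I \<Longrightarrow> w i \<in> L" and \<theta>: "\<theta> \<ge> 0"
  defines "C \<equiv> \<lambda>i j. expectation (\<lambda>\<omega>. w i \<omega> * w j \<omega>)"
  shows "(\<integral>\<^sup>+\<omega>. ennreal (exp (\<theta> * (\<Sum>i\<in>I. (w i \<omega>)\<^sup>2))) \<partial>M)
      = (\<integral>\<^sup>+g. ennreal (exp (\<theta> * cov_form I C g)) \<partial>std_normal_vec I)"
    and "(\<integral>\<^sup>+\<omega>. ennreal (exp (- \<theta> * (\<Sum>i\<in>I. (w i \<omega>)\<^sup>2))) \<partial>M)
      = (\<integral>\<^sup>+g. ennreal (exp (- \<theta> * cov_form I C g)) \<partial>std_normal_vec I)"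
proof -
  let ?D = "std_normal_vec I" and ?c = "sqrt (2 * \<theta>)"
  interpret D: prob_space ?D by (rule prob_space_std_normal_vec)
  interpret MD: pair_prob_space M ?D ..
  note std_normal_vec_component[OF fin, measurable]
  have [measurable]: "w i \<in> borel_measurable M" if "i \<in> I" for i
    using w[OF that] by (rule mem_measurable)
  have sq: "?c\<^sup>2 = 2 * \<theta>" using \<theta> by simp
  have normal_comb: "centered_normal M (\<lambda>\<omega>. \<Sum>i\<in>I. g i * w i \<omega>) (cov_form I C g)" for g
    using normal[OF sum_mem[where I=I and X=w and c=g, OF fin w]] expectation_lin_square[where I=I and X=w and c=g, OF fin w]
    unfolding cov_form_def C_def by simp
  have lin: "(\<Sum>i\<in>I. (?c * w i \<omega>) * g i) = ?c * (\<Sum>i\<in>I. g i * w i \<omega>)" for g \<omega>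
    by (simp add: sum_distrib_left mult_ac)
  have "(\<integral>\<^sup>+\<omega>. ennreal (exp (\<theta> * (\<Sum>i\<in>I. (w i \<omega>)\<^sup>2))) \<partial>M)
    = (\<integral>\<^sup>+\<omega>. \<integral>\<^sup>+g. ennreal (exp (\<Sum>i\<in>I. (?c * w i \<omega>) * g i)) \<partial>?D \<partial>M)"
    unfolding std_normal_vec_nn_integral_exp[OF fin]
    using \<theta> by (simp add: power_mult_distrib sum_distrib_left sum_divide_distrib)
  also have "\<dots> = (\<integral>\<^sup>+\<omega>. \<integral>\<^sup>+g. ennreal (exp (?c * (\<Sum>i\<in>I. g i * w i \<omega>))) \<partial>?D \<partial>M)"
    by (simp only: lin)
  also have "\<dots> = (\<integral>\<^sup>+g. \<integral>\<^sup>+\<omega>. ennreal (exp (?c * (\<Sum>i\<in>I. g i * w i \<omega>))) \<partial>M \<partial>?D)"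
    by (rule MD.Fubini'[symmetric]) measurable
  also have "\<dots> = (\<integral>\<^sup>+g. ennreal (exp (\<theta> * cov_form I C g)) \<partial>?D)"
    unfolding centered_normal_nn_integral_exp[OF normal_comb] sq by simp
  finally show "(\<integral>\<^sup>+\<omega>. ennreal (exp (\<theta> * (\<Sum>i\<in>I. (w i \<omega>)\<^sup>2))) \<partial>M)
      = (\<integral>\<^sup>+g. ennreal (exp (\<theta> * cov_form I C g)) \<partial>?D)" .
  have pos: "cov_form I C g \<ge> 0" for g
    using centered_normalD(1)[OF normal_comb] .
  have [measurable]: "(\<lambda>g. cov_form I C g) \<in> borel_measurable ?D"
    unfolding cov_form_def by measurable
  have int1: "integrable M (\<lambda>\<omega>. exp (- \<theta> * (\<Sum>i\<in>I. (w i \<omega>)\<^sup>2)))"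
    using \<theta> by (intro integrable_const_bound[where B=1]) (auto intro!: sum_nonneg mult_nonneg_nonneg)
  have int2: "integrable ?D (\<lambda>g. exp (- \<theta> * cov_form I C g))"
    using \<theta> pos by (intro D.integrable_const_bound[where B=1]) auto
  have "complex_of_real (\<integral>\<omega>. exp (- \<theta> * (\<Sum>i\<in>I. (w i \<omega>)\<^sup>2)) \<partial>M)
    = (\<integral>\<omega>. of_real (exp (- \<theta> * (\<Sum>i\<in>I. (w i \<omega>)\<^sup>2))) \<partial>M)"
    by (rule integral_complex_of_real[symmetric])
  also have "\<dots> = (\<integral>\<omega>. \<integral>g. iexp (\<Sum>i\<in>I. (?c * w i \<omega>) * g i) \<partial>?D \<partial>M)"
    unfolding std_normal_vec_char[OF fin]
    using \<theta> by (simp add: power_mult_distrib sum_distrib_left sum_divide_distrib sum_negf)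
  also have "\<dots> = (\<integral>\<omega>. \<integral>g. iexp (?c * (\<Sum>i\<in>I. g i * w i \<omega>)) \<partial>?D \<partial>M)"
    by (simp only: lin)
  also have "\<dots> = (\<integral>g. \<integral>\<omega>. iexp (?c * (\<Sum>i\<in>I. g i * w i \<omega>)) \<partial>M \<partial>?D)"
    by (rule MD.Fubini_integral[symmetric]) (auto intro!: MD.integrable_const_bound[where B=1])
  also have "\<dots> = (\<integral>g. of_real (exp (- \<theta> * cov_form I C g)) \<partial>?D)"
  proof (rule Bochner_Integration.integral_cong[OF refl])
    fix g
    have m: "(\<lambda>\<omega>. \<Sum>i\<in>I. g i * w i \<omega>) \<in> borel_measurable M" by measurable
    have "(\<integral>\<omega>. iexp (?c * (\<Sum>i\<in>I. g i * w i \<omega>)) \<partial>M) = char (distr M borel (\<lambda>\<omega>. \<Sum>i\<in>I. g i * w i \<omega>)) ?c"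
      unfolding char_def using m by (subst integral_distr) auto
    also have "\<dots> = of_real (exp (- (cov_form I C g * ?c\<^sup>2) / 2))"
      using normal_comb[of g] unfolding centered_normal_iff_char by blast
    finally show "(\<integral>\<omega>. iexp (?c * (\<Sum>i\<in>I. g i * w i \<omega>)) \<partial>M) = of_real (exp (- \<theta> * cov_form I C g))"
      unfolding sq by (simp add: mult_ac)
  qed
  also have "\<dots> = of_real (\<integral>g. exp (- \<theta> * cov_form I C g) \<partial>?D)"
    by (rule integral_complex_of_real)
  finally have "(\<integral>\<omega>. exp (- \<theta> * (\<Sum>i\<in>I. (w i \<omega>)\<^sup>2)) \<partial>M) = (\<integral>g. exp (- \<theta> * cov_form I C g) \<partial>?D)"
    by (simp only: of_real_eq_iff)
  then show "(\<integral>\<^sup>+\<omega>. ennreal (exp (- \<theta> * (\<Sum>i\<in>I. (w i \<omega>)\<^sup>2))) \<partial>M)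
      = (\<integral>\<^sup>+g. ennreal (exp (- \<theta> * cov_form I C g)) \<partial>?D)"
    using int1 int2 by (simp add: nn_integral_eq_integral)
qed

text \<open>
  A Hanson--Wright inequality with the operator norm of the covariance matrix replaced by a bound on its row sums.
  Both tails are bounded by the same product of Laplace transforms, since Jensen's inequality replaces
  \<open>exp (\<mp>\<theta>EQ)\<close> by the Laplace transform of the opposite sign.
\<close>

theorem square_sum_concentration:
  assumes fin: "finite I" and w: "\<And>i. i \<in> I \<Longrightarrow> w i \<in> L"
    and row: "\<And>i. i \<in> I \<Longrightarrow> (\<Sum>j\<in>I. \<bar>expectation (\<lambda>\<omega>. w i \<omega> * w j \<omega>)\<bar>) \<le> \<rho>"
    and \<rho>: "\<rho> > 0" and x: "0 \<le> x" "x \<le> 2 * \<rho>"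
  shows "prob {\<omega> \<in> space M. real (card I) * x \<le>
      \<bar>(\<Sum>i\<in>I. (w i \<omega>)\<^sup>2) - (\<Sum>i\<in>I. expectation (\<lambda>\<omega>. (w i \<omega>)\<^sup>2))\<bar>}
    \<le> 2 * exp (- real (card I) * x\<^sup>2 / (16 * \<rho>\<^sup>2))"
proof -
  define \<theta> where "\<theta> = x / (8 * \<rho>\<^sup>2)"
  define Q where "Q \<omega> = (\<Sum>i\<in>I. (w i \<omega>)\<^sup>2)" for \<omega>
  define t where "t = real (card I) * x"
  define R where "R = (1 / sqrt (1 - 4 * \<theta>\<^sup>2 * \<rho>\<^sup>2)) ^ card I"
  define b where "b = exp (- real (card I) * x\<^sup>2 / (16 * \<rho>\<^sup>2))"
  let ?m = "expectation Q"
  let ?A = "\<integral>\<^sup>+\<omega>. ennreal (exp (\<theta> * Q \<omega>)) \<partial>M" and ?B = "\<integral>\<^sup>+\<omega>. ennreal (exp (- \<theta> * Q \<omega>)) \<partial>M"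
  have \<theta>: "\<theta> \<ge> 0" using x \<rho> by (simp add: \<theta>_def)
  note cf = chernoff_factor(1)[OF x \<rho> \<theta>_def] chernoff_factor(2)[OF x \<rho> \<theta>_def, of "card I"]
  have R0: "R \<ge> 0" using cf(1) by (simp add: R_def)
  have bound: "exp (- \<theta> * t) * R \<le> b" using cf(2) by (simp add: R_def t_def b_def)
  have [measurable]: "w i \<in> borel_measurable M" if "i \<in> I" for i
    using w[OF that] by (rule mem_measurable)
  have [measurable]: "Q \<in> borel_measurable M" unfolding Q_def by measurable
  have intQ: "integrable M Q" unfolding Q_def using w by (auto intro!: integrable_square)
  have AB: "?A * ?B \<le> ennreal R"
  proof -
    let ?C = "\<lambda>i j. expectation (\<lambda>\<omega>. w i \<omega> * w j \<omega>)"
    have "?A = (\<integral>\<^sup>+g. ennreal (exp (\<theta> * cov_form I ?C g)) \<partial>std_normal_vec I)"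
      unfolding Q_def by (rule laplace_square_sum(1)[OF fin w \<theta>])
    moreover have "?B = (\<integral>\<^sup>+g. ennreal (exp (- \<theta> * cov_form I ?C g)) \<partial>std_normal_vec I)"
      unfolding Q_def by (rule laplace_square_sum(2)[OF fin w \<theta>])
    moreover have "(\<integral>\<^sup>+g. ennreal (exp (\<theta> * cov_form I ?C g)) \<partial>std_normal_vec I) *
      (\<integral>\<^sup>+g. ennreal (exp (- \<theta> * cov_form I ?C g)) \<partial>std_normal_vec I) \<le> ennreal R"
      unfolding R_def by (rule std_normal_vec_form_difference[OF fin _ row cf(1)]) (simp_all add: mult.commute)
    ultimately show ?thesis by simp
  qed
  have A: "ennreal (exp (\<theta> * ?m)) \<le> ?A"
    using exp_expectation_le[of "\<lambda>\<omega>. \<theta> * Q \<omega>"] intQ by simp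
  have B: "ennreal (exp (- \<theta> * ?m)) \<le> ?B"
    using exp_expectation_le[of "\<lambda>\<omega>. - \<theta> * Q \<omega>"] intQ by simp
  have tail: "prob {\<omega> \<in> space M. s * (Q \<omega> - ?m) \<ge> t} \<le> b"
    if s: "s = 1 \<or> s = -1" for s :: real
  proof -
    let ?S = "{\<omega> \<in> space M. s * (Q \<omega> - ?m) \<ge> t}"
    have "emeasure M ?S = (\<integral>\<^sup>+\<omega>. indicator ?S \<omega> \<partial>M)" by simp
    also have "\<dots> \<le> (\<integral>\<^sup>+\<omega>. ennreal (exp (- \<theta> * t)) * (ennreal (exp (- (s * \<theta>) * ?m)) * ennreal (exp (s * \<theta> * Q \<omega>))) \<partial>M)"
    proof (rule nn_integral_mono)
      fix \<omega>
      have "1 \<le> exp (- \<theta> * t + (- (s * \<theta>) * ?m + s * \<theta> * Q \<omega>))" if "\<omega> \<in> ?S"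
      proof -
        have "\<theta> * t \<le> \<theta> * (s * (Q \<omega> - ?m))" using that \<theta> by (intro mult_left_mono) auto
        then have "- \<theta> * t + (- (s * \<theta>) * ?m + s * \<theta> * Q \<omega>) \<ge> 0" by (simp add: algebra_simps)
        then show ?thesis by simp
      qed
      then show "indicator ?S \<omega> \<le> ennreal (exp (- \<theta> * t)) * (ennreal (exp (- (s * \<theta>) * ?m)) * ennreal (exp (s * \<theta> * Q \<omega>)))"
        by (auto simp: indicator_def ennreal_mult[symmetric] exp_add[symmetric] simp del: ennreal_1 simp flip: ennreal_1)
    qed
    also have "\<dots> = ennreal (exp (- \<theta> * t)) * (ennreal (exp (- (s * \<theta>) * ?m)) * (\<integral>\<^sup>+\<omega>. ennreal (exp (s * \<theta> * Q \<omega>)) \<partial>M))"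
      by (simp add: nn_integral_cmult)
    also have "\<dots> \<le> ennreal (exp (- \<theta> * t)) * ennreal R"
    proof (rule mult_left_mono)
      show "ennreal (exp (- (s * \<theta>) * ?m)) * (\<integral>\<^sup>+\<omega>. ennreal (exp (s * \<theta> * Q \<omega>)) \<partial>M) \<le> ennreal R"
        using s
      proof
        assume [simp]: "s = 1"
        show ?thesis using order_trans[OF mult_mono[OF order_refl B] AB] by (simp add: mult.commute)
      next
        assume [simp]: "s = -1"
        show ?thesis using order_trans[OF mult_mono[OF A order_refl] AB] by simp
      qed
    qed simp
    also have "\<dots> \<le> ennreal b" using bound R0 by (simp add: ennreal_mult[symmetric] ennreal_leI)
    finally show ?thesis by (simp add: emeasure_eq_measure b_def)
  qed
  have m: "?m = (\<Sum>i\<in>I. expectation (\<lambda>\<omega>. (w i \<omega>)\<^sup>2))"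
    unfolding Q_def using w by (intro Bochner_Integration.integral_sum) (auto intro!: integrable_square)
  have "prob {\<omega> \<in> space M. t \<le> \<bar>Q \<omega> - ?m\<bar>}
    \<le> prob ({\<omega> \<in> space M. 1 * (Q \<omega> - ?m) \<ge> t} \<union> {\<omega> \<in> space M. (-1) * (Q \<omega> - ?m) \<ge> t})"
    by (intro finite_measure_mono) auto
  also have "\<dots> \<le> b + b"
    by (rule order_trans[OF measure_Un_le]) (use tail[of 1] tail[of "-1"] in simp_all)
  finally show ?thesis unfolding m by (simp add: b_def t_def Q_def)
qed

text \<open>
  Polarisation: a product is a quarter of the difference of the squares of sum and difference.
\<close>

corollary product_sum_concentration:
  assumes fin: "finite I" and u: "\<And>i. i \<in> I \<Longrightarrow> u i \<in> L" and v: "\<And>i. i \<in> I \<Longrightarrow> v i \<in> L"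
    and row: "\<And>i. i \<in> I \<Longrightarrow> (\<Sum>j\<in>I. \<bar>expectation (\<lambda>\<omega>. u i \<omega> * u j \<omega>)\<bar> + \<bar>expectation (\<lambda>\<omega>. u i \<omega> * v j \<omega>)\<bar>
      + \<bar>expectation (\<lambda>\<omega>. v i \<omega> * u j \<omega>)\<bar> + \<bar>expectation (\<lambda>\<omega>. v i \<omega> * v j \<omega>)\<bar>) \<le> \<rho>"
    and \<rho>: "\<rho> > 0" and x: "0 \<le> x" "x \<le> \<rho>"
  shows "prob {\<omega> \<in> space M. real (card I) * x \<le>
      \<bar>(\<Sum>i\<in>I. u i \<omega> * v i \<omega>) - (\<Sum>i\<in>I. expectation (\<lambda>\<omega>. u i \<omega> * v i \<omega>))\<bar>}
    \<le> 4 * exp (- real (card I) * x\<^sup>2 / (4 * \<rho>\<^sup>2))"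
proof -
  define w where "w s i \<omega> = u i \<omega> + s * v i \<omega>" for s i \<omega>
  define Q where "Q s \<omega> = (\<Sum>i\<in>I. (w s i \<omega>)\<^sup>2) - (\<Sum>i\<in>I. expectation (\<lambda>\<omega>. (w s i \<omega>)\<^sup>2))" for s \<omega>
  have wL: "w s i \<in> L" if "i \<in> I" for s i unfolding w_def using u v that by (intro lin_mem)
  have ww: "expectation (\<lambda>\<omega>. w s i \<omega> * w s j \<omega>) = expectation (\<lambda>\<omega>. u i \<omega> * u j \<omega>) + s * expectation (\<lambda>\<omega>. u i \<omega> * v j \<omega>)
    + s * expectation (\<lambda>\<omega>. v i \<omega> * u j \<omega>) + s * s * expectation (\<lambda>\<omega>. v i \<omega> * v j \<omega>)" if "i \<in> I" "j \<in> I" for s i j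
  proof -
    have "expectation (\<lambda>\<omega>. w s i \<omega> * w s j \<omega>) = expectation (\<lambda>\<omega>. u i \<omega> * u j \<omega> + s * (u i \<omega> * v j \<omega>)
      + s * (v i \<omega> * u j \<omega>) + s * s * (v i \<omega> * v j \<omega>))"
      unfolding w_def by (rule Bochner_Integration.integral_cong[OF refl]) (simp add: algebra_simps)
    then show ?thesis using u v that by (simp add: integrable_mult)
  qed
  have [measurable]: "w s i \<in> borel_measurable M" if "i \<in> I" for s i
    using wL[OF that] by (rule mem_measurable)
  have [measurable]: "Q s \<in> borel_measurable M" for s unfolding Q_def by measurable
  \<comment> \<open>if a quarter of a difference is at least \<open>x\<close>, then one of the two terms is at least \<open>2x\<close> in absolute value\<close>
  have tail: "prob {\<omega> \<in> space M. real (card I) * (2 * x) \<le> \<bar>Q s \<omega>\<bar>}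
      \<le> 2 * exp (- real (card I) * x\<^sup>2 / (4 * \<rho>\<^sup>2))" if s: "s = 1 \<or> s = -1" for s
  proof -
    have "prob {\<omega> \<in> space M. real (card I) * (2 * x) \<le> \<bar>Q s \<omega>\<bar>}
      \<le> 2 * exp (- real (card I) * (2 * x)\<^sup>2 / (16 * \<rho>\<^sup>2))"
      unfolding Q_def
    proof (rule square_sum_concentration[OF fin wL _ \<rho>])
      fix i assume i: "i \<in> I"
      have "(\<Sum>j\<in>I. \<bar>expectation (\<lambda>\<omega>. w s i \<omega> * w s j \<omega>)\<bar>) \<le> (\<Sum>j\<in>I. \<bar>expectation (\<lambda>\<omega>. u i \<omega> * u j \<omega>)\<bar> + \<bar>expectation (\<lambda>\<omega>. u i \<omega> * v j \<omega>)\<bar>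
      + \<bar>expectation (\<lambda>\<omega>. v i \<omega> * u j \<omega>)\<bar> + \<bar>expectation (\<lambda>\<omega>. v i \<omega> * v j \<omega>)\<bar>)"
        using s by (intro sum_mono) (auto simp: ww[OF i])
      then show "(\<Sum>j\<in>I. \<bar>expectation (\<lambda>\<omega>. w s i \<omega> * w s j \<omega>)\<bar>) \<le> \<rho>" using row[OF i] by simp
    qed (use x in auto)
    then show ?thesis by (simp add: power_mult_distrib)
  qed
  have uv: "(\<Sum>i\<in>I. u i \<omega> * v i \<omega>) - (\<Sum>i\<in>I. expectation (\<lambda>\<omega>. u i \<omega> * v i \<omega>)) = (Q 1 \<omega> - Q (-1) \<omega>) / 4" for \<omega>
  proof -
    have "u i \<omega> * v i \<omega> - expectation (\<lambda>\<omega>. u i \<omega> * v i \<omega>) = (((w 1 i \<omega>)\<^sup>2 - expectation (\<lambda>\<omega>. (w 1 i \<omega>)\<^sup>2))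
        - ((w (-1) i \<omega>)\<^sup>2 - expectation (\<lambda>\<omega>. (w (-1) i \<omega>)\<^sup>2))) / 4" if "i \<in> I" for i
      using ww[OF that that, of 1] ww[OF that that, of "-1"]
      by (simp add: power2_eq_square mult.commute[of "v i _" "u i _"]) (simp add: w_def algebra_simps)
    then have "(\<Sum>i\<in>I. u i \<omega> * v i \<omega> - expectation (\<lambda>\<omega>. u i \<omega> * v i \<omega>)) = (\<Sum>i\<in>I. (((w 1 i \<omega>)\<^sup>2 - expectation (\<lambda>\<omega>. (w 1 i \<omega>)\<^sup>2))
        - ((w (-1) i \<omega>)\<^sup>2 - expectation (\<lambda>\<omega>. (w (-1) i \<omega>)\<^sup>2))) / 4)"
      by (rule sum.cong[OF refl])
    then show ?thesis unfolding Q_def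
      by (simp add: sum_subtractf sum_divide_distrib[symmetric])
  qed
  have "prob {\<omega> \<in> space M. real (card I) * x \<le> \<bar>(\<Sum>i\<in>I. u i \<omega> * v i \<omega>) - (\<Sum>i\<in>I. expectation (\<lambda>\<omega>. u i \<omega> * v i \<omega>))\<bar>}
    \<le> prob ({\<omega> \<in> space M. real (card I) * (2 * x) \<le> \<bar>Q 1 \<omega>\<bar>} \<union> {\<omega> \<in> space M. real (card I) * (2 * x) \<le> \<bar>Q (-1) \<omega>\<bar>})"
    unfolding uv by (intro finite_measure_mono) auto
  also have "\<dots> \<le> 2 * exp (- real (card I) * x\<^sup>2 / (4 * \<rho>\<^sup>2)) + 2 * exp (- real (card I) * x\<^sup>2 / (4 * \<rho>\<^sup>2))"
    by (rule order_trans[OF measure_Un_le]) (use tail[of 1] tail[of "-1"] in simp_all)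
  finally show ?thesis by simp
qed

end

section \<open>Weighted l1-penalised least squares\<close>

definition gram :: "real mat \<Rightarrow> nat \<Rightarrow> nat \<Rightarrow> real" where
  "gram X a b = (\<Sum>r<dim_row X. X $$ (r, a) * X $$ (r, b)) / real (dim_row X)"

definition score :: "real mat \<Rightarrow> (nat \<Rightarrow> real) \<Rightarrow> nat \<Rightarrow> real" where
  "score X e a = (\<Sum>r<dim_row X. X $$ (r, a) * e r) / real (dim_row X)"

definition qform :: "nat \<Rightarrow> (nat \<Rightarrow> nat \<Rightarrow> real) \<Rightarrow> (nat \<Rightarrow> real) \<Rightarrow> real" where
  "qform N G d = (\<Sum>a<N. \<Sum>b<N. d a * G a b * d b)"

text \<open>
  The first-order condition of a minimiser \<open>b\<close> over the vectors supported in \<open>D\<close>, in terms of the Gram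
  matrix \<open>G\<close>, the score \<open>\<nu>\<close> and the true parameter \<open>bs\<close>. Stating it as a variational inequality avoids subgradients.
\<close>

definition penalised_stationary ::
    "nat \<Rightarrow> (nat \<Rightarrow> nat \<Rightarrow> real) \<Rightarrow> (nat \<Rightarrow> real) \<Rightarrow> real \<Rightarrow> (nat \<Rightarrow> real) \<Rightarrow> nat set \<Rightarrow>
      (nat \<Rightarrow> real) \<Rightarrow> (nat \<Rightarrow> real) \<Rightarrow> bool" where
  "penalised_stationary N G \<nu> lam w D bs b \<longleftrightarrow>
     (\<forall>j<N. j \<notin> D \<longrightarrow> b j = 0) \<and>
     (\<forall>\<gamma>. (\<forall>j<N. j \<notin> D \<longrightarrow> \<gamma> j = 0) \<longrightarrow>
       (\<Sum>j<N. (\<gamma> j - b j) * (\<nu> j - (\<Sum>l<N. G j l * (b l - bs l))))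
         \<le> lam * (\<Sum>j\<in>D. w j * (\<bar>\<gamma> j\<bar> - \<bar>b j\<bar>)))"

lemma vnorm_square: "(vnorm v)\<^sup>2 = (\<Sum>r<dim_vec v. (v $ r)\<^sup>2)"
  by (simp add: vnorm_def l2_on_def L2_set_def sum_nonneg)

lemma mult_mat_vec_index_sum:
  "r < dim_row X \<Longrightarrow> dim_vec v = dim_col X \<Longrightarrow> (X *\<^sub>v v) $ r = (\<Sum>a<dim_col X. X $$ (r, a) * v $ a)"
  by (simp add: scalar_prod_def atLeast0LessThan)

lemma nonneg_if_le_linear:
  fixes A q :: real
  assumes "\<And>t. 0 < t \<Longrightarrow> t \<le> 1 \<Longrightarrow> A \<le> t * q"
  shows "A \<le> 0"
proof (rule tendsto_lowerbound[of "\<lambda>t. t * q" 0 "at_right 0"])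
  have "((\<lambda>t. t * q) \<longlongrightarrow> 0 * q) (at_right 0)" by (intro tendsto_intros)
  then show "((\<lambda>t. t * q) \<longlongrightarrow> 0) (at_right 0)" by simp
  show "\<forall>\<^sub>F t in at_right 0. A \<le> t * q"
    unfolding eventually_at_right_field by (intro exI[of _ 1]) (use assms in auto)
qed simp

lemma gram_mult:
  "(\<Sum>l<N. gram X j l * d l) = (\<Sum>r<dim_row X. X $$ (r, j) * (\<Sum>l<N. X $$ (r, l) * d l)) / real (dim_row X)"
proof -
  let ?T = "dim_row X"
  have "(\<Sum>l<N. gram X j l * d l) = (\<Sum>l<N. \<Sum>r<?T. X $$ (r, j) * (X $$ (r, l) * d l)) / ?T"
    unfolding gram_def sum_divide_distrib[symmetric] sum_distrib_right times_divide_eq_left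
    by (simp only: sum_distrib_right sum_divide_distrib mult.assoc)
  then show ?thesis by (subst (asm) sum.swap) (simp add: sum_distrib_left)
qed

lemma qform_gram:
  "qform N (gram X) d = (\<Sum>r<dim_row X. (\<Sum>l<N. X $$ (r, l) * d l)\<^sup>2) / real (dim_row X)"
proof -
  let ?T = "dim_row X" and ?z = "\<lambda>r. \<Sum>l<N. X $$ (r, l) * d l"
  have "qform N (gram X) d = (\<Sum>a<N. d a * (\<Sum>l<N. gram X a l * d l))"
    by (simp add: qform_def sum_distrib_left mult_ac)
  also have "\<dots> = (\<Sum>a<N. \<Sum>r<?T. (X $$ (r, a) * d a) * ?z r) / ?T"
    unfolding gram_mult by (simp add: sum_divide_distrib sum_distrib_left mult_ac)
  also have "\<dots> = (\<Sum>r<?T. ?z r * ?z r) / ?T"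
    by (subst sum.swap) (simp add: sum_distrib_right)
  finally show ?thesis by (simp add: power2_eq_square)
qed

lemma qform_gram_nonneg: "qform N (gram X) d \<ge> 0"
  unfolding qform_gram by (simp add: sum_nonneg)

lemma gram_cauchy_schwarz:
  "(\<Sum>l<N. gram X j l * d l)\<^sup>2 \<le> gram X j j * qform N (gram X) d"
proof -
  have "(\<Sum>r<dim_row X. X $$ (r, j) * (\<Sum>l<N. X $$ (r, l) * d l))\<^sup>2
      \<le> (\<Sum>r<dim_row X. (X $$ (r, j))\<^sup>2) * (\<Sum>r<dim_row X. (\<Sum>l<N. X $$ (r, l) * d l)\<^sup>2)"
    by (rule Cauchy_Schwarz_ineq_sum)
  then show ?thesis
    unfolding gram_mult qform_gram unfolding gram_def
    by (simp add: power_divide power2_eq_square divide_right_mono)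
qed

text \<open>
  Along the segment from the minimiser to \<open>\<gamma>\<close> the quadratic part changes by its derivative up to a term of second
  order and the penalty is convex; dividing by the step length and letting it tend to zero gives the inequality.
\<close>

lemma minimiser_imp_stationary:
  fixes X :: "real mat"
  defines "T \<equiv> dim_row X" and "N \<equiv> dim_col X"
  assumes T: "T > 0" and lam: "lam \<ge> 0" and D: "D \<subseteq> {..<N}" and w: "\<And>j. j \<in> D \<Longrightarrow> w j \<ge> 0"
    and model: "\<And>r. r < T \<Longrightarrow> v $ r = (\<Sum>a<N. X $$ (r, a) * bs a) + e r"
    and min: "is_arg_min
      (\<lambda>\<gamma>. (vnorm (v - X *\<^sub>v \<gamma>))\<^sup>2 / real T + 2 * lam * (\<Sum>j\<in>D. w j * \<bar>\<gamma> $ j\<bar>))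
      (\<lambda>\<gamma>. \<gamma> \<in> carrier_vec N \<and> support \<gamma> \<subseteq> D) b"
  shows "penalised_stationary N (gram X) (score X e) lam w D bs (\<lambda>j. b $ j)"
proof -
  have b: "dim_vec b = N" "\<And>j. j < N \<Longrightarrow> j \<notin> D \<Longrightarrow> b $ j = 0"
    using min by (auto simp: is_arg_min_def support_def carrier_vecD)
  define res where "res r = v $ r - (\<Sum>a<N. X $$ (r, a) * b $ a)" for r
  have grad: "score X e j - (\<Sum>l<N. gram X j l * (b $ l - bs l)) = (\<Sum>r<T. X $$ (r, j) * res r) / real T" for j
  proof -
    have "(\<Sum>l<N. gram X j l * (b $ l - bs l)) = (\<Sum>r<T. X $$ (r, j) * (\<Sum>l<N. X $$ (r, l) * (b $ l - bs l))) / real T"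
      unfolding T_def by (rule gram_mult)
    moreover have "(\<Sum>r<T. X $$ (r, j) * res r)
       = (\<Sum>r<T. X $$ (r, j) * e r) - (\<Sum>r<T. X $$ (r, j) * (\<Sum>l<N. X $$ (r, l) * (b $ l - bs l)))"
      unfolding sum_subtractf[symmetric]
    proof (rule sum.cong[OF refl])
      fix r assume "r \<in> {..<T}"
      then have "res r = e r - (\<Sum>l<N. X $$ (r, l) * (b $ l - bs l))"
        by (simp add: res_def model right_diff_distrib sum_subtractf)
      then show "X $$ (r, j) * res r = X $$ (r, j) * e r - X $$ (r, j) * (\<Sum>l<N. X $$ (r, l) * (b $ l - bs l))"
        by (simp add: right_diff_distrib)
    qed
    ultimately show ?thesis by (simp add: score_def T_def[symmetric] diff_divide_distrib)
  qed
  have "(\<Sum>j<N. (\<gamma> j - b $ j) * (score X e j - (\<Sum>l<N. gram X j l * (b $ l - bs l))))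
     \<le> lam * (\<Sum>j\<in>D. w j * (\<bar>\<gamma> j\<bar> - \<bar>b $ j\<bar>))" if \<gamma>: "\<And>j. j < N \<Longrightarrow> j \<notin> D \<Longrightarrow> \<gamma> j = 0" for \<gamma>
  proof -
    define d where "d j = \<gamma> j - b $ j" for j
    define Xd where "Xd r = (\<Sum>a<N. X $$ (r, a) * d a)" for r
    define g where "g = (\<Sum>r<T. Xd r * res r) / real T"
    define q where "q = (\<Sum>r<T. (Xd r)\<^sup>2) / real T"
    define P where "P = (\<Sum>j\<in>D. w j * (\<bar>\<gamma> j\<bar> - \<bar>b $ j\<bar>))"
    have g: "(\<Sum>j<N. (\<gamma> j - b $ j) * (score X e j - (\<Sum>l<N. gram X j l * (b $ l - bs l)))) = g"
    proof -
      have "g = (\<Sum>r<T. \<Sum>j<N. d j * (X $$ (r, j) * res r)) / real T"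
        unfolding g_def Xd_def by (simp add: sum_distrib_right sum_distrib_left mult_ac)
      also have "\<dots> = (\<Sum>j<N. d j * ((\<Sum>r<T. X $$ (r, j) * res r) / real T))"
        by (subst sum.swap) (simp add: sum_distrib_left sum_divide_distrib)
      finally show ?thesis unfolding grad d_def by simp
    qed
    have step: "2 * (g - lam * P) \<le> t * q" if t: "0 < t" "t \<le> 1" for t
    proof -
      define \<gamma>t where "\<gamma>t = vec N (\<lambda>j. b $ j + t * d j)"
      have feas: "\<gamma>t \<in> carrier_vec N" "support \<gamma>t \<subseteq> D"
      proof -
        show "\<gamma>t \<in> carrier_vec N" by (simp add: \<gamma>t_def)
        have "\<gamma>t $ j = 0" if "j < N" "j \<notin> D" for j
          using \<gamma>[OF that] b(2)[OF that] that by (simp add: \<gamma>t_def d_def)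
        moreover have "dim_vec \<gamma>t = N" by (simp add: \<gamma>t_def)
        ultimately show "support \<gamma>t \<subseteq> D" unfolding support_def by blast
      qed
      have "(vnorm (v - X *\<^sub>v b))\<^sup>2 / real T + 2 * lam * (\<Sum>j\<in>D. w j * \<bar>b $ j\<bar>)
        \<le> (vnorm (v - X *\<^sub>v \<gamma>t))\<^sup>2 / real T + 2 * lam * (\<Sum>j\<in>D. w j * \<bar>\<gamma>t $ j\<bar>)"
        using min feas unfolding is_arg_min_linorder by blast
      moreover have e1: "(vnorm (v - X *\<^sub>v b))\<^sup>2 = (\<Sum>r<T. (res r)\<^sup>2)"
        unfolding vnorm_square
      proof (rule sum.cong)
        show "{..<dim_vec (v - X *\<^sub>v b)} = {..<T}" by (simp add: T_def)
        fix r assume r: "r \<in> {..<T}"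
        then have "(X *\<^sub>v b) $ r = (\<Sum>a<N. X $$ (r, a) * b $ a)"
          using b(1) unfolding T_def N_def by (intro mult_mat_vec_index_sum) auto
        then show "((v - X *\<^sub>v b) $ r)\<^sup>2 = (res r)\<^sup>2" using r by (simp add: T_def res_def)
      qed
      moreover have e2: "(vnorm (v - X *\<^sub>v \<gamma>t))\<^sup>2 = (\<Sum>r<T. (res r)\<^sup>2) - 2 * t * (real T * g) + t\<^sup>2 * (real T * q)"
      proof -
        have "(vnorm (v - X *\<^sub>v \<gamma>t))\<^sup>2 = (\<Sum>r<T. (res r - t * Xd r)\<^sup>2)"
          unfolding vnorm_square
        proof (rule sum.cong)
          show "{..<dim_vec (v - X *\<^sub>v \<gamma>t)} = {..<T}" by (simp add: T_def)
          fix r assume r: "r \<in> {..<T}"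
          have "(X *\<^sub>v \<gamma>t) $ r = (\<Sum>a<N. X $$ (r, a) * (b $ a + t * d a))"
            using r feas(1) by (subst mult_mat_vec_index_sum) (auto simp: T_def N_def \<gamma>t_def)
          also have "\<dots> = (\<Sum>a<N. X $$ (r, a) * b $ a) + t * Xd r"
            unfolding Xd_def by (simp add: sum.distrib[symmetric] sum_distrib_left algebra_simps)
          finally show "((v - X *\<^sub>v \<gamma>t) $ r)\<^sup>2 = (res r - t * Xd r)\<^sup>2"
            using r by (simp add: T_def res_def diff_diff_add)
        qed
        also have "\<dots> = (\<Sum>r<T. (res r)\<^sup>2 - 2 * t * (Xd r * res r) + t\<^sup>2 * (Xd r)\<^sup>2)"
          by (simp add: power2_diff power_mult_distrib algebra_simps)
        also have "\<dots> = (\<Sum>r<T. (res r)\<^sup>2) - 2 * t * (\<Sum>r<T. Xd r * res r) + t\<^sup>2 * (\<Sum>r<T. (Xd r)\<^sup>2)"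
          by (simp add: sum.distrib sum_subtractf sum_distrib_left)
        finally show ?thesis using T by (simp add: g_def q_def)
      qed
      moreover have "(\<Sum>j\<in>D. w j * \<bar>\<gamma>t $ j\<bar>) \<le> (\<Sum>j\<in>D. w j * \<bar>b $ j\<bar>) + t * P"
      proof -
        have "(\<Sum>j\<in>D. w j * \<bar>\<gamma>t $ j\<bar>) \<le> (\<Sum>j\<in>D. w j * (\<bar>b $ j\<bar> + t * (\<bar>\<gamma> j\<bar> - \<bar>b $ j\<bar>)))"
        proof (intro sum_mono mult_left_mono)
          fix j assume j: "j \<in> D"
          have "\<gamma>t $ j = (1 - t) * b $ j + t * \<gamma> j"
            using j D by (auto simp: \<gamma>t_def d_def algebra_simps)
          then have "\<bar>\<gamma>t $ j\<bar> \<le> (1 - t) * \<bar>b $ j\<bar> + t * \<bar>\<gamma> j\<bar>"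
            using t by (metis abs_mult abs_of_nonneg abs_triangle_ineq diff_ge_0_iff_ge less_imp_le)
          then show "\<bar>\<gamma>t $ j\<bar> \<le> \<bar>b $ j\<bar> + t * (\<bar>\<gamma> j\<bar> - \<bar>b $ j\<bar>)" by (simp add: algebra_simps)
        qed (rule w)
        also have "\<dots> = (\<Sum>j\<in>D. w j * \<bar>b $ j\<bar>) + t * P"
          unfolding P_def by (simp add: sum.distrib[symmetric] sum_distrib_left algebra_simps)
        finally show ?thesis .
      qed
      then have "lam * (\<Sum>j\<in>D. w j * \<bar>\<gamma>t $ j\<bar>) \<le> lam * ((\<Sum>j\<in>D. w j * \<bar>b $ j\<bar>) + t * P)"
        using lam by (rule mult_left_mono)
      moreover have "(vnorm (v - X *\<^sub>v \<gamma>t))\<^sup>2 / real T = (\<Sum>r<T. (res r)\<^sup>2) / real T - 2 * t * g + t\<^sup>2 * q"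
        unfolding e2 using T by (simp add: diff_divide_distrib add_divide_distrib)
      ultimately have "0 \<le> t * (t * q - 2 * (g - lam * P))"
        unfolding e1 by (simp add: algebra_simps power2_eq_square)
      then show ?thesis using t by (simp add: zero_le_mult_iff)
    qed
    have "2 * (g - lam * P) \<le> 0" by (rule nonneg_if_le_linear[OF step])
    then show ?thesis unfolding g P_def by simp
  qed
  then show ?thesis unfolding penalised_stationary_def using b(2) by blast
qed

definition restricted_eigenvalue :: "nat \<Rightarrow> (nat \<Rightarrow> nat \<Rightarrow> real) \<Rightarrow> nat set \<Rightarrow> real \<Rightarrow> bool" where
  "restricted_eigenvalue N G J \<mu> \<longleftrightarrow> (\<forall>d. (\<Sum>j\<in>{..<N} - J. \<bar>d j\<bar>) \<le> 3 * (\<Sum>j\<in>J. \<bar>d j\<bar>)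
     \<longrightarrow> \<mu> * (\<Sum>j\<in>J. (d j)\<^sup>2) \<le> qform N G d)"

lemma l1_square_le_card_l2:
  "(\<Sum>j\<in>J. \<bar>d j\<bar>)\<^sup>2 \<le> real (card J) * (\<Sum>j\<in>J. (d j)\<^sup>2)" for d :: "'i \<Rightarrow> real"
  using Cauchy_Schwarz_ineq_sum[of "\<lambda>_. 1" "\<lambda>j. \<bar>d j\<bar>" J] by simp

text \<open>
  On the cone the \<open>\<ell>\<^sub>1\<close>-norm is at most four times the one on \<open>J\<close>, and squaring it costs a factor \<open>card J\<close> in
  terms of the Euclidean norm; this is the origin of 16.
\<close>

lemma restricted_eigenvalue_perturb:
  assumes re: "restricted_eigenvalue N G J \<mu>" and J: "J \<subseteq> {..<N}"
    and close: "\<And>a b. a < N \<Longrightarrow> b < N \<Longrightarrow> \<bar>H a b - G a b\<bar> \<le> x" and x: "x \<ge> 0"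
  shows "restricted_eigenvalue N H J (\<mu> - 16 * x * card J)"
  unfolding restricted_eigenvalue_def
proof (intro allI impI)
  fix d :: "nat \<Rightarrow> real"
  assume cone: "(\<Sum>j\<in>{..<N} - J. \<bar>d j\<bar>) \<le> 3 * (\<Sum>j\<in>J. \<bar>d j\<bar>)"
  have l1: "(\<Sum>j<N. \<bar>d j\<bar>) \<le> 4 * (\<Sum>j\<in>J. \<bar>d j\<bar>)"
    using cone J sum.subset_diff[of J "{..<N}" "\<lambda>j. \<bar>d j\<bar>"] by simp
  have "qform N G d - qform N H d = (\<Sum>a<N. \<Sum>b<N. d a * (G a b - H a b) * d b)"
    by (simp add: qform_def sum_subtractf[symmetric] algebra_simps)
  also have "\<dots> \<le> (\<Sum>a<N. \<Sum>b<N. x * (\<bar>d a\<bar> * \<bar>d b\<bar>))"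
  proof (intro sum_mono)
    fix a b assume "a \<in> {..<N}" "b \<in> {..<N}"
    then have "\<bar>G a b - H a b\<bar> \<le> x" using close by (simp add: abs_minus_commute)
    then have "\<bar>G a b - H a b\<bar> * (\<bar>d a\<bar> * \<bar>d b\<bar>) \<le> x * (\<bar>d a\<bar> * \<bar>d b\<bar>)"
      by (intro mult_right_mono) auto
    moreover have "d a * (G a b - H a b) * d b \<le> \<bar>G a b - H a b\<bar> * (\<bar>d a\<bar> * \<bar>d b\<bar>)"
      using abs_ge_self[of "d a * (G a b - H a b) * d b"] by (simp add: abs_mult mult_ac)
    ultimately show "d a * (G a b - H a b) * d b \<le> x * (\<bar>d a\<bar> * \<bar>d b\<bar>)" by simp
  qed
  also have "\<dots> = x * (\<Sum>a<N. \<bar>d a\<bar>)\<^sup>2"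
    unfolding power2_eq_square sum_product by (simp only: sum_distrib_left)
  also have "\<dots> \<le> x * (4 * (\<Sum>j\<in>J. \<bar>d j\<bar>))\<^sup>2"
    using l1 x by (intro mult_left_mono power_mono) (auto intro: sum_nonneg)
  also have "\<dots> \<le> 16 * x * (real (card J) * (\<Sum>j\<in>J. (d j)\<^sup>2))"
    using mult_left_mono[OF l1_square_le_card_l2[of d J], of "16 * x"] x by (simp add: power_mult_distrib)
  finally have "qform N G d - 16 * x * (real (card J) * (\<Sum>j\<in>J. (d j)\<^sup>2)) \<le> qform N H d" by simp
  moreover have "\<mu> * (\<Sum>j\<in>J. (d j)\<^sup>2) \<le> qform N G d"
    using re cone unfolding restricted_eigenvalue_def by blast
  ultimately show "(\<mu> - 16 * x * card J) * (\<Sum>j\<in>J. (d j)\<^sup>2) \<le> qform N H d"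
    by (simp add: algebra_simps)
qed

text \<open>
  Testing stationarity at the true parameter gives
  \<open>\<delta>'G\<delta> \<le> m\<parallel>\<delta>\<^sub>J\<parallel>\<^sub>1 - lam (V - 1/2)\<parallel>\<delta>\<^sub>J\<^sub>c\<parallel>\<^sub>1\<close>. As the left-hand side is nonnegative, \<open>W + 2 \<le> 3V\<close> puts \<open>\<delta>\<close> into the cone
  of the restricted eigenvalue. The plain LASSO is the case \<open>V = W = 1\<close>.
\<close>

lemma weighted_lasso_error:
  assumes st: "penalised_stationary N G \<nu> lam w D bs b"
    and J: "J \<subseteq> D" and D: "D \<subseteq> {..<N}" and bs: "\<And>j. j < N \<Longrightarrow> j \<notin> J \<Longrightarrow> bs j = 0"
    and lam: "lam > 0" and \<nu>: "\<And>j. j < N \<Longrightarrow> \<bar>\<nu> j\<bar> \<le> lam / 2"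
    and w: "\<And>j. j \<in> D \<Longrightarrow> w j \<ge> 0"
    and wJ: "\<And>j. j \<in> J \<Longrightarrow> w j \<le> W" and wD: "\<And>j. j \<in> D - J \<Longrightarrow> V \<le> w j"
    and W: "W \<ge> 0" "W + 2 \<le> 3 * V"
    and re: "restricted_eigenvalue N G J \<mu>" and \<mu>: "\<mu> > 0"
    and psd: "\<And>d. qform N G d \<ge> 0"
  defines "d \<equiv> \<lambda>j. b j - bs j" and "m \<equiv> lam * (1 / 2 + W)"
  shows "(\<Sum>j<N. \<bar>d j\<bar>) \<le> 4 * m * card J / \<mu>"
    and "(\<Sum>j\<in>J. (d j)\<^sup>2) \<le> m\<^sup>2 * card J / \<mu>\<^sup>2"
    and "qform N G d \<le> m\<^sup>2 * card J / \<mu>"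
proof -
  define A where "A = (\<Sum>j\<in>J. \<bar>d j\<bar>)"
  define B where "B = (\<Sum>j\<in>{..<N} - J. \<bar>d j\<bar>)"
  define E where "E = (\<Sum>j\<in>J. (d j)\<^sup>2)"
  have fD: "finite D" using D finite_subset by blast
  have JN: "J \<subseteq> {..<N}" using J D by auto
  have A0: "A \<ge> 0" "B \<ge> 0" "E \<ge> 0" by (simp_all add: A_def B_def E_def sum_nonneg)
  have AB: "(\<Sum>j<N. \<bar>d j\<bar>) = A + B"
    using sum.subset_diff[OF JN, of "\<lambda>j. \<bar>d j\<bar>"] by (simp add: A_def B_def)
  have BD: "B = (\<Sum>j\<in>D - J. \<bar>d j\<bar>)" unfolding B_def
  proof (rule sum.mono_neutral_right)
    show "\<forall>j\<in>{..<N} - J - (D - J). \<bar>d j\<bar> = 0"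
      using st bs unfolding penalised_stationary_def d_def by auto
  qed (use D in auto)
  have "(\<Sum>j<N. (bs j - b j) * (\<nu> j - (\<Sum>l<N. G j l * d l))) \<le> lam * (\<Sum>j\<in>D. w j * (\<bar>bs j\<bar> - \<bar>b j\<bar>))"
    using st bs J unfolding penalised_stationary_def d_def by blast
  moreover have "(\<Sum>j<N. (bs j - b j) * (\<nu> j - (\<Sum>l<N. G j l * d l))) = qform N G d - (\<Sum>j<N. d j * \<nu> j)"
  proof -
    have "(bs j - b j) * (\<nu> j - z) = d j * z - d j * \<nu> j" for j z
      by (simp add: d_def algebra_simps)
    then show ?thesis by (simp add: qform_def sum_subtractf sum_distrib_left mult.assoc)
  qed
  moreover have "(\<Sum>j<N. d j * \<nu> j) \<le> lam / 2 * (A + B)"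
  proof -
    have "(\<Sum>j<N. d j * \<nu> j) \<le> (\<Sum>j<N. lam / 2 * \<bar>d j\<bar>)"
    proof (rule sum_mono)
      fix j assume "j \<in> {..<N}"
      then have "\<bar>d j\<bar> * \<bar>\<nu> j\<bar> \<le> \<bar>d j\<bar> * (lam / 2)" using \<nu> by (intro mult_left_mono) auto
      then show "d j * \<nu> j \<le> lam / 2 * \<bar>d j\<bar>"
        using abs_ge_self[of "d j * \<nu> j"] by (simp add: abs_mult mult_ac)
    qed
    then show ?thesis unfolding AB[symmetric] sum_distrib_left .
  qed
  moreover have "(\<Sum>j\<in>D. w j * (\<bar>bs j\<bar> - \<bar>b j\<bar>)) \<le> W * A - V * B"
  proof -
    have "(\<Sum>j\<in>D. w j * (\<bar>bs j\<bar> - \<bar>b j\<bar>)) = (\<Sum>j\<in>D - J. w j * (\<bar>bs j\<bar> - \<bar>b j\<bar>)) + (\<Sum>j\<in>J. w j * (\<bar>bs j\<bar> - \<bar>b j\<bar>))"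
      using J fD by (rule sum.subset_diff)
    also have "\<dots> \<le> (\<Sum>j\<in>D - J. - (V * \<bar>d j\<bar>)) + (\<Sum>j\<in>J. W * \<bar>d j\<bar>)"
    proof (intro add_mono sum_mono)
      fix j assume j: "j \<in> D - J"
      then have "bs j = 0" using bs D by auto
      moreover have "V * \<bar>b j\<bar> \<le> w j * \<bar>b j\<bar>" using wD[OF j] by (rule mult_right_mono) simp
      ultimately show "w j * (\<bar>bs j\<bar> - \<bar>b j\<bar>) \<le> - (V * \<bar>d j\<bar>)" by (simp add: d_def)
    next
      fix j assume j: "j \<in> J"
      have "w j * (\<bar>bs j\<bar> - \<bar>b j\<bar>) \<le> w j * \<bar>d j\<bar>"
        using w j J by (intro mult_left_mono) (auto simp: d_def)
      also have "\<dots> \<le> W * \<bar>d j\<bar>" using wJ[OF j] by (rule mult_right_mono) simp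
      finally show "w j * (\<bar>bs j\<bar> - \<bar>b j\<bar>) \<le> W * \<bar>d j\<bar>" .
    qed
    also have "\<dots> = W * A - V * B" unfolding A_def BD by (simp add: sum_distrib_left sum_negf)
    finally show ?thesis .
  qed
  then have "lam * (\<Sum>j\<in>D. w j * (\<bar>bs j\<bar> - \<bar>b j\<bar>)) \<le> lam * (W * A - V * B)"
    using lam by (intro mult_left_mono) auto
  ultimately have basic: "qform N G d \<le> m * A - lam * (V - 1 / 2) * B"
    unfolding m_def by (simp add: algebra_simps)
  have V: "V - 1 / 2 > 0" using W by simp
  have m0: "m > 0" using lam W by (simp add: m_def)
  have cone: "B \<le> 3 * A"
  proof (rule ccontr)
    assume "\<not> B \<le> 3 * A"
    then have "A < B / 3" by simp
    have "lam * (V - 1 / 2) * B \<ge> m * (B / 3)"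
    proof -
      have "(1 / 2 + W) * (B / 3) \<le> (V - 1 / 2) * B" using W A0 mult_right_mono[of "(1/2 + W)/3" "V - 1/2" B] by simp
      then show ?thesis using lam unfolding m_def by (simp add: mult.assoc)
    qed
    moreover have "m * A < m * (B / 3)" using \<open>A < B / 3\<close> m0 by simp
    ultimately have "qform N G d < 0" using basic by linarith
    then show False using psd[of d] by simp
  qed
  have q: "qform N G d \<le> m * A"
    using basic mult_nonneg_nonneg[OF mult_nonneg_nonneg[of lam "V - 1 / 2"] A0(2)] lam V by simp
  have low: "\<mu> * E \<le> qform N G d"
    using re cone unfolding restricted_eigenvalue_def A_def B_def E_def by blast
  have AE: "A\<^sup>2 \<le> card J * E" unfolding A_def E_def by (rule l1_square_le_card_l2)
  show E: "(\<Sum>j\<in>J. (d j)\<^sup>2) \<le> m\<^sup>2 * card J / \<mu>\<^sup>2"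
  proof (cases "E = 0")
    case True
    then show ?thesis unfolding E_def[symmetric] by simp
  next
    case False
    then have "E > 0" using A0 by simp
    have "(\<mu> * E)\<^sup>2 \<le> (m * A)\<^sup>2" using low q \<mu> A0 by (intro power_mono) auto
    also have "\<dots> \<le> m\<^sup>2 * (card J * E)" unfolding power_mult_distrib by (intro mult_left_mono AE) simp
    finally have "(\<mu>\<^sup>2 * E) * E \<le> (m\<^sup>2 * card J) * E" by (simp add: power2_eq_square mult_ac)
    then have "\<mu>\<^sup>2 * E \<le> m\<^sup>2 * card J" using \<open>E > 0\<close> by simp
    then show ?thesis unfolding E_def[symmetric] using \<mu> by (simp add: field_simps)
  qed
  have A: "A \<le> m * card J / \<mu>"
  proof (rule power2_le_imp_le)
    have "A\<^sup>2 \<le> card J * (m\<^sup>2 * card J / \<mu>\<^sup>2)"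
      using AE E mult_left_mono[of E "m\<^sup>2 * card J / \<mu>\<^sup>2" "card J"] unfolding E_def[symmetric] by simp
    then show "A\<^sup>2 \<le> (m * card J / \<mu>)\<^sup>2" by (simp add: power2_eq_square mult_ac)
  qed (use m0 \<mu> in simp)
  have "(\<Sum>j<N. \<bar>d j\<bar>) \<le> 4 * A" using AB cone by simp
  also have "\<dots> \<le> 4 * (m * card J / \<mu>)" using A by simp
  finally show "(\<Sum>j<N. \<bar>d j\<bar>) \<le> 4 * m * card J / \<mu>" by simp
  have "qform N G d \<le> m * (m * card J / \<mu>)" using q A m0 by (meson mult_left_mono less_imp_le order_trans)
  then show "qform N G d \<le> m\<^sup>2 * card J / \<mu>" by (simp add: power2_eq_square)
qed

text \<open>
  Test stationarity at the vector in which only the coordinate \<open>j\<close> is set to zero.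
\<close>

lemma penalised_stationary_active:
  assumes st: "penalised_stationary N G \<nu> lam w D bs b" and D: "D \<subseteq> {..<N}"
    and j: "j \<in> D" "b j \<noteq> 0"
  shows "lam * w j \<le> \<bar>\<nu> j - (\<Sum>l<N. G j l * (b l - bs l))\<bar>"
proof -
  have fD: "finite D" using D finite_subset by blast
  have jN: "j < N" using j D by auto
  let ?g = "\<lambda>j. \<nu> j - (\<Sum>l<N. G j l * (b l - bs l))"
  have "\<forall>l<N. l \<notin> D \<longrightarrow> (b(j := 0)) l = 0" using st unfolding penalised_stationary_def by auto
  then have "(\<Sum>l<N. ((b(j := 0)) l - b l) * ?g l) \<le> lam * (\<Sum>l\<in>D. w l * (\<bar>(b(j := 0)) l\<bar> - \<bar>b l\<bar>))"
    using st unfolding penalised_stationary_def by blast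
  moreover have "(\<Sum>l<N. ((b(j := 0)) l - b l) * ?g l) = - b j * ?g j"
    using jN by (subst sum.remove[of _ j]) auto
  moreover have "(\<Sum>l\<in>D. w l * (\<bar>(b(j := 0)) l\<bar> - \<bar>b l\<bar>)) = - (w j * \<bar>b j\<bar>)"
    using j fD by (subst sum.remove[of _ j]) auto
  ultimately have "lam * w j * \<bar>b j\<bar> \<le> b j * ?g j" by (simp add: mult_ac)
  also have "\<dots> \<le> \<bar>?g j\<bar> * \<bar>b j\<bar>"
    using abs_ge_self[of "b j * ?g j"] by (simp add: abs_mult mult.commute)
  finally show ?thesis using j(2) by simp
qed

lemma sgn_eq_if_close:
  fixes x y :: real
  shows "\<bar>x - y\<bar> < \<bar>y\<bar> \<Longrightarrow> sgn x = sgn y"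
  by (auto simp: sgn_if abs_if split: if_splits)

text \<open>
  Here \<open>r\<close> bounds the \<open>\<ell>\<^sub>1\<close>-error of the first step. Condition \<open>c1\<close> keeps the relevant regressors,
  \<open>c2\<close> makes the weights of the second step separate, \<open>c3\<close> makes its error on \<open>J\<close> smaller than \<open>bmin\<close>, and
  \<open>c4\<close> excludes irrelevant regressors: their penalty exceeds the largest possible residual correlation.
\<close>

theorem adaptive_lasso_sign_recovery:
  fixes X :: "real mat" and N :: nat and lam \<mu> :: real and bs bh bt :: "nat \<Rightarrow> real"
  defines "G \<equiv> gram X"
  defines "J \<equiv> {j. j < N \<and> bs j \<noteq> 0}" and "D \<equiv> {j. j < N \<and> bh j \<noteq> 0}"
  defines "s \<equiv> real (card J)" and "r \<equiv> 6 * lam * real (card J) / \<mu>"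
  assumes lasso: "penalised_stationary N G \<nu> lam (\<lambda>_. 1) {..<N} bs bh"
    and adaptive: "penalised_stationary N G \<nu> lam (\<lambda>j. 1 / \<bar>bh j\<bar>) D bs bt"
    and lam: "lam > 0" and \<nu>: "\<And>j. j < N \<Longrightarrow> \<bar>\<nu> j\<bar> \<le> lam / 2"
    and re: "restricted_eigenvalue N G J \<mu>" and \<mu>: "\<mu> > 0"
    and diag: "\<And>j. j < N \<Longrightarrow> G j j \<le> \<tau>\<^sup>2" and \<tau>: "\<tau> \<ge> 0" and s: "s \<ge> 1"
    and bmin: "bmin > 0" "\<And>j. j \<in> J \<Longrightarrow> bmin \<le> \<bar>bs j\<bar>"
    and c1: "r \<le> bmin / 2" and c2: "r * (2 / bmin + 2) \<le> 3"
    and c3: "lam * (1 / 2 + 2 / bmin) * sqrt s / \<mu> < bmin"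
    and c4: "r * (1 / 2 + \<tau> * ((1 / 2 + 2 / bmin) * sqrt s / sqrt \<mu>)) < 1"
    and j: "j < N"
  shows "sgn (bt j) = sgn (bs j)"
proof -
  note psd = qform_gram_nonneg[of N X, folded G_def]
  have JN: "J \<subseteq> {..<N}" by (auto simp: J_def)
  have bs0: "bs j = 0" if "j < N" "j \<notin> J" for j using that by (auto simp: J_def)
  have r0: "r > 0" using lam \<mu> s by (simp add: r_def s_def)
  have first_l1: "(\<Sum>j<N. \<bar>bh j - bs j\<bar>) \<le> r"
    using weighted_lasso_error(1)[OF lasso JN order_refl bs0 lam \<nu>, of 1 1 \<mu>] re \<mu> psd
    by (simp add: r_def)
  have first: "\<bar>bh j - bs j\<bar> \<le> r" if "j < N" for j
    using member_le_sum[of j "{..<N}" "\<lambda>j. \<bar>bh j - bs j\<bar>"] first_l1 that by simp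
  define W V where "W = 2 / bmin" and "V = 1 / r"
  have big: "\<bar>bh j\<bar> \<ge> bmin / 2" if "j \<in> J" for j
    using first[of j] bmin(2)[OF that] c1 that JN by force
  have JD: "J \<subseteq> D"
    using big bmin(1) JN by (fastforce simp: D_def)
  have DN: "D \<subseteq> {..<N}" by (auto simp: D_def)
  have wJ: "1 / \<bar>bh j\<bar> \<le> W" if "j \<in> J" for j
    using divide_left_mono[OF big[OF that], of 1] bmin(1) big[OF that] by (simp add: W_def)
  have wD: "V \<le> 1 / \<bar>bh j\<bar>" if "j \<in> D - J" for j
  proof -
    have "0 < \<bar>bh j\<bar>" "\<bar>bh j\<bar> \<le> r" using first[of j] bs0[of j] that by (auto simp: D_def)
    then show ?thesis unfolding V_def by (intro divide_left_mono) auto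
  qed
  have W0: "W \<ge> 0" using bmin(1) by (simp add: W_def)
  have WV: "W + 2 \<le> 3 * V" using c2 r0 by (simp add: W_def V_def field_simps)
  note err = weighted_lasso_error[OF adaptive JD DN bs0 lam \<nu> _ wJ wD W0 WV re \<mu> psd, simplified]
  define m where "m = lam * (1 / 2 + W)"
  have m0: "m > 0" using lam W0 by (simp add: m_def)
  show ?thesis
  proof (cases "j \<in> J")
    case True
    have fJ: "finite J" using JN finite_subset by blast
    have "(bt j - bs j)\<^sup>2 \<le> (\<Sum>j\<in>J. (bt j - bs j)\<^sup>2)"
      using True fJ by (intro member_le_sum) auto
    also have "\<dots> \<le> m\<^sup>2 * s / \<mu>\<^sup>2" using err(2) by (simp add: m_def s_def)
    also have "\<dots> = (m * sqrt s / \<mu>)\<^sup>2" using s by (simp add: power_divide power_mult_distrib)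
    finally have "\<bar>bt j - bs j\<bar> \<le> m * sqrt s / \<mu>"
      using m0 s \<mu> by (subst (asm) abs_le_square_iff[symmetric]) auto
    also have "\<dots> < bmin" using c3 by (simp add: m_def W_def)
    also have "\<dots> \<le> \<bar>bs j\<bar>" using bmin(2)[OF True] .
    finally show ?thesis by (rule sgn_eq_if_close)
  next
    case False
    have "bt j = 0"
    proof (rule ccontr)
      assume nz: "bt j \<noteq> 0"
      then have jD: "j \<in> D" using adaptive j unfolding penalised_stationary_def by auto
      let ?z = "\<Sum>l<N. G j l * (bt l - bs l)"
      have "?z\<^sup>2 \<le> G j j * qform N G (\<lambda>l. bt l - bs l)"
        unfolding G_def by (rule gram_cauchy_schwarz)
      also have "\<dots> \<le> \<tau>\<^sup>2 * (m\<^sup>2 * s / \<mu>)"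
        using diag[OF j] err(3) psd m0 s \<mu> by (intro mult_mono) (auto simp: m_def s_def)
      also have "\<dots> = (\<tau> * (m * sqrt s / sqrt \<mu>))\<^sup>2"
        using s \<mu> by (simp add: power_divide power_mult_distrib)
      finally have z: "\<bar>?z\<bar> \<le> \<tau> * (m * sqrt s / sqrt \<mu>)"
        using m0 s \<mu> \<tau> by (subst (asm) abs_le_square_iff[symmetric]) auto
      have "lam * V \<le> lam * (1 / \<bar>bh j\<bar>)" using wD[of j] jD False lam by (intro mult_left_mono) auto
      also have "\<dots> \<le> \<bar>\<nu> j - ?z\<bar>"
        by (rule penalised_stationary_active[OF adaptive DN jD nz])
      also have "\<dots> \<le> lam / 2 + \<tau> * (m * sqrt s / sqrt \<mu>)"
        using \<nu>[OF j] z by linarith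
      also have "\<dots> = lam * (1 / 2 + \<tau> * ((1 / 2 + W) * sqrt s / sqrt \<mu>))"
        by (simp add: m_def algebra_simps)
      finally have "V \<le> 1 / 2 + \<tau> * ((1 / 2 + W) * sqrt s / sqrt \<mu>)" using lam by simp
      then have "r * V \<le> r * (1 / 2 + \<tau> * ((1 / 2 + W) * sqrt s / sqrt \<mu>))"
        using r0 by (intro mult_left_mono) auto
      then show False using c4 r0 by (simp add: V_def W_def)
    qed
    then show ?thesis using bs0[OF j False] by simp
  qed
qed

text \<open>
  Without a penalty both steps are least squares, whose error is the score divided by the Gram entry.
\<close>

lemma single_regressor_sign_recovery:
  fixes bs bh bt :: "nat \<Rightarrow> real"
  defines "D \<equiv> {j. j < 1 \<and> bh j \<noteq> 0}"
  assumes ols: "penalised_stationary 1 G \<nu> 0 (\<lambda>_. 1) {..<1} bs bh"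
    and refit: "penalised_stationary 1 G \<nu> 0 (\<lambda>j. 1 / \<bar>bh j\<bar>) D bs bt"
    and re: "restricted_eigenvalue 1 G {..<1} \<mu>" and \<mu>: "\<mu> > 0"
    and small: "\<bar>\<nu> 0\<bar> < \<mu> * \<bar>bs 0\<bar>"
  shows "sgn (bt 0) = sgn (bs 0)"
proof -
  have G: "\<mu> * (d :: real)\<^sup>2 \<le> G 0 0 * d\<^sup>2" for d
    using re[unfolded restricted_eigenvalue_def, rule_format, of "\<lambda>_. d"] 
    by (simp add: qform_def power2_eq_square lessThan_Suc mult_ac)
  have close: "sgn (b 0) = sgn (bs 0) \<and> b 0 \<noteq> 0"
    if st: "penalised_stationary 1 G \<nu> 0 w E bs b" and E: "0 \<in> E" for w E b
  proof -
    let ?d = "b 0 - bs 0"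
    have "(bs 0 - b 0) * (\<nu> 0 - G 0 0 * ?d) \<le> 0"
      using st E unfolding penalised_stationary_def by (auto simp: lessThan_Suc dest!: spec[of _ bs])
    then have "G 0 0 * ?d\<^sup>2 \<le> ?d * \<nu> 0" by (simp add: algebra_simps power2_eq_square)
    then have "\<mu> * ?d\<^sup>2 \<le> ?d * \<nu> 0" using G[of ?d] by simp
    also have "\<dots> \<le> \<bar>?d\<bar> * \<bar>\<nu> 0\<bar>" by (metis abs_ge_self abs_mult)
    finally have "\<bar>?d\<bar> * (\<mu> * \<bar>?d\<bar>) \<le> \<bar>?d\<bar> * \<bar>\<nu> 0\<bar>"
      by (simp add: power2_eq_square mult_ac)
    then have "?d \<noteq> 0 \<Longrightarrow> \<mu> * \<bar>?d\<bar> \<le> \<bar>\<nu> 0\<bar>" by simp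
    then have "\<mu> * \<bar>?d\<bar> < \<mu> * \<bar>bs 0\<bar>"
      using small abs_ge_zero[of "\<nu> 0"] by (metis abs_zero le_less_trans mult_zero_right)
    then have "\<bar>?d\<bar> < \<bar>bs 0\<bar>" using \<mu> by simp
    then show ?thesis using sgn_eq_if_close[of "b 0" "bs 0"] by (metis abs_minus_commute diff_0 abs_minus_cancel diff_0_right less_irrefl)
  qed
  have "bh 0 \<noteq> 0" using close[OF ols] by simp
  then show ?thesis using close[OF refit] by (simp add: D_def)
qed

section \<open>The Gaussian space of a vector autoregression\<close>

context gaussian_var
begin

definition noise_comb :: "int set \<Rightarrow> (int \<Rightarrow> nat \<Rightarrow> real) \<Rightarrow> 'a \<Rightarrow> real" where
  "noise_comb U C \<omega> = (\<Sum>u\<in>U. \<Sum>j<k. C u j * \<epsilon> u j \<omega>)"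

text \<open>
  The variance of \<open>noise_comb U C\<close>. Its additivity in \<open>U\<close> is what makes disjoint combinations orthogonal.
\<close>

definition noise_variance :: "int set \<Rightarrow> (int \<Rightarrow> nat \<Rightarrow> real) \<Rightarrow> real" where
  "noise_variance U C = (\<Sum>u\<in>U. vec k (C u) \<bullet> (S *\<^sub>v vec k (C u)))"

lemma noise_comb_normal:
  assumes "finite U"
  shows "centered_normal M (noise_comb U C) (noise_variance U C)"
proof -
  define Y where "Y u \<omega> = (\<Sum>j<k. C u j * \<epsilon> u j \<omega>)" for u \<omega>
  have normal: "centered_normal M (Y u) (vec k (C u) \<bullet> (S *\<^sub>v vec k (C u)))" for u
  proof -
    have "centered_normal M (\<lambda>\<omega>. \<Sum>j<k. vec k (C u) $ j * \<epsilon> u j \<omega>) (vec k (C u) \<bullet> (S *\<^sub>v vec k (C u)))"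
      using innovations_gaussian[of u] unfolding centered_gaussian_vector_def
      by (elim conjE) (erule bspec, simp)
    moreover have "(\<Sum>j<k. vec k (C u) $ j * \<epsilon> u j \<omega>) = Y u \<omega>" for \<omega>
      unfolding Y_def by (rule sum.cong) auto
    ultimately show ?thesis by simp
  qed
  have "indep_vars (\<lambda>_. borel) (\<lambda>u \<omega>. (\<lambda>z. \<Sum>j<k. C u j * z j) (\<lambda>j\<in>{..<k}. \<epsilon> u j \<omega>)) UNIV"
    by (rule indep_vars_compose2[OF innovations_indep]) measurable
  then have "indep_vars (\<lambda>_. borel) Y UNIV" unfolding Y_def by simp
  then have ind: "indep_vars (\<lambda>_. borel) Y U" by (rule indep_vars_subset) simp
  have "char (distr M borel (\<lambda>\<omega>. \<Sum>u\<in>U. Y u \<omega>)) t = of_real (exp (- (noise_variance U C * t\<^sup>2) / 2))" for t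
  proof -
    have "char (distr M borel (\<lambda>\<omega>. \<Sum>u\<in>U. Y u \<omega>)) t = (\<Prod>u\<in>U. char (distr M borel (Y u)) t)"
      using ind by (rule char_distr_sum)
    also have "\<dots> = (\<Prod>u\<in>U. of_real (exp (- ((vec k (C u) \<bullet> (S *\<^sub>v vec k (C u))) * t\<^sup>2) / 2)))"
      using normal by (intro prod.cong refl) (simp add: centered_normal_iff_char)
    also have "\<dots> = of_real (exp (\<Sum>u\<in>U. - ((vec k (C u) \<bullet> (S *\<^sub>v vec k (C u))) * t\<^sup>2) / 2))"
      using assms by (simp add: exp_sum)
    also have "(\<Sum>u\<in>U. - ((vec k (C u) \<bullet> (S *\<^sub>v vec k (C u))) * t\<^sup>2) / 2) = - (noise_variance U C * t\<^sup>2) / 2"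
      by (simp add: noise_variance_def sum_distrib_right sum_negf sum_divide_distrib)
    finally show ?thesis .
  qed
  moreover have "noise_comb U C = (\<lambda>\<omega>. \<Sum>u\<in>U. Y u \<omega>)"
    by (simp add: noise_comb_def[abs_def] Y_def)
  moreover have "noise_variance U C \<ge> 0"
    unfolding noise_variance_def by (intro sum_nonneg centered_normalD(1)[OF normal])
  moreover have "(\<lambda>\<omega>. \<Sum>u\<in>U. Y u \<omega>) \<in> borel_measurable M"
    by (intro borel_measurable_sum centered_normalD(2)[OF normal])
  ultimately show ?thesis by (simp add: centered_normal_iff_char)
qed

lemma noise_comb_extend:
  assumes "U \<subseteq> W" "finite W"
  shows "noise_comb U C = noise_comb W (\<lambda>u j. if u \<in> U then C u j else 0)"
proof
  fix \<omega>
  have "noise_comb W (\<lambda>u j. if u \<in> U then C u j else 0) \<omega>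
    = (\<Sum>u\<in>W. if u \<in> U then \<Sum>j<k. C u j * \<epsilon> u j \<omega> else 0)"
    unfolding noise_comb_def by (intro sum.cong) auto
  also have "\<dots> = noise_comb U C \<omega>"
    unfolding noise_comb_def using assms
    by (subst sum.inter_restrict[symmetric]) (simp_all add: Int_absorb1)
  finally show "noise_comb U C \<omega> = noise_comb W (\<lambda>u j. if u \<in> U then C u j else 0) \<omega>" by simp
qed

definition noise_combs :: "('a \<Rightarrow> real) set" where
  "noise_combs = {noise_comb U C |U C. finite U}"

lemma noise_combsI: "finite U \<Longrightarrow> noise_comb U C \<in> noise_combs"
  unfolding noise_combs_def by auto

lemma noise_combsE:
  assumes "X \<in> noise_combs"
  obtains U C where "X = noise_comb U C" "finite U"
  using assms unfolding noise_combs_def by auto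

lemma noise_combs_normal: "X \<in> noise_combs \<Longrightarrow> \<exists>v. centered_normal M X v"
  by (erule noise_combsE) (auto intro: noise_comb_normal)

lemma noise_combs_lin:
  assumes "X \<in> noise_combs" "Y \<in> noise_combs"
  shows "(\<lambda>\<omega>. X \<omega> + c * Y \<omega>) \<in> noise_combs"
proof -
  obtain U C where X: "X = noise_comb U C" "finite U"
    using assms(1) by (rule noise_combsE)
  obtain V D where Y: "Y = noise_comb V D" "finite V"
    using assms(2) by (rule noise_combsE)
  let ?W = "U \<union> V"
  have "X = noise_comb ?W (\<lambda>u j. if u \<in> U then C u j else 0)"
    "Y = noise_comb ?W (\<lambda>u j. if u \<in> V then D u j else 0)"
    unfolding X(1) Y(1) using X(2) Y(2) by (simp_all add: noise_comb_extend[symmetric])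
  then have "(\<lambda>\<omega>. X \<omega> + c * Y \<omega>) = noise_comb ?W
      (\<lambda>u j. (if u \<in> U then C u j else 0) + c * (if u \<in> V then D u j else 0))"
    by (simp add: noise_comb_def[abs_def] sum_distrib_left sum.distrib[symmetric] distrib_right mult.assoc)
  then show ?thesis using X(2) Y(2) by (simp add: noise_combsI)
qed

text \<open>
  The process is an infinite moving average of the innovations, so it is only an almost sure limit of their
  finite linear combinations.
\<close>

definition noise_space :: "('a \<Rightarrow> real) set" where
  "noise_space = {X \<in> borel_measurable M. \<exists>Xn. (\<forall>n. Xn n \<in> noise_combs) \<and>
     (AE \<omega> in M. (\<lambda>n. Xn n \<omega>) \<longlonglongrightarrow> X \<omega>)}"

lemma noise_spaceI:
  assumes "X \<in> borel_measurable M" "\<And>n. Xn n \<in> noise_combs" "AE \<omega> in M. (\<lambda>n. Xn n \<omega>) \<longlonglongrightarrow> X \<omega>"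
  shows "X \<in> noise_space"
  unfolding noise_space_def using assms by (intro CollectI conjI exI[of _ Xn]) auto

lemma noise_spaceE:
  assumes "X \<in> noise_space"
  obtains Xn where "X \<in> borel_measurable M" "\<forall>n. Xn n \<in> noise_combs" "AE \<omega> in M. (\<lambda>n. Xn n \<omega>) \<longlonglongrightarrow> X \<omega>"
  using assms unfolding noise_space_def by auto

lemma gaussian_noise_space: "gaussian_linear_space M noise_space"
proof
  show "gaussian_space M noise_space"
    unfolding gaussian_space_def
  proof (intro conjI ballI allI)
    have "noise_comb {} (\<lambda>_ _. 0) \<in> noise_combs" by (rule noise_combsI) simp
    then have "(\<lambda>_. 0) \<in> noise_combs" by (simp add: noise_comb_def[abs_def])
    then show "(\<lambda>_. 0) \<in> noise_space"
      by (rule noise_spaceI[rotated]) auto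
  next
    fix X Y c assume "X \<in> noise_space" "Y \<in> noise_space"
    obtain Xn where X: "X \<in> borel_measurable M" "\<forall>n. Xn n \<in> noise_combs" "AE \<omega> in M. (\<lambda>n. Xn n \<omega>) \<longlonglongrightarrow> X \<omega>"
      using \<open>X \<in> noise_space\<close> by (rule noise_spaceE)
    obtain Yn where Y: "Y \<in> borel_measurable M" "\<forall>n. Yn n \<in> noise_combs" "AE \<omega> in M. (\<lambda>n. Yn n \<omega>) \<longlonglongrightarrow> Y \<omega>"
      using \<open>Y \<in> noise_space\<close> by (rule noise_spaceE)
    have "AE \<omega> in M. (\<lambda>n. Xn n \<omega> + c * Yn n \<omega>) \<longlonglongrightarrow> X \<omega> + c * Y \<omega>"
      using X(3) Y(3) by eventually_elim (intro tendsto_intros)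
    with X Y show "(\<lambda>\<omega>. X \<omega> + c * Y \<omega>) \<in> noise_space"
      by (intro noise_spaceI[where Xn="\<lambda>n \<omega>. Xn n \<omega> + c * Yn n \<omega>"] noise_combs_lin) auto
  next
    fix X assume "X \<in> noise_space"
    then obtain Xn where X: "X \<in> borel_measurable M" "\<forall>n. Xn n \<in> noise_combs" "AE \<omega> in M. (\<lambda>n. Xn n \<omega>) \<longlonglongrightarrow> X \<omega>"
      by (rule noise_spaceE)
    have "\<forall>n. \<exists>v. centered_normal M (Xn n) v" using X(2) noise_combs_normal by blast
    then obtain v where v: "\<And>n. centered_normal M (Xn n) (v n)" by (auto simp: choice_iff)
    from centered_normal_limit[OF v X(1,3)] show "\<exists>v. centered_normal M X v" by blast
  qed
qed

sublocale noise: gaussian_linear_space M noise_space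
  by (rule gaussian_noise_space)

lemma noise_combs_subset: "noise_combs \<subseteq> noise_space"
proof
  fix X assume X: "X \<in> noise_combs"
  then have "X \<in> borel_measurable M" using noise_combs_normal centered_normalD(2) by blast
  then show "X \<in> noise_space" using X by (intro noise_spaceI[where Xn="\<lambda>_. X"]) auto
qed

lemma innovation_eq_noise_comb:
  assumes "j < k"
  shows "\<epsilon> t j = noise_comb {t} (\<lambda>u l. if l = j then 1 else 0)"
proof
  fix \<omega>
  have "(\<Sum>l<k. (if l = j then 1 else 0) * \<epsilon> t l \<omega>) = (\<Sum>l<k. if l = j then \<epsilon> t l \<omega> else 0)"
    by (intro sum.cong) auto
  then show "\<epsilon> t j \<omega> = noise_comb {t} (\<lambda>u l. if l = j then 1 else 0) \<omega>"
    using assms by (simp add: noise_comb_def)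
qed

lemma innovation_combs: "j < k \<Longrightarrow> \<epsilon> t j \<in> noise_combs"
  by (subst innovation_eq_noise_comb) (auto intro: noise_combsI)

lemma innovation_mem: "j < k \<Longrightarrow> \<epsilon> t j \<in> noise_space"
  using innovation_combs noise_combs_subset by blast

text \<open>Variances pass to the limit, hence so do covariances.\<close>

lemma expectation_square_limit:
  assumes "\<And>n. Xn n \<in> noise_combs" "X \<in> borel_measurable M" "AE \<omega> in M. (\<lambda>n. Xn n \<omega>) \<longlonglongrightarrow> X \<omega>"
  shows "(\<lambda>n. expectation (\<lambda>\<omega>. (Xn n \<omega>)\<^sup>2)) \<longlonglongrightarrow> expectation (\<lambda>\<omega>. (X \<omega>)\<^sup>2)"
proof -
  have "centered_normal M (Xn n) (expectation (\<lambda>\<omega>. (Xn n \<omega>)\<^sup>2))" for n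
    using assms(1) noise_combs_subset by (intro noise.normal) auto
  from centered_normal_limit[OF this assms(2,3)] obtain w
    where w: "centered_normal M X w \<and> (\<lambda>n. expectation (\<lambda>\<omega>. (Xn n \<omega>)\<^sup>2)) \<longlonglongrightarrow> w" by (rule exE)
  then have "w = expectation (\<lambda>\<omega>. (X \<omega>)\<^sup>2)" using centered_normal_moments(2)[of X w] by simp
  with w show ?thesis by simp
qed

lemma expectation_mult_limit:
  assumes X: "\<And>n. Xn n \<in> noise_combs" "X \<in> borel_measurable M" "AE \<omega> in M. (\<lambda>n. Xn n \<omega>) \<longlonglongrightarrow> X \<omega>"
    and Y: "Y \<in> noise_combs"
  shows "(\<lambda>n. expectation (\<lambda>\<omega>. Xn n \<omega> * Y \<omega>)) \<longlonglongrightarrow> expectation (\<lambda>\<omega>. X \<omega> * Y \<omega>)"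
proof -
  have XL: "X \<in> noise_space" by (rule noise_spaceI[OF X(2,1,3)])
  have L: "Xn n \<in> noise_space" "Y \<in> noise_space" for n using X Y noise_combs_subset by auto
  have pol: "expectation (\<lambda>\<omega>. A \<omega> * Y \<omega>) = (expectation (\<lambda>\<omega>. (A \<omega> + 1 * Y \<omega>)\<^sup>2) - expectation (\<lambda>\<omega>. (A \<omega> + (-1) * Y \<omega>)\<^sup>2)) / 4"
    if A: "A \<in> noise_space" for A
  proof -
    have "expectation (\<lambda>\<omega>. (A \<omega> + 1 * Y \<omega>)\<^sup>2) - expectation (\<lambda>\<omega>. (A \<omega> + (-1) * Y \<omega>)\<^sup>2)
      = expectation (\<lambda>\<omega>. (A \<omega> + 1 * Y \<omega>)\<^sup>2 - (A \<omega> + (-1) * Y \<omega>)\<^sup>2)"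
      using A L by (intro Bochner_Integration.integral_diff[symmetric] noise.integrable_square noise.lin_mem)
    also have "\<dots> = expectation (\<lambda>\<omega>. 4 * (A \<omega> * Y \<omega>))"
      by (intro Bochner_Integration.integral_cong refl) (simp add: power2_eq_square algebra_simps)
    finally show ?thesis by simp
  qed
  have [measurable]: "Y \<in> borel_measurable M" using L by (intro noise.mem_measurable)
  have lim: "(\<lambda>n. expectation (\<lambda>\<omega>. (Xn n \<omega> + c * Y \<omega>)\<^sup>2)) \<longlonglongrightarrow> expectation (\<lambda>\<omega>. (X \<omega> + c * Y \<omega>)\<^sup>2)" for c
  proof (rule expectation_square_limit)
    show "AE \<omega> in M. (\<lambda>n. Xn n \<omega> + c * Y \<omega>) \<longlonglongrightarrow> X \<omega> + c * Y \<omega>"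
      using X(3) by eventually_elim (intro tendsto_intros)
  qed (use X Y noise_combs_lin in auto)
  have "(\<lambda>n. (expectation (\<lambda>\<omega>. (Xn n \<omega> + 1 * Y \<omega>)\<^sup>2) - expectation (\<lambda>\<omega>. (Xn n \<omega> + (-1) * Y \<omega>)\<^sup>2)) / 4)
    \<longlonglongrightarrow> (expectation (\<lambda>\<omega>. (X \<omega> + 1 * Y \<omega>)\<^sup>2) - expectation (\<lambda>\<omega>. (X \<omega> + (-1) * Y \<omega>)\<^sup>2)) / 4"
    by (intro tendsto_divide tendsto_diff lim tendsto_const) simp
  then show ?thesis unfolding pol[OF XL, symmetric] pol[OF L(1), symmetric] .
qed

text \<open>
  The variance of the sum is the sum of the variances, so the covariance vanishes.
\<close>

lemma noise_comb_orthogonal: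
  assumes "finite U" "finite V" "U \<inter> V = {}"
  shows "expectation (\<lambda>\<omega>. noise_comb U C \<omega> * noise_comb V D \<omega>) = 0"
proof -
  let ?X = "noise_comb U C" and ?Y = "noise_comb V D"
  let ?E = "\<lambda>u j. if u \<in> U then C u j else D u j"
  have L: "?X \<in> noise_space" "?Y \<in> noise_space"
    using assms by (auto intro!: subsetD[OF noise_combs_subset] noise_combsI)
  have sum_eq: "noise_comb (U \<union> V) ?E \<omega> = ?X \<omega> + ?Y \<omega>" for \<omega>
    unfolding noise_comb_def using assms
    by (subst sum.union_disjoint) (auto intro!: arg_cong2[of _ _ _ _ "(+)"] sum.cong)
  have "noise_comb (U \<union> V) ?E = (\<lambda>\<omega>. ?X \<omega> + ?Y \<omega>)" by (rule ext) (rule sum_eq)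
  then have "centered_normal M (\<lambda>\<omega>. ?X \<omega> + ?Y \<omega>) (noise_variance (U \<union> V) ?E)"
    using noise_comb_normal[of "U \<union> V" ?E] assms(1,2) by simp
  moreover have "u \<notin> U" if "u \<in> V" for u using assms(3) that by auto
  then have "noise_variance (U \<union> V) ?E = noise_variance U C + noise_variance V D"
    unfolding noise_variance_def using assms
    by (subst sum.union_disjoint) (auto intro!: arg_cong2[of _ _ _ _ "(+)"] sum.cong)
  ultimately have "centered_normal M (\<lambda>\<omega>. ?X \<omega> + ?Y \<omega>) (noise_variance U C + noise_variance V D)" by simp
  from centered_normal_moments(2)[OF this]
  have "expectation (\<lambda>\<omega>. (?X \<omega> + ?Y \<omega>)\<^sup>2) = expectation (\<lambda>\<omega>. (?X \<omega>)\<^sup>2) + expectation (\<lambda>\<omega>. (?Y \<omega>)\<^sup>2)"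
    using centered_normal_moments(2)[OF noise_comb_normal[OF assms(1)]]
      centered_normal_moments(2)[OF noise_comb_normal[OF assms(2)]] by simp
  moreover have "expectation (\<lambda>\<omega>. (?X \<omega> + ?Y \<omega>)\<^sup>2)
      = expectation (\<lambda>\<omega>. (?X \<omega>)\<^sup>2) + expectation (\<lambda>\<omega>. (?Y \<omega>)\<^sup>2) + 2 * expectation (\<lambda>\<omega>. ?X \<omega> * ?Y \<omega>)"
    using L by (simp add: power2_sum noise.integrable_square noise.integrable_mult mult.assoc)
  ultimately show ?thesis by simp
qed

lemma innovations_orthogonal:
  assumes "s \<noteq> t" "i < k" "j < k"
  shows "expectation (\<lambda>\<omega>. \<epsilon> s i \<omega> * \<epsilon> t j \<omega>) = 0"
  unfolding innovation_eq_noise_comb[OF assms(2)] innovation_eq_noise_comb[OF assms(3)]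
  using assms(1) by (intro noise_comb_orthogonal) auto

lemma process_approximation:
  assumes "i < k"
  shows "\<exists>C. AE \<omega> in M. (\<lambda>n. noise_comb ((\<lambda>h. t - int h) ` {..<n}) C \<omega>) \<longlonglongrightarrow> y t i \<omega>"
proof -
  obtain \<Psi> :: "nat \<Rightarrow> real mat" where
    \<Psi>: "AE \<omega> in M. (\<lambda>h. \<Sum>j<k. \<Psi> h $$ (i, j) * \<epsilon> (t - int h) j \<omega>) sums y t i \<omega>"
    using causal assms by blast
  let ?C = "\<lambda>u j. \<Psi> (nat (t - u)) $$ (i, j)"
  have "noise_comb ((\<lambda>h. t - int h) ` {..<n}) ?C \<omega>
      = (\<Sum>h<n. \<Sum>j<k. \<Psi> h $$ (i, j) * \<epsilon> (t - int h) j \<omega>)" for n \<omega>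
    unfolding noise_comb_def by (subst sum.reindex) (auto simp: inj_on_def)
  then have "AE \<omega> in M. (\<lambda>n. noise_comb ((\<lambda>h. t - int h) ` {..<n}) ?C \<omega>) \<longlonglongrightarrow> y t i \<omega>"
    using \<Psi> unfolding sums_def by simp
  then show ?thesis by (rule exI[of _ ?C])
qed

lemma process_mem: "i < k \<Longrightarrow> y t i \<in> noise_space"
proof -
  assume i: "i < k"
  obtain C where "AE \<omega> in M. (\<lambda>n. noise_comb ((\<lambda>h. t - int h) ` {..<n}) C \<omega>) \<longlonglongrightarrow> y t i \<omega>"
    using process_approximation[OF i] by (rule exE)
  then show "y t i \<in> noise_space"
    by (rule noise_spaceI[OF y_measurable[OF i] noise_combsI, rotated]) simp
qed

text \<open>
  The approximations of \<open>y s i\<close> involve only innovations up to time \<open>s\<close>, and covariances pass to the limit.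
\<close>

lemma process_innovation_orthogonal:
  assumes "s < t" "i < k" "j < k"
  shows "expectation (\<lambda>\<omega>. y s i \<omega> * \<epsilon> t j \<omega>) = 0"
proof -
  obtain C where C: "AE \<omega> in M. (\<lambda>n. noise_comb ((\<lambda>h. s - int h) ` {..<n}) C \<omega>) \<longlonglongrightarrow> y s i \<omega>"
    using process_approximation[OF assms(2)] by (rule exE)
  have "(\<lambda>n. expectation (\<lambda>\<omega>. noise_comb ((\<lambda>h. s - int h) ` {..<n}) C \<omega> * \<epsilon> t j \<omega>)) \<longlonglongrightarrow> expectation (\<lambda>\<omega>. y s i \<omega> * \<epsilon> t j \<omega>)"
    by (rule expectation_mult_limit[OF _ y_measurable[OF assms(2)] C innovation_combs[OF assms(3)]])
      (simp add: noise_combsI)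
  moreover have "expectation (\<lambda>\<omega>. noise_comb ((\<lambda>h. s - int h) ` {..<n}) C \<omega> * \<epsilon> t j \<omega>) = 0" for n
    unfolding innovation_eq_noise_comb[OF assms(3)]
    using assms(1) by (intro noise_comb_orthogonal) auto
  ultimately show ?thesis by (simp add: LIMSEQ_const_iff)
qed

lemma process_cov_shift:
  assumes "i < k" "j < k"
  shows "expectation (\<lambda>\<omega>. y (s + h) i \<omega> * y (t + h) j \<omega>) = expectation (\<lambda>\<omega>. y s i \<omega> * y t j \<omega>)"
proof -
  let ?P = "PiM (UNIV \<times> {..<k}) (\<lambda>_. borel) :: (int \<times> nat \<Rightarrow> real) measure"
  let ?Y = "\<lambda>h \<omega>. \<lambda>tj\<in>UNIV \<times> {..<k}. y (fst tj + h) (snd tj) \<omega>"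
  have [measurable]: "?Y h \<in> measurable M ?P" for h
    by (rule measurable_restrict) (auto intro!: y_measurable)
  have [measurable]: "(\<lambda>z. z (u, l)) \<in> borel_measurable ?P" if "l < k" for u :: int and l
    using that by (intro measurable_component_singleton) auto
  have "expectation (\<lambda>\<omega>. y (s + h) i \<omega> * y (t + h) j \<omega>) = (\<integral>z. z (s, i) * z (t, j) \<partial>distr M ?P (?Y h))" for h
    using assms by (subst integral_distr) auto
  note eq = this
  show ?thesis
    using eq[of h] eq[of 0] strictly_stationary[of h] by simp
qed

end

section \<open>The spectral norm\<close>

lemma vnorm_nonneg [simp]: "vnorm v \<ge> 0"
  by (simp add: vnorm_def l2_on_def)

lemma vnorm_mult_mat_vec_bound:
  assumes "dim_vec v = dim_col A"
  shows "vnorm (A *\<^sub>v v) \<le> sqrt (\<Sum>r<dim_row A. \<Sum>c<dim_col A. (A $$ (r, c))\<^sup>2) * vnorm v"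
proof (rule power2_le_imp_le)
  have "(vnorm (A *\<^sub>v v))\<^sup>2 = (\<Sum>r<dim_row A. (\<Sum>c<dim_col A. A $$ (r, c) * v $ c)\<^sup>2)"
    unfolding vnorm_square by (rule sum.cong) (simp_all only: dim_mult_mat_vec mult_mat_vec_index_sum assms lessThan_iff)
  also have "\<dots> \<le> (\<Sum>r<dim_row A. (\<Sum>c<dim_col A. (A $$ (r, c))\<^sup>2) * (\<Sum>c<dim_col A. (v $ c)\<^sup>2))"
    by (intro sum_mono Cauchy_Schwarz_ineq_sum)
  also have "\<dots> = (sqrt (\<Sum>r<dim_row A. \<Sum>c<dim_col A. (A $$ (r, c))\<^sup>2) * vnorm v)\<^sup>2"
    unfolding power_mult_distrib vnorm_square assms
    by (simp add: sum_distrib_right[symmetric] sum_nonneg)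
  finally show "(vnorm (A *\<^sub>v v))\<^sup>2 \<le> (sqrt (\<Sum>r<dim_row A. \<Sum>c<dim_col A. (A $$ (r, c))\<^sup>2) * vnorm v)\<^sup>2" .
qed (simp add: sum_nonneg)

lemma vnorm_smult: "vnorm (c \<cdot>\<^sub>v v) = \<bar>c\<bar> * vnorm v"
proof -
  have "(vnorm (c \<cdot>\<^sub>v v))\<^sup>2 = (\<bar>c\<bar> * vnorm v)\<^sup>2"
    unfolding power_mult_distrib vnorm_square by (simp add: power_mult_distrib sum_distrib_left)
  then show ?thesis by (simp add: power2_eq_iff_nonneg)
qed

lemma spectral_norm_bdd:
  "bdd_above ((\<lambda>v. vnorm (A *\<^sub>v v)) ` {v \<in> carrier_vec (dim_col A). vnorm v \<le> 1})"
proof (rule bdd_aboveI2)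
  fix v assume "v \<in> {v \<in> carrier_vec (dim_col A). vnorm v \<le> 1}"
  then have v: "dim_vec v = dim_col A" "vnorm v \<le> 1" by auto
  have "vnorm (A *\<^sub>v v) \<le> sqrt (\<Sum>r<dim_row A. \<Sum>c<dim_col A. (A $$ (r, c))\<^sup>2) * vnorm v"
    using v(1) by (rule vnorm_mult_mat_vec_bound)
  also have "\<dots> \<le> sqrt (\<Sum>r<dim_row A. \<Sum>c<dim_col A. (A $$ (r, c))\<^sup>2) * 1"
    using v(2) by (intro mult_left_mono) (auto intro!: sum_nonneg)
  finally show "vnorm (A *\<^sub>v v) \<le> sqrt (\<Sum>r<dim_row A. \<Sum>c<dim_col A. (A $$ (r, c))\<^sup>2) * 1" .
qed

lemma vnorm_zero: "vnorm (0\<^sub>v n) = 0"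
  by (simp add: vnorm_def l2_on_def L2_set_def)

lemma spectral_norm_nonneg: "spectral_norm A \<ge> 0"
proof -
  have "vnorm (A *\<^sub>v 0\<^sub>v (dim_col A)) \<le> spectral_norm A"
    unfolding spectral_norm_def by (rule cSUP_upper[OF _ spectral_norm_bdd]) (simp add: vnorm_zero)
  then show ?thesis using vnorm_nonneg order_trans by blast
qed

lemma vnorm_mult_mat_vec_le:
  assumes v: "v \<in> carrier_vec (dim_col A)"
  shows "vnorm (A *\<^sub>v v) \<le> spectral_norm A * vnorm v"
proof (cases "vnorm v = 0")
  case True
  then show ?thesis using vnorm_mult_mat_vec_bound[of v A] v by simp
next
  case False
  then have pos: "vnorm v > 0" using vnorm_nonneg[of v] by linarith
  let ?w = "(1 / vnorm v) \<cdot>\<^sub>v v"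
  have "vnorm (A *\<^sub>v ?w) \<le> spectral_norm A"
    unfolding spectral_norm_def using v pos
    by (intro cSUP_upper[OF _ spectral_norm_bdd]) (simp add: vnorm_smult)
  moreover have "A *\<^sub>v ?w = (1 / vnorm v) \<cdot>\<^sub>v (A *\<^sub>v v)"
    using v by (intro mult_mat_vec) auto
  ultimately show ?thesis using pos by (simp add: vnorm_smult field_simps)
qed

lemma abs_vec_index_le_vnorm:
  assumes "j < dim_vec v" shows "\<bar>v $ j\<bar> \<le> vnorm v"
proof (rule power2_le_imp_le)
  show "\<bar>v $ j\<bar>\<^sup>2 \<le> (vnorm v)\<^sup>2"
    unfolding vnorm_square using member_le_sum[of j "{..<dim_vec v}" "\<lambda>j. (v $ j)\<^sup>2"] assms by simp
qed simp

lemma vnorm_unit_vec: "j < n \<Longrightarrow> vnorm (unit_vec n j) = 1"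
proof -
  assume j: "j < n"
  have "(vnorm (unit_vec n j))\<^sup>2 = (\<Sum>r<n. if r = j then 1 else 0)"
    unfolding vnorm_square by (rule sum.cong) (use j in auto)
  also have "\<dots> = 1" using j by simp
  finally have "vnorm (unit_vec n j) = 1 \<or> vnorm (unit_vec n j) = -1"
    by (simp add: power2_eq_1_iff)
  then show "vnorm (unit_vec n j) = 1" using vnorm_nonneg[of "unit_vec n j"] by linarith
qed

lemma abs_mat_vec_index_le:
  assumes "v \<in> carrier_vec (dim_col A)" "j < dim_row A"
  shows "\<bar>(A *\<^sub>v v) $ j\<bar> \<le> spectral_norm A * vnorm v"
  using order_trans[OF abs_vec_index_le_vnorm vnorm_mult_mat_vec_le[OF assms(1)]] assms(2) by simp

lemma mat_col_eq_mult_unit: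
  fixes A :: "real mat"
  assumes "A \<in> carrier_mat n n" "a < n" "b < n"
  shows "(A *\<^sub>v unit_vec n b) $ a = A $$ (a, b)"
  using assms by (simp add: scalar_prod_right_unit)

lemma abs_mat_index_le:
  assumes "A \<in> carrier_mat n n" "a < n" "b < n"
  shows "\<bar>A $$ (a, b)\<bar> \<le> spectral_norm A"
  using abs_mat_vec_index_le[of "unit_vec n b" A a] assms mat_col_eq_mult_unit[OF assms] vnorm_unit_vec[OF assms(3)]
  by simp

section \<open>Covariances of the regressors\<close>

text \<open>
  Division with remainder identifies \<open>{..<k * p}\<close> with the pairs of a lag and a component.
\<close>

lemma sum_lessThan_mult:
  fixes f :: "nat \<Rightarrow> nat \<Rightarrow> real"
  assumes "k > 0"
  shows "(\<Sum>c<k * p. f (c div k) (c mod k)) = (\<Sum>l<p. \<Sum>j<k. f l j)"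
proof -
  have "(\<Sum>c<k * p. f (c div k) (c mod k)) = (\<Sum>l<p. \<Sum>c\<in>{l * k..<l * k + k}. f (c div k) (c mod k))"
    by (subst sum.nat_group) (simp add: mult.commute)
  also have "\<dots> = (\<Sum>l<p. \<Sum>j<k. f l j)"
  proof (rule sum.cong[OF refl])
    fix l
    have "(\<Sum>c\<in>{l * k..<l * k + k}. f (c div k) (c mod k)) = (\<Sum>j\<in>{0..<k}. f ((j + l * k) div k) ((j + l * k) mod k))"
      using sum.shift_bounds_nat_ivl[of "\<lambda>c. f (c div k) (c mod k)" 0 "l * k" k] by (simp add: add.commute)
    also have "\<dots> = (\<Sum>j<k. f l j)"
      using assms by (intro sum.cong) auto
    finally show "(\<Sum>c\<in>{l * k..<l * k + k}. f (c div k) (c mod k)) = (\<Sum>j<k. f l j)" .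
  qed
  finally show ?thesis .
qed

lemma sum_lag_le:
  fixes \<phi> :: "nat \<Rightarrow> real"
  assumes nn: "\<And>h. \<phi> h \<ge> 0" and inj: "inj_on g A" and sub: "g ` A \<subseteq> {0..T}"
  shows "(\<Sum>r\<in>A. \<phi> (g r)) \<le> (\<Sum>h=0..T. \<phi> h)"
proof -
  have "(\<Sum>r\<in>A. \<phi> (g r)) = (\<Sum>h\<in>g ` A. \<phi> h)" by (simp add: sum.reindex[OF inj])
  also have "\<dots> \<le> (\<Sum>h=0..T. \<phi> h)" using nn sub by (intro sum_mono2) auto
  finally show ?thesis .
qed

context gaussian_var
begin

abbreviation "N \<equiv> k * p"
abbreviation "Z t c \<equiv> \<lambda>\<omega>. regressor k p y t \<omega> $ c"
abbreviation "F \<equiv> companion k p \<Phi>"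
abbreviation "\<Gamma> \<equiv> regressor_cov M k p y"

lemma k_gt_0: "k > 0" using k_pos by auto

lemma regressor_eq: "c < N \<Longrightarrow> Z t c = y (t - int (Suc (c div k))) (c mod k)"
  by (auto simp: regressor_def)

lemma regressor_index: "c < N \<Longrightarrow> regressor k p y t \<omega> $ c = y (t - int (Suc (c div k))) (c mod k) \<omega>"
  by (simp add: regressor_def)

lemma mod_k: "c mod k < k" using k_gt_0 by simp

lemma regressor_mem: "c < N \<Longrightarrow> Z t c \<in> noise_space"
  using regressor_eq process_mem[OF mod_k] by simp

lemma F_carrier: "F \<in> carrier_mat N N" by (simp add: companion_def)
lemma \<Gamma>_carrier: "\<Gamma> \<in> carrier_mat N N" by (simp add: regressor_cov_def)

lemma regressor_cov_shift:
  assumes "a < N" "b < N"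
  shows "expectation (\<lambda>\<omega>. Z (s + h) a \<omega> * Z (t + h) b \<omega>) = expectation (\<lambda>\<omega>. Z s a \<omega> * Z t b \<omega>)"
  using process_cov_shift[OF mod_k mod_k, of "s - int (Suc (a div k))" h a "t - int (Suc (b div k))" b]
  unfolding regressor_index[OF assms(1)] regressor_index[OF assms(2)] by (simp add: algebra_simps)

lemma regressor_cov_eq:
  assumes "a < N" "b < N"
  shows "expectation (\<lambda>\<omega>. Z t a \<omega> * Z t b \<omega>) = \<Gamma> $$ (a, b)"
  using regressor_cov_shift[OF assms, of 1 "t - 1" 1] assms by (simp add: regressor_cov_def)

lemma model_equation:
  assumes "i < k"
  shows "AE \<omega> in M. y t i \<omega> = (\<Sum>c<N. true_param k p \<Phi> i $ c * Z t c \<omega>) + \<epsilon> t i \<omega>"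
proof -
  have "(\<Sum>l=1..p. \<Sum>j<k. \<Phi> l $$ (i, j) * y (t - int l) j \<omega>)
      = (\<Sum>c<N. true_param k p \<Phi> i $ c * Z t c \<omega>)" for \<omega>
  proof -
    have "(\<Sum>l=1..p. \<Sum>j<k. \<Phi> l $$ (i, j) * y (t - int l) j \<omega>)
      = (\<Sum>l<p. \<Sum>j<k. \<Phi> (Suc l) $$ (i, j) * y (t - int (Suc l)) j \<omega>)"
      by (simp add: sum.atLeast1_atMost_eq)
    also have "\<dots> = (\<Sum>c<N. \<Phi> (Suc (c div k)) $$ (i, c mod k) * y (t - int (Suc (c div k))) (c mod k) \<omega>)"
      by (rule sum_lessThan_mult[OF k_gt_0, symmetric])
    also have "\<dots> = (\<Sum>c<N. true_param k p \<Phi> i $ c * Z t c \<omega>)"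
      by (intro sum.cong refl) (simp add: true_param_def regressor_def)
    finally show ?thesis .
  qed
  then show ?thesis using var_equation[OF assms, of t] by simp
qed

text \<open>
  The first \<open>k\<close> rows of the companion matrix are the autoregression, whose innovation contributes nothing by
  orthogonality; the other rows shift the lags.
\<close>

lemma companion_recursion:
  assumes X: "X \<in> noise_space" and r: "r < N"
    and orth: "\<And>j. j < k \<Longrightarrow> expectation (\<lambda>\<omega>. X \<omega> * \<epsilon> t j \<omega>) = 0"
  shows "expectation (\<lambda>\<omega>. X \<omega> * Z (t + 1) r \<omega>) = (\<Sum>c<N. F $$ (r, c) * expectation (\<lambda>\<omega>. X \<omega> * Z t c \<omega>))"
proof (cases "r < k")
  case True
  have [measurable]: "X \<in> borel_measurable M" using X by (rule noise.mem_measurable)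
  have [measurable]: "Z t c \<in> borel_measurable M" if "c < N" for t c
    using regressor_mem[OF that] by (rule noise.mem_measurable)
  have [measurable]: "\<epsilon> t r \<in> borel_measurable M" using innovation_mem[OF True] by (rule noise.mem_measurable)
  have Zr: "regressor k p y (t + 1) \<omega> $ r = y t r \<omega>" for \<omega> using True r regressor_index[OF r] by simp
  have "expectation (\<lambda>\<omega>. X \<omega> * Z (t + 1) r \<omega>)
    = expectation (\<lambda>\<omega>. (\<Sum>c<N. true_param k p \<Phi> r $ c * Z t c \<omega>) * X \<omega> + X \<omega> * \<epsilon> t r \<omega>)"
    unfolding Zr
  proof (rule integral_cong_AE)
    show "AE \<omega> in M. X \<omega> * y t r \<omega> = (\<Sum>c<N. true_param k p \<Phi> r $ c * Z t c \<omega>) * X \<omega> + X \<omega> * \<epsilon> t r \<omega>"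
      using model_equation[OF True, of t] by eventually_elim (simp add: algebra_simps)
    show "(\<lambda>\<omega>. X \<omega> * y t r \<omega>) \<in> borel_measurable M" using y_measurable[OF True] by simp
    show "(\<lambda>\<omega>. (\<Sum>c<N. true_param k p \<Phi> r $ c * Z t c \<omega>) * X \<omega> + X \<omega> * \<epsilon> t r \<omega>) \<in> borel_measurable M"
      by measurable
  qed
  also have "\<dots> = expectation (\<lambda>\<omega>. (\<Sum>c<N. true_param k p \<Phi> r $ c * Z t c \<omega>) * X \<omega>) + 0"
    using X True orth[OF True]
    by (subst Bochner_Integration.integral_add)
      (auto intro!: noise.integrable_mult noise.sum_mem regressor_mem innovation_mem)
  also have "\<dots> = (\<Sum>c<N. true_param k p \<Phi> r $ c * expectation (\<lambda>\<omega>. Z t c \<omega> * X \<omega>))"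
    using X by (simp, intro noise.expectation_lin_mult regressor_mem) auto
  also have "\<dots> = (\<Sum>c<N. F $$ (r, c) * expectation (\<lambda>\<omega>. X \<omega> * Z t c \<omega>))"
    using True r by (auto intro!: sum.cong simp: companion_def true_param_def mult.commute)
  finally show ?thesis .
next
  case False
  then have rk: "r \<ge> k" by simp
  have "(\<Sum>c<N. F $$ (r, c) * expectation (\<lambda>\<omega>. X \<omega> * Z t c \<omega>))
     = (\<Sum>c<N. if c = r - k then expectation (\<lambda>\<omega>. X \<omega> * Z t c \<omega>) else 0)"
    using False r rk by (intro sum.cong) (auto simp: companion_def)
  also have "\<dots> = expectation (\<lambda>\<omega>. X \<omega> * Z t (r - k) \<omega>)" using r rk by simp
  also have "Z t (r - k) = Z (t + 1) r"
    using r rk k_gt_0 regressor_eq[of "r - k" t] regressor_eq[of r "t + 1"]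
    by (simp add: le_div_geq le_mod_geq diff_diff_eq add.commute)
  finally show ?thesis by simp
qed

lemma companion_power:
  assumes X: "X \<in> noise_space"
    and orth: "\<And>u j. u \<ge> t \<Longrightarrow> j < k \<Longrightarrow> expectation (\<lambda>\<omega>. X \<omega> * \<epsilon> u j \<omega>) = 0"
  shows "vec N (\<lambda>c. expectation (\<lambda>\<omega>. X \<omega> * Z (t + int h) c \<omega>))
     = (F ^\<^sub>m h) *\<^sub>v vec N (\<lambda>c. expectation (\<lambda>\<omega>. X \<omega> * Z t c \<omega>))"
  using orth
proof (induction h arbitrary: t)
  case 0
  show ?case using F_carrier by simp
next
  case (Suc h)
  let ?m = "\<lambda>t. vec N (\<lambda>c. expectation (\<lambda>\<omega>. X \<omega> * Z t c \<omega>))"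
  have step: "?m (t + 1) = F *\<^sub>v ?m t"
  proof (rule eq_vecI)
    fix r assume "r < dim_vec (F *\<^sub>v ?m t)"
    then have r: "r < N" using F_carrier by simp
    have "(F *\<^sub>v ?m t) $ r = (\<Sum>c<N. F $$ (r, c) * ?m t $ c)"
      using mult_mat_vec_index_sum[of r F "?m t"] r F_carrier by simp
    also have "\<dots> = expectation (\<lambda>\<omega>. X \<omega> * Z (t + 1) r \<omega>)"
    proof -
      have "expectation (\<lambda>\<omega>. X \<omega> * Z (t + 1) r \<omega>)
          = (\<Sum>c<N. F $$ (r, c) * expectation (\<lambda>\<omega>. X \<omega> * Z t c \<omega>))"
        by (rule companion_recursion[OF X r]) (rule Suc.prems, simp_all)
      then show ?thesis by (simp cong: sum.cong_simp)
    qed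
    finally show "?m (t + 1) $ r = (F *\<^sub>v ?m t) $ r" using r by simp
  qed (use F_carrier in simp)
  have "?m (t + int (Suc h)) = ?m ((t + 1) + int h)" by (simp add: algebra_simps)
  also have "\<dots> = (F ^\<^sub>m h) *\<^sub>v ?m (t + 1)" by (rule Suc.IH) (use Suc.prems in auto)
  also have "\<dots> = (F ^\<^sub>m h * F) *\<^sub>v ?m t"
    unfolding step using F_carrier by (intro assoc_mult_mat_vec[symmetric]) auto
  finally show ?case by simp
qed

lemma regressor_innovation_orthogonal:
  assumes "c < N" "j < k" "u \<ge> t"
  shows "expectation (\<lambda>\<omega>. Z t c \<omega> * \<epsilon> u j \<omega>) = 0"
  unfolding regressor_index[OF assms(1)]
  using assms by (intro process_innovation_orthogonal mod_k) auto

lemma cov_at_lag_le: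
  assumes X: "X \<in> noise_space" and a: "a < N"
    and orth: "\<And>u j. u \<ge> t \<Longrightarrow> j < k \<Longrightarrow> expectation (\<lambda>\<omega>. X \<omega> * \<epsilon> u j \<omega>) = 0"
  shows "\<bar>expectation (\<lambda>\<omega>. X \<omega> * Z (t + int h) a \<omega>)\<bar>
    \<le> spectral_norm (F ^\<^sub>m h) * vnorm (vec N (\<lambda>c. expectation (\<lambda>\<omega>. X \<omega> * Z t c \<omega>)))"
proof -
  have Fh: "F ^\<^sub>m h \<in> carrier_mat N N" using F_carrier by simp
  have "expectation (\<lambda>\<omega>. X \<omega> * Z (t + int h) a \<omega>)
      = ((F ^\<^sub>m h) *\<^sub>v vec N (\<lambda>c. expectation (\<lambda>\<omega>. X \<omega> * Z t c \<omega>))) $ a"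
    using arg_cong[where f="\<lambda>v. v $ a", OF companion_power[where h=h, OF X orth]] a by simp
  moreover have "\<bar>((F ^\<^sub>m h) *\<^sub>v v) $ a\<bar> \<le> spectral_norm (F ^\<^sub>m h) * vnorm v" if "v \<in> carrier_vec N" for v
    by (rule abs_mat_vec_index_le) (use that Fh a in \<open>simp_all only: carrier_matD\<close>)
  ultimately show ?thesis by simp
qed

lemma regressor_cov_lag_le:
  assumes "a < N" "b < N"
  shows "\<bar>expectation (\<lambda>\<omega>. Z t b \<omega> * Z (t + int h) a \<omega>)\<bar> \<le> spectral_norm (F ^\<^sub>m h) * spectral_norm \<Gamma>"
proof -
  have m: "vec N (\<lambda>c. expectation (\<lambda>\<omega>. Z t b \<omega> * Z t c \<omega>)) = \<Gamma> *\<^sub>v unit_vec N b"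
  proof (rule eq_vecI)
    fix c assume "c < dim_vec (\<Gamma> *\<^sub>v unit_vec N b)"
    then have c: "c < N" using \<Gamma>_carrier by simp
    have "expectation (\<lambda>\<omega>. Z t b \<omega> * Z t c \<omega>) = expectation (\<lambda>\<omega>. Z t c \<omega> * Z t b \<omega>)"
      by (simp add: mult.commute)
    then show "vec N (\<lambda>c. expectation (\<lambda>\<omega>. Z t b \<omega> * Z t c \<omega>)) $ c = (\<Gamma> *\<^sub>v unit_vec N b) $ c"
      using c regressor_cov_eq[OF c assms(2)] mat_col_eq_mult_unit[OF \<Gamma>_carrier c assms(2)] by simp
  qed (use \<Gamma>_carrier in simp)
  have "\<bar>expectation (\<lambda>\<omega>. Z t b \<omega> * Z (t + int h) a \<omega>)\<bar> \<le> spectral_norm (F ^\<^sub>m h) * vnorm (\<Gamma> *\<^sub>v unit_vec N b)"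
    unfolding m[symmetric]
    by (rule cov_at_lag_le[OF regressor_mem[OF assms(2)] assms(1) regressor_innovation_orthogonal[OF assms(2)]])
  also have "\<dots> \<le> spectral_norm (F ^\<^sub>m h) * (spectral_norm \<Gamma> * 1)"
    using vnorm_mult_mat_vec_le[of "unit_vec N b" \<Gamma>] \<Gamma>_carrier vnorm_unit_vec[OF assms(2)] spectral_norm_nonneg
    by (intro mult_left_mono) auto
  finally show ?thesis by simp
qed

text \<open>
  The squared length of this vector \<open>m\<close> is itself a covariance, namely that of \<open>X\<close> and \<open>m \<bullet> Z\<^sub>t\<close>, and the variance of
  the latter is at most \<open>\<parallel>\<Gamma>\<parallel>\<close> times the squared length.
\<close>

lemma cov_vec_norm_le:
  assumes X: "X \<in> noise_space" and pos: "spectral_norm \<Gamma> > 0"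
  shows "vnorm (vec N (\<lambda>c. expectation (\<lambda>\<omega>. X \<omega> * Z t c \<omega>)))
     \<le> sqrt (expectation (\<lambda>\<omega>. (X \<omega>)\<^sup>2)) * sqrt (spectral_norm \<Gamma>)"
proof -
  define m where "m = vec N (\<lambda>c. expectation (\<lambda>\<omega>. X \<omega> * Z t c \<omega>))"
  define Y where "Y \<omega> = (\<Sum>c<N. m $ c * Z t c \<omega>)" for \<omega>
  define g where "g = spectral_norm \<Gamma>"
  have dm: "dim_vec m = N" by (simp add: m_def)
  have YL: "Y \<in> noise_space" unfolding Y_def[abs_def] by (intro noise.sum_mem regressor_mem) auto
  have XY: "expectation (\<lambda>\<omega>. Y \<omega> * X \<omega>) = (vnorm m)\<^sup>2"
  proof -
    have "expectation (\<lambda>\<omega>. Y \<omega> * X \<omega>) = (\<Sum>c<N. m $ c * expectation (\<lambda>\<omega>. Z t c \<omega> * X \<omega>))"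
      unfolding Y_def using X by (intro noise.expectation_lin_mult regressor_mem) auto
    also have "\<dots> = (\<Sum>c<N. (m $ c)\<^sup>2)"
      by (intro sum.cong) (auto simp: m_def power2_eq_square mult.commute)
    finally show ?thesis by (simp add: vnorm_square dm)
  qed
  have YY: "expectation (\<lambda>\<omega>. (Y \<omega>)\<^sup>2) \<le> g * (vnorm m)\<^sup>2"
  proof -
    have "expectation (\<lambda>\<omega>. (Y \<omega>)\<^sup>2) = (\<Sum>a<N. \<Sum>b<N. m $ a * m $ b * expectation (\<lambda>\<omega>. Z t a \<omega> * Z t b \<omega>))"
      unfolding Y_def by (intro noise.expectation_lin_square regressor_mem) auto
    also have "\<dots> = (\<Sum>a<N. m $ a * (\<Gamma> *\<^sub>v m) $ a)"
    proof (rule sum.cong[OF refl])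
      fix a assume a: "a \<in> {..<N}"
      have "(\<Gamma> *\<^sub>v m) $ a = (\<Sum>b<N. \<Gamma> $$ (a, b) * m $ b)"
        using mult_mat_vec_index_sum[of a \<Gamma> m] a \<Gamma>_carrier dm by simp
      moreover have "(\<Sum>b<N. m $ a * m $ b * expectation (\<lambda>\<omega>. Z t a \<omega> * Z t b \<omega>))
          = (\<Sum>b<N. m $ a * (\<Gamma> $$ (a, b) * m $ b))"
        using a by (intro sum.cong) (simp_all add: regressor_cov_eq)
      ultimately show "(\<Sum>b<N. m $ a * m $ b * expectation (\<lambda>\<omega>. Z t a \<omega> * Z t b \<omega>)) = m $ a * (\<Gamma> *\<^sub>v m) $ a"
        by (simp add: sum_distrib_left)
    qed
    also have "\<dots> \<le> (\<Sum>a<N. \<bar>m $ a\<bar> * \<bar>(\<Gamma> *\<^sub>v m) $ a\<bar>)"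
      by (intro sum_mono) (metis abs_ge_self abs_mult)
    also have "\<dots> \<le> L2_set (\<lambda>a. m $ a) {..<N} * L2_set (\<lambda>a. (\<Gamma> *\<^sub>v m) $ a) {..<N}"
      by (rule L2_set_mult_ineq)
    also have "\<dots> = vnorm m * vnorm (\<Gamma> *\<^sub>v m)"
      using \<Gamma>_carrier dm by (simp add: vnorm_def l2_on_def)
    also have "\<dots> \<le> vnorm m * (g * vnorm m)"
      unfolding g_def using \<Gamma>_carrier dm by (intro mult_left_mono vnorm_mult_mat_vec_le) (auto intro: carrier_vecI)
    finally show ?thesis by (simp add: power2_eq_square mult_ac)
  qed
  \<comment> \<open>expanding the square of X - Y/g gives the Cauchy-Schwarz inequality in the required form\<close>
  have "0 \<le> expectation (\<lambda>\<omega>. (X \<omega> + (- 1 / g) * Y \<omega>)\<^sup>2)" by simp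
  also have "\<dots> = expectation (\<lambda>\<omega>. (X \<omega>)\<^sup>2 - 2 / g * (Y \<omega> * X \<omega>) + 1 / g\<^sup>2 * (Y \<omega>)\<^sup>2)"
    by (intro Bochner_Integration.integral_cong refl) (simp add: power2_diff power_divide mult_ac)
  also have "\<dots> = expectation (\<lambda>\<omega>. (X \<omega>)\<^sup>2) - 2 / g * (vnorm m)\<^sup>2 + 1 / g\<^sup>2 * expectation (\<lambda>\<omega>. (Y \<omega>)\<^sup>2)"
    using X YL by (simp add: noise.integrable_square noise.integrable_mult XY)
  also have "\<dots> \<le> expectation (\<lambda>\<omega>. (X \<omega>)\<^sup>2) - 2 / g * (vnorm m)\<^sup>2 + 1 / g\<^sup>2 * (g * (vnorm m)\<^sup>2)"
    using YY by (intro add_left_mono mult_left_mono) auto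
  also have "\<dots> = expectation (\<lambda>\<omega>. (X \<omega>)\<^sup>2) - (vnorm m)\<^sup>2 / g"
    using pos by (simp add: g_def power2_eq_square field_simps)
  finally have "(vnorm m)\<^sup>2 \<le> expectation (\<lambda>\<omega>. (X \<omega>)\<^sup>2) * g"
    using pos by (simp add: g_def field_simps)
  then have "vnorm m \<le> sqrt (expectation (\<lambda>\<omega>. (X \<omega>)\<^sup>2) * g)" by (rule real_le_rsqrt)
  then show ?thesis by (simp add: real_sqrt_mult m_def g_def)
qed

end

section \<open>Concentration of the Gram matrix and of the score\<close>

context gaussian_var
begin

definition lag_sum :: "nat \<Rightarrow> real" where
  "lag_sum T = (\<Sum>h=0..T. spectral_norm (F ^\<^sub>m h))"

lemma lag_sum_nonneg: "lag_sum T \<ge> 0"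
  unfolding lag_sum_def by (intro sum_nonneg spectral_norm_nonneg)

abbreviation sample_time :: "nat \<Rightarrow> nat \<Rightarrow> int" where
  "sample_time T r \<equiv> int T - int r"

lemma split_at_row:
  fixes f :: "nat \<Rightarrow> real"
  assumes "r < T" shows "(\<Sum>r'<T. f r') = (\<Sum>r'\<le>r. f r') + (\<Sum>r'\<in>{r<..<T}. f r')"
proof -
  have e: "{..<T} = {..r} \<union> {r<..<T}" using assms by auto
  have "{..r} \<inter> {r<..<T} = {}" by auto
  then show ?thesis unfolding e by (intro sum.union_disjoint) simp_all
qed

text \<open>
  The covariance at lag \<open>h\<close> is at most \<open>\<parallel>F\<^sup>h\<parallel>\<parallel>\<Gamma>\<parallel>\<close>, and every lag occurs at most twice in a row of the
  covariance matrix.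
\<close>

lemma regressor_row_sum:
  assumes r: "r < T" and a: "a < N" and b: "b < N"
  shows "(\<Sum>r'<T. \<bar>expectation (\<lambda>\<omega>. Z (sample_time T r) a \<omega> * Z (sample_time T r') b \<omega>)\<bar>)
    \<le> 2 * (spectral_norm \<Gamma> * lag_sum T)"
proof -
  let ?E = "\<lambda>r'. \<bar>expectation (\<lambda>\<omega>. Z (sample_time T r) a \<omega> * Z (sample_time T r') b \<omega>)\<bar>"
  let ?\<phi> = "\<lambda>h. spectral_norm (F ^\<^sub>m h) * spectral_norm \<Gamma>"
  have \<phi>0: "?\<phi> h \<ge> 0" for h using spectral_norm_nonneg by simp
  have tot: "(\<Sum>h=0..T. ?\<phi> h) = spectral_norm \<Gamma> * lag_sum T"
    by (simp add: lag_sum_def sum_distrib_left mult.commute)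
  have comm: "expectation (\<lambda>\<omega>. Z s a \<omega> * Z t b \<omega>) = expectation (\<lambda>\<omega>. Z t b \<omega> * Z s a \<omega>)" for s t
    by (simp add: mult.commute)
  have "(\<Sum>r'\<le>r. ?E r') \<le> (\<Sum>r'\<le>r. ?\<phi> (r - r'))"
  proof (rule sum_mono)
    fix r' assume "r' \<in> {..r}"
    then have eq: "sample_time T r' = sample_time T r + int (r - r')" by (simp add: of_nat_diff)
    show "?E r' \<le> ?\<phi> (r - r')" unfolding eq by (rule regressor_cov_lag_le[OF b a])
  qed
  also have "\<dots> \<le> (\<Sum>h=0..T. ?\<phi> h)"
    using r by (intro sum_lag_le[OF \<phi>0]) (auto simp: inj_on_def)
  finally have 1: "(\<Sum>r'\<le>r. ?E r') \<le> spectral_norm \<Gamma> * lag_sum T" unfolding tot .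
  have "(\<Sum>r'\<in>{r<..<T}. ?E r') \<le> (\<Sum>r'\<in>{r<..<T}. ?\<phi> (r' - r))"
  proof (rule sum_mono)
    fix r' assume "r' \<in> {r<..<T}"
    then have eq: "sample_time T r = sample_time T r' + int (r' - r)" by (simp add: of_nat_diff)
    show "?E r' \<le> ?\<phi> (r' - r)" unfolding eq comm by (rule regressor_cov_lag_le[OF a b])
  qed
  also have "\<dots> \<le> (\<Sum>h=0..T. ?\<phi> h)"
    using r by (intro sum_lag_le[OF \<phi>0]) (auto simp: inj_on_def)
  finally have 2: "(\<Sum>r'\<in>{r<..<T}. ?E r') \<le> spectral_norm \<Gamma> * lag_sum T" unfolding tot .
  show ?thesis unfolding split_at_row[OF r] using 1 2 by simp
qed

lemma expectation_innovation_square: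
  assumes "i < k"
  shows "expectation (\<lambda>\<omega>. (\<epsilon> t i \<omega>)\<^sup>2) = expectation (\<lambda>\<omega>. (\<epsilon> 1 i \<omega>)\<^sup>2)"
proof -
  let ?C = "\<lambda>(u::int) l. if l = i then 1 else 0 :: real"
  have "expectation (\<lambda>\<omega>. (\<epsilon> t i \<omega>)\<^sup>2) = noise_variance {t} ?C" for t
    unfolding innovation_eq_noise_comb[OF assms]
    by (rule centered_normal_moments(2)[OF noise_comb_normal]) simp
  then show ?thesis by (simp add: noise_variance_def)
qed

text \<open>
  From time \<open>t + 1\<close> on, the innovation of time \<open>t\<close> is propagated by the companion matrix.
\<close>

lemma innovation_regressor_lag_le:
  assumes i: "i < k" and a: "a < N" and pos: "spectral_norm \<Gamma> > 0"
  shows "\<bar>expectation (\<lambda>\<omega>. \<epsilon> t i \<omega> * Z (t + 1 + int h) a \<omega>)\<bar>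
    \<le> spectral_norm (F ^\<^sub>m h) * (sqrt (expectation (\<lambda>\<omega>. (\<epsilon> 1 i \<omega>)\<^sup>2)) * sqrt (spectral_norm \<Gamma>))"
proof -
  note X = innovation_mem[OF i, of t]
  have "\<bar>expectation (\<lambda>\<omega>. \<epsilon> t i \<omega> * Z (t + 1 + int h) a \<omega>)\<bar>
    \<le> spectral_norm (F ^\<^sub>m h) * vnorm (vec N (\<lambda>c. expectation (\<lambda>\<omega>. \<epsilon> t i \<omega> * Z (t + 1) c \<omega>)))"
    by (rule cov_at_lag_le[OF X a]) (use innovations_orthogonal i in auto)
  also have "\<dots> \<le> spectral_norm (F ^\<^sub>m h) * (sqrt (expectation (\<lambda>\<omega>. (\<epsilon> 1 i \<omega>)\<^sup>2)) * sqrt (spectral_norm \<Gamma>))"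
    using cov_vec_norm_le[OF X pos, of "t + 1"] expectation_innovation_square[OF i, of t]
    by (intro mult_left_mono spectral_norm_nonneg) simp
  finally show ?thesis .
qed

text \<open>
  An innovation is correlated only with later regressors, so each lag occurs at most once in these rows.
\<close>

lemma innovation_regressor_row_sums:
  assumes r: "r < T" and i: "i < k" and a: "a < N" and pos: "spectral_norm \<Gamma> > 0"
  defines "B \<equiv> sqrt (expectation (\<lambda>\<omega>. (\<epsilon> 1 i \<omega>)\<^sup>2)) * sqrt (spectral_norm \<Gamma>) * lag_sum T"
  shows "(\<Sum>r'<T. \<bar>expectation (\<lambda>\<omega>. \<epsilon> (sample_time T r) i \<omega> * Z (sample_time T r') a \<omega>)\<bar>) \<le> B"
    and "(\<Sum>r'<T. \<bar>expectation (\<lambda>\<omega>. Z (sample_time T r) a \<omega> * \<epsilon> (sample_time T r') i \<omega>)\<bar>) \<le> B"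
    and "(\<Sum>r'<T. \<bar>expectation (\<lambda>\<omega>. \<epsilon> (sample_time T r) i \<omega> * \<epsilon> (sample_time T r') i \<omega>)\<bar>)
      = expectation (\<lambda>\<omega>. (\<epsilon> 1 i \<omega>)\<^sup>2)"
proof -
  let ?\<phi> = "\<lambda>h. spectral_norm (F ^\<^sub>m h) * (sqrt (expectation (\<lambda>\<omega>. (\<epsilon> 1 i \<omega>)\<^sup>2)) * sqrt (spectral_norm \<Gamma>))"
  let ?E1 = "\<lambda>r'. \<bar>expectation (\<lambda>\<omega>. \<epsilon> (sample_time T r) i \<omega> * Z (sample_time T r') a \<omega>)\<bar>"
  let ?E2 = "\<lambda>r'. \<bar>expectation (\<lambda>\<omega>. Z (sample_time T r) a \<omega> * \<epsilon> (sample_time T r') i \<omega>)\<bar>"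
  have \<phi>0: "?\<phi> h \<ge> 0" for h using spectral_norm_nonneg by simp
  have tot: "(\<Sum>h=0..T. ?\<phi> h) = B"
    by (simp add: B_def lag_sum_def sum_distrib_left sum_distrib_right mult_ac)
  have comm: "expectation (\<lambda>\<omega>. \<epsilon> s i \<omega> * Z t a \<omega>) = expectation (\<lambda>\<omega>. Z t a \<omega> * \<epsilon> s i \<omega>)" for s t
    by (simp add: mult.commute)
  have z: "expectation (\<lambda>\<omega>. Z t a \<omega> * \<epsilon> s i \<omega>) = 0" if "t \<le> s" for s t
    using regressor_innovation_orthogonal[OF a i] that by simp
  have "(\<Sum>r'<T. ?E1 r') = (\<Sum>r'<r. ?E1 r')"
    using r by (intro sum.mono_neutral_right) (auto simp: comm z)
  also have "\<dots> \<le> (\<Sum>r'<r. ?\<phi> (r - r' - 1))"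
  proof (rule sum_mono)
    fix r' assume "r' \<in> {..<r}"
    then have eq: "sample_time T r' = sample_time T r + 1 + int (r - r' - 1)" by (simp add: of_nat_diff)
    show "?E1 r' \<le> ?\<phi> (r - r' - 1)"
      unfolding eq by (rule innovation_regressor_lag_le[OF i a pos])
  qed
  also have "\<dots> \<le> (\<Sum>h=0..T. ?\<phi> h)"
    using r by (intro sum_lag_le[OF \<phi>0]) (auto simp: inj_on_def)
  finally show "(\<Sum>r'<T. ?E1 r') \<le> B" unfolding tot .
  have "(\<Sum>r'<T. ?E2 r') = (\<Sum>r'\<in>{r<..<T}. ?E2 r')"
    using r by (intro sum.mono_neutral_right) (auto simp: z)
  also have "\<dots> \<le> (\<Sum>r'\<in>{r<..<T}. ?\<phi> (r' - r - 1))"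
  proof (rule sum_mono)
    fix r' assume "r' \<in> {r<..<T}"
    then have eq: "sample_time T r = sample_time T r' + 1 + int (r' - r - 1)" by (simp add: of_nat_diff)
    show "?E2 r' \<le> ?\<phi> (r' - r - 1)"
      unfolding eq comm[symmetric] by (rule innovation_regressor_lag_le[OF i a pos])
  qed
  also have "\<dots> \<le> (\<Sum>h=0..T. ?\<phi> h)"
    using r by (intro sum_lag_le[OF \<phi>0]) (auto simp: inj_on_def)
  finally show "(\<Sum>r'<T. ?E2 r') \<le> B" unfolding tot .
  have "(\<Sum>r'<T. \<bar>expectation (\<lambda>\<omega>. \<epsilon> (sample_time T r) i \<omega> * \<epsilon> (sample_time T r') i \<omega>)\<bar>)
    = (\<Sum>r'<T. if r' = r then expectation (\<lambda>\<omega>. (\<epsilon> (sample_time T r) i \<omega>)\<^sup>2) else 0)"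
    by (intro sum.cong) (auto simp: innovations_orthogonal[OF _ i i] power2_eq_square)
  then show "(\<Sum>r'<T. \<bar>expectation (\<lambda>\<omega>. \<epsilon> (sample_time T r) i \<omega> * \<epsilon> (sample_time T r') i \<omega>)\<bar>)
      = expectation (\<lambda>\<omega>. (\<epsilon> 1 i \<omega>)\<^sup>2)"
    using r expectation_innovation_square[OF i, of "sample_time T r"] by simp
qed

lemma gram_design:
  "a < N \<Longrightarrow> b < N \<Longrightarrow> gram (design T k p y \<omega>) a b
    = (\<Sum>r<T. Z (sample_time T r) a \<omega> * Z (sample_time T r) b \<omega>) / real T"
  by (simp add: gram_def design_def)

lemma score_design:
  "a < N \<Longrightarrow> score (design T k p y \<omega>) (\<lambda>r. e r) a
    = (\<Sum>r<T. Z (sample_time T r) a \<omega> * e r) / real T"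
  by (simp add: score_def design_def)

lemma gram_concentration:
  assumes T: "T \<ge> 1" and a: "a < N" and b: "b < N"
    and \<rho>: "8 * (spectral_norm \<Gamma> * lag_sum T) \<le> \<rho>" "\<rho> > 0" and x: "0 \<le> x" "x \<le> \<rho>"
  shows "prob {\<omega> \<in> space M. x \<le> \<bar>gram (design T k p y \<omega>) a b - \<Gamma> $$ (a, b)\<bar>}
    \<le> 4 * exp (- real T * x\<^sup>2 / (4 * \<rho>\<^sup>2))"
proof -
  have "prob {\<omega> \<in> space M. real (card {..<T}) * x \<le>
      \<bar>(\<Sum>r<T. Z (sample_time T r) a \<omega> * Z (sample_time T r) b \<omega>)
        - (\<Sum>r<T. expectation (\<lambda>\<omega>. Z (sample_time T r) a \<omega> * Z (sample_time T r) b \<omega>))\<bar>}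
    \<le> 4 * exp (- real (card {..<T}) * x\<^sup>2 / (4 * \<rho>\<^sup>2))"
  proof (rule noise.product_sum_concentration[OF _ _ _ _ \<rho>(2) x])
    fix r assume "r \<in> {..<T}"
    then have r: "r < T" by simp
    show "(\<Sum>r'<T. \<bar>expectation (\<lambda>\<omega>. Z (sample_time T r) a \<omega> * Z (sample_time T r') a \<omega>)\<bar>
        + \<bar>expectation (\<lambda>\<omega>. Z (sample_time T r) a \<omega> * Z (sample_time T r') b \<omega>)\<bar>
        + \<bar>expectation (\<lambda>\<omega>. Z (sample_time T r) b \<omega> * Z (sample_time T r') a \<omega>)\<bar>
        + \<bar>expectation (\<lambda>\<omega>. Z (sample_time T r) b \<omega> * Z (sample_time T r') b \<omega>)\<bar>) \<le> \<rho>"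
      unfolding sum.distrib
      using regressor_row_sum[OF r a a] regressor_row_sum[OF r a b]
        regressor_row_sum[OF r b a] regressor_row_sum[OF r b b] \<rho>(1) by linarith
  qed (use a b regressor_mem in auto)
  moreover have "(\<Sum>r<T. expectation (\<lambda>\<omega>. Z (sample_time T r) a \<omega> * Z (sample_time T r) b \<omega>)) = real T * \<Gamma> $$ (a, b)"
    using regressor_cov_eq[OF a b] by simp
  moreover have "real T * x \<le> \<bar>q - real T * \<gamma>\<bar> \<longleftrightarrow> x \<le> \<bar>q / real T - \<gamma>\<bar>" for q \<gamma>
  proof -
    have "q / real T - \<gamma> = (q - real T * \<gamma>) / real T" using T by (simp add: field_simps)
    then show ?thesis using T by (simp add: abs_divide field_simps)
  qed
  ultimately show ?thesis by (simp add: gram_design[OF a b])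
qed

lemma score_concentration:
  assumes T: "T \<ge> 1" and a: "a < N" and i: "i < k" and pos: "spectral_norm \<Gamma> > 0"
    and \<rho>: "2 * (spectral_norm \<Gamma> * lag_sum T)
      + 2 * (sqrt (expectation (\<lambda>\<omega>. (\<epsilon> 1 i \<omega>)\<^sup>2)) * sqrt (spectral_norm \<Gamma>) * lag_sum T)
      + expectation (\<lambda>\<omega>. (\<epsilon> 1 i \<omega>)\<^sup>2) \<le> \<rho>" "\<rho> > 0"
    and x: "0 \<le> x" "x \<le> \<rho>"
  shows "prob {\<omega> \<in> space M. x \<le> \<bar>score (design T k p y \<omega>) (\<lambda>r. \<epsilon> (sample_time T r) i \<omega>) a\<bar>}
    \<le> 4 * exp (- real T * x\<^sup>2 / (4 * \<rho>\<^sup>2))"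
proof -
  have "prob {\<omega> \<in> space M. real (card {..<T}) * x \<le>
      \<bar>(\<Sum>r<T. Z (sample_time T r) a \<omega> * \<epsilon> (sample_time T r) i \<omega>)
        - (\<Sum>r<T. expectation (\<lambda>\<omega>. Z (sample_time T r) a \<omega> * \<epsilon> (sample_time T r) i \<omega>))\<bar>}
    \<le> 4 * exp (- real (card {..<T}) * x\<^sup>2 / (4 * \<rho>\<^sup>2))"
  proof (rule noise.product_sum_concentration[OF _ _ _ _ \<rho>(2) x])
    fix r assume "r \<in> {..<T}"
    then have r: "r < T" by simp
    show "(\<Sum>r'<T. \<bar>expectation (\<lambda>\<omega>. Z (sample_time T r) a \<omega> * Z (sample_time T r') a \<omega>)\<bar>
        + \<bar>expectation (\<lambda>\<omega>. Z (sample_time T r) a \<omega> * \<epsilon> (sample_time T r') i \<omega>)\<bar>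
        + \<bar>expectation (\<lambda>\<omega>. \<epsilon> (sample_time T r) i \<omega> * Z (sample_time T r') a \<omega>)\<bar>
        + \<bar>expectation (\<lambda>\<omega>. \<epsilon> (sample_time T r) i \<omega> * \<epsilon> (sample_time T r') i \<omega>)\<bar>) \<le> \<rho>"
      unfolding sum.distrib
      using regressor_row_sum[OF r a a] innovation_regressor_row_sums[OF r i a pos] \<rho>(1) by linarith
  qed (use a i regressor_mem innovation_mem in auto)
  moreover have "(\<Sum>r<T. expectation (\<lambda>\<omega>. Z (sample_time T r) a \<omega> * \<epsilon> (sample_time T r) i \<omega>)) = 0"
    using regressor_innovation_orthogonal[OF a i] by simp
  moreover have "real T * x \<le> \<bar>q\<bar> \<longleftrightarrow> x \<le> \<bar>q / real T\<bar>" for q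
    using T by (simp add: abs_divide field_simps)
  ultimately show ?thesis by (simp add: score_design[OF a])
qed

definition good_event :: "nat \<Rightarrow> nat \<Rightarrow> real \<Rightarrow> real \<Rightarrow> 'a set" where
  "good_event T i x \<nu> = {\<omega> \<in> space M.
     (\<forall>a<N. \<forall>b<N. \<bar>gram (design T k p y \<omega>) a b - \<Gamma> $$ (a, b)\<bar> < x) \<and>
     (\<forall>a<N. \<bar>score (design T k p y \<omega>) (\<lambda>r. \<epsilon> (sample_time T r) i \<omega>) a\<bar> < \<nu>)}"

text \<open>
  The union bound over the \<open>(kp)\<^sup>2\<close> entries of the Gram matrix and the \<open>kp\<close> entries of the score.
\<close>

lemma good_event_prob:
  assumes T: "T \<ge> 1" and i: "i < k" and pos: "spectral_norm \<Gamma> > 0"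
    and \<rho>1: "8 * (spectral_norm \<Gamma> * lag_sum T) \<le> \<rho>"
    and \<rho>2: "2 * (spectral_norm \<Gamma> * lag_sum T)
      + 2 * (sqrt (expectation (\<lambda>\<omega>. (\<epsilon> 1 i \<omega>)\<^sup>2)) * sqrt (spectral_norm \<Gamma>) * lag_sum T)
      + expectation (\<lambda>\<omega>. (\<epsilon> 1 i \<omega>)\<^sup>2) \<le> \<rho>"
    and \<rho>: "\<rho> > 0" and x: "0 \<le> x" "x \<le> \<rho>" and \<nu>: "0 \<le> \<nu>" "\<nu> \<le> \<rho>"
  shows "good_event T i x \<nu> \<in> events"
    and "1 - (4 * (real N)\<^sup>2 * exp (- real T * x\<^sup>2 / (4 * \<rho>\<^sup>2)) + 4 * real N * exp (- real T * \<nu>\<^sup>2 / (4 * \<rho>\<^sup>2)))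
      \<le> prob (good_event T i x \<nu>)"
proof -
  have [measurable]: "Z t c \<in> borel_measurable M" if "c < N" for t c
    using regressor_mem[OF that] by (rule noise.mem_measurable)
  have [measurable]: "\<epsilon> t i \<in> borel_measurable M" for t using innovation_mem[OF i] by (rule noise.mem_measurable)
  define A where "A ab = {\<omega> \<in> space M. x \<le> \<bar>gram (design T k p y \<omega>) (fst ab) (snd ab) - \<Gamma> $$ ab\<bar>}" for ab
  define B where "B a = {\<omega> \<in> space M. \<nu> \<le> \<bar>score (design T k p y \<omega>) (\<lambda>r. \<epsilon> (sample_time T r) i \<omega>) a\<bar>}" for a
  have A: "A ab \<in> events" "prob (A ab) \<le> 4 * exp (- real T * x\<^sup>2 / (4 * \<rho>\<^sup>2))" if mem: "ab \<in> {..<N} \<times> {..<N}" for ab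
  proof -
    obtain a b where ab: "ab = (a, b)" "a < N" "b < N" using mem by auto
    show "prob (A ab) \<le> 4 * exp (- real T * x\<^sup>2 / (4 * \<rho>\<^sup>2))"
      using gram_concentration[OF T ab(2,3) \<rho>1 \<rho> x] ab(1) by (simp add: A_def)
    show "A ab \<in> events" unfolding A_def ab(1) fst_conv snd_conv gram_design[OF ab(2,3)]
      using ab(2,3) by measurable
  qed
  have B: "B a \<in> events" "prob (B a) \<le> 4 * exp (- real T * \<nu>\<^sup>2 / (4 * \<rho>\<^sup>2))" if "a \<in> {..<N}" for a
  proof -
    have a: "a < N" using that by simp
    show "prob (B a) \<le> 4 * exp (- real T * \<nu>\<^sup>2 / (4 * \<rho>\<^sup>2))"
      using score_concentration[OF T a i pos \<rho>2 \<rho> \<nu>] by (simp add: B_def)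
    show "B a \<in> events" unfolding B_def score_design[OF a] using a by measurable
  qed
  let ?U = "(\<Union>ab\<in>{..<N} \<times> {..<N}. A ab) \<union> (\<Union>a<N. B a)"
  have U: "?U \<in> events" using A(1) B(1) by (intro sets.Un sets.finite_UN) auto
  have good: "good_event T i x \<nu> = space M - ?U"
    unfolding good_event_def A_def B_def linorder_not_le[symmetric] by auto
  show "good_event T i x \<nu> \<in> events" unfolding good using U by auto
  have "prob ?U \<le> prob (\<Union>ab\<in>{..<N} \<times> {..<N}. A ab) + prob (\<Union>a<N. B a)"
    using A(1) B(1) by (intro measure_Un_le sets.finite_UN) auto
  also have "\<dots> \<le> (\<Sum>ab\<in>{..<N} \<times> {..<N}. prob (A ab)) + (\<Sum>a<N. prob (B a))"
    using A(1) B(1) by (intro add_mono measure_UNION_le) auto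
  also have "\<dots> \<le> (\<Sum>ab\<in>{..<N} \<times> {..<N}. 4 * exp (- real T * x\<^sup>2 / (4 * \<rho>\<^sup>2))) + (\<Sum>a<N. 4 * exp (- real T * \<nu>\<^sup>2 / (4 * \<rho>\<^sup>2)))"
    using A(2) B(2) by (intro add_mono sum_mono) auto
  also have "\<dots> = 4 * (real N)\<^sup>2 * exp (- real T * x\<^sup>2 / (4 * \<rho>\<^sup>2)) + 4 * real N * exp (- real T * \<nu>\<^sup>2 / (4 * \<rho>\<^sup>2))"
    by (simp add: card_cartesian_product power2_eq_square)
  finally show "1 - (4 * (real N)\<^sup>2 * exp (- real T * x\<^sup>2 / (4 * \<rho>\<^sup>2)) + 4 * real N * exp (- real T * \<nu>\<^sup>2 / (4 * \<rho>\<^sup>2)))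
      \<le> prob (good_event T i x \<nu>)"
    unfolding good using prob_compl[OF U] by simp
qed

lemma sample_model:
  assumes i: "i < k"
  shows "AE \<omega> in M. \<forall>r<T. response T y i \<omega> $ r
    = (\<Sum>a<N. design T k p y \<omega> $$ (r, a) * true_param k p \<Phi> i $ a) + \<epsilon> (sample_time T r) i \<omega>"
proof -
  have "AE \<omega> in M. \<forall>r\<in>{..<T}. y (sample_time T r) i \<omega>
    = (\<Sum>c<N. true_param k p \<Phi> i $ c * Z (sample_time T r) c \<omega>) + \<epsilon> (sample_time T r) i \<omega>"
    by (rule AE_finite_allI) (use model_equation[OF i] in auto)
  then show ?thesis
  proof eventually_elim
    case (elim \<omega>)
    show ?case
    proof (intro allI impI)
      fix r assume r: "r < T"
      have "(\<Sum>a<N. design T k p y \<omega> $$ (r, a) * true_param k p \<Phi> i $ a)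
        = (\<Sum>c<N. true_param k p \<Phi> i $ c * Z (sample_time T r) c \<omega>)"
        using r by (intro sum.cong) (auto simp: design_def)
      then show "response T y i \<omega> $ r
        = (\<Sum>a<N. design T k p y \<omega> $$ (r, a) * true_param k p \<Phi> i $ a) + \<epsilon> (sample_time T r) i \<omega>"
        using elim r by (simp add: response_def)
    qed
  qed
qed

section \<open>The restricted eigenvalue and the variances\<close>

lemma qform_regressor_cov: "qform N (\<lambda>a b. \<Gamma> $$ (a, b)) d = expectation (\<lambda>\<omega>. (\<Sum>a<N. d a * Z 1 a \<omega>)\<^sup>2)"
proof -
  have "expectation (\<lambda>\<omega>. (\<Sum>a<N. d a * Z 1 a \<omega>)\<^sup>2)
      = (\<Sum>a<N. \<Sum>b<N. d a * d b * expectation (\<lambda>\<omega>. Z 1 a \<omega> * Z 1 b \<omega>))"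
    by (intro noise.expectation_lin_square regressor_mem) auto
  also have "\<dots> = (\<Sum>a<N. \<Sum>b<N. d a * \<Gamma> $$ (a, b) * d b)"
    by (intro sum.cong refl) (simp add: regressor_cov_eq)
  finally show ?thesis unfolding qform_def by simp
qed

lemma qform_regressor_cov_nonneg: "qform N (\<lambda>a b. \<Gamma> $$ (a, b)) d \<ge> 0"
  unfolding qform_regressor_cov by simp

lemma scalar_prod_mult_eq_qform:
  assumes "A \<in> carrier_mat n n" "dim_vec v = n"
  shows "v \<bullet> (A *\<^sub>v v) = qform n (\<lambda>a b. A $$ (a, b)) (\<lambda>a. v $ a)"
proof -
  have "v \<bullet> (A *\<^sub>v v) = (\<Sum>a<n. v $ a * (A *\<^sub>v v) $ a)"
    using assms by (simp add: scalar_prod_def atLeast0LessThan)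
  also have "\<dots> = (\<Sum>a<n. v $ a * (\<Sum>b<n. A $$ (a, b) * v $ b))"
    using assms mult_mat_vec_index_sum[of _ A v] by (intro sum.cong refl) auto
  finally show ?thesis by (simp add: qform_def sum_distrib_left mult.assoc)
qed

text \<open>
  Positive semidefiniteness of \<open>\<Gamma>\<close> is what bounds the set of quotients from below, so that its infimum is a lower bound.
\<close>

lemma kappa_imp_restricted_eigenvalue:
  assumes c: "c > 0" "c \<le> kappa \<Gamma> s" and J: "J \<subseteq> {..<N}" "card J \<le> s"
  shows "restricted_eigenvalue N (\<lambda>a b. \<Gamma> $$ (a, b)) J (c\<^sup>2)"
  unfolding restricted_eigenvalue_def
proof (intro allI impI)
  fix d :: "nat \<Rightarrow> real"
  assume cone: "(\<Sum>j\<in>{..<N} - J. \<bar>d j\<bar>) \<le> 3 * (\<Sum>j\<in>J. \<bar>d j\<bar>)"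
  let ?Q = "qform N (\<lambda>a b. \<Gamma> $$ (a, b)) d"
  show "c\<^sup>2 * (\<Sum>j\<in>J. (d j)\<^sup>2) \<le> ?Q"
  proof (cases "(\<Sum>j\<in>J. (d j)\<^sup>2) = 0")
    case True
    then show ?thesis using qform_regressor_cov_nonneg by simp
  next
    case False
    define \<delta> where "\<delta> = vec N d"
    define Q where "Q = {(\<delta> \<bullet> (\<Gamma> *\<^sub>v \<delta>)) / (l2_on R \<delta>)\<^sup>2 | R \<delta>.
      R \<subseteq> {..<dim_row \<Gamma>} \<and> card R \<le> s \<and>
      \<delta> \<in> carrier_vec (dim_row \<Gamma>) \<and> \<delta> \<noteq> 0\<^sub>v (dim_row \<Gamma>) \<and>
      l1_on ({..<dim_row \<Gamma>} - R) \<delta> \<le> 3 * l1_on R \<delta>}"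
    have dim: "dim_row \<Gamma> = N" using \<Gamma>_carrier by simp
    have \<delta>J: "\<delta> $ j = d j" if "j < N" for j using that by (simp add: \<delta>_def)
    have l2: "(l2_on J \<delta>)\<^sup>2 = (\<Sum>j\<in>J. (d j)\<^sup>2)"
    proof -
      have "(l2_on J \<delta>)\<^sup>2 = (\<Sum>j\<in>J. (\<delta> $ j)\<^sup>2)" by (simp add: l2_on_def L2_set_def sum_nonneg)
      then show ?thesis using J(1) \<delta>J by (auto intro!: sum.cong)
    qed
    have "\<delta> \<noteq> 0\<^sub>v N"
    proof
      assume "\<delta> = 0\<^sub>v N"
      then have "d j = 0" if "j \<in> J" for j using J(1) that \<delta>J[of j] by auto
      then show False using False by simp
    qed
    moreover have "l1_on ({..<N} - J) \<delta> \<le> 3 * l1_on J \<delta>"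
    proof -
      have "l1_on ({..<N} - J) \<delta> = (\<Sum>j\<in>{..<N} - J. \<bar>d j\<bar>)" "l1_on J \<delta> = (\<Sum>j\<in>J. \<bar>d j\<bar>)"
        unfolding l1_on_def using J(1) \<delta>J by (auto intro!: sum.cong)
      then show ?thesis using cone by simp
    qed
    ultimately have mem: "(\<delta> \<bullet> (\<Gamma> *\<^sub>v \<delta>)) / (l2_on J \<delta>)\<^sup>2 \<in> Q"
      unfolding Q_def dim using J by (intro CollectI exI[of _ J] exI[of _ \<delta>]) (simp add: \<delta>_def)
    have "bdd_below Q"
    proof (rule bdd_belowI[of _ 0])
      fix z assume "z \<in> Q"
      then obtain R v where v: "z = (v \<bullet> (\<Gamma> *\<^sub>v v)) / (l2_on R v)\<^sup>2" "v \<in> carrier_vec N"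
        unfolding Q_def dim by auto
      have "v \<bullet> (\<Gamma> *\<^sub>v v) \<ge> 0"
        using scalar_prod_mult_eq_qform[OF \<Gamma>_carrier, of v] v(2) qform_regressor_cov_nonneg by simp
      then show "0 \<le> z" by (simp add: v(1))
    qed
    then have "Inf Q \<le> (\<delta> \<bullet> (\<Gamma> *\<^sub>v \<delta>)) / (l2_on J \<delta>)\<^sup>2" using mem by (intro cInf_lower)
    moreover have "c\<^sup>2 \<le> Inf Q"
    proof -
      have "c \<le> sqrt (Inf Q)" using c(2) unfolding kappa_def Q_def .
      then have "0 < Inf Q" using c(1) by (metis less_le_trans real_sqrt_gt_0_iff)
      then have "c\<^sup>2 \<le> (sqrt (Inf Q))\<^sup>2" using \<open>c \<le> sqrt (Inf Q)\<close> c(1) by (intro power_mono) auto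
      then show ?thesis using \<open>0 < Inf Q\<close> by simp
    qed
    ultimately have "c\<^sup>2 \<le> (\<delta> \<bullet> (\<Gamma> *\<^sub>v \<delta>)) / (\<Sum>j\<in>J. (d j)\<^sup>2)" by (simp add: l2)
    moreover have "\<delta> \<bullet> (\<Gamma> *\<^sub>v \<delta>) = ?Q"
      using scalar_prod_mult_eq_qform[OF \<Gamma>_carrier, of \<delta>] \<delta>J by (simp add: qform_def) (simp add: \<delta>_def)
    moreover have "(\<Sum>j\<in>J. (d j)\<^sup>2) > 0" using False sum_nonneg[of J "\<lambda>j. (d j)\<^sup>2"] by simp
    ultimately show ?thesis by (simp add: pos_le_divide_eq)
  qed
qed

lemma second_moments_le_max_sd:
  assumes "i < k"
  shows "expectation (\<lambda>\<omega>. (\<epsilon> 1 i \<omega>)\<^sup>2) \<le> (max_sd M k \<epsilon> y)\<^sup>2"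
    and "expectation (\<lambda>\<omega>. (y 1 i \<omega>)\<^sup>2) \<le> (max_sd M k \<epsilon> y)\<^sup>2"
    and "max_sd M k \<epsilon> y \<ge> 0"
proof -
  have m: "max (sqrt (variance (y 1 i))) (sqrt (variance (\<epsilon> 1 i))) \<le> max_sd M k \<epsilon> y"
    unfolding max_sd_def using assms by (intro Max_ge) auto
  have "variance X = expectation (\<lambda>\<omega>. (X \<omega>)\<^sup>2)" if "X \<in> noise_space" for X
    using centered_normal_moments(4)[OF noise.normal[OF that]] by simp
  then have v: "variance (y 1 i) = expectation (\<lambda>\<omega>. (y 1 i \<omega>)\<^sup>2)" "variance (\<epsilon> 1 i) = expectation (\<lambda>\<omega>. (\<epsilon> 1 i \<omega>)\<^sup>2)"
    using process_mem[OF assms] innovation_mem[OF assms] by auto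
  show "expectation (\<lambda>\<omega>. (\<epsilon> 1 i \<omega>)\<^sup>2) \<le> (max_sd M k \<epsilon> y)\<^sup>2" "expectation (\<lambda>\<omega>. (y 1 i \<omega>)\<^sup>2) \<le> (max_sd M k \<epsilon> y)\<^sup>2"
    using m unfolding v by (auto intro!: sqrt_le_D)
  have "0 \<le> sqrt (variance (y 1 i))" by simp
  then show "max_sd M k \<epsilon> y \<ge> 0" using m by linarith
qed

lemma regressor_variance_le:
  assumes "a < N" shows "\<Gamma> $$ (a, a) \<le> (max_sd M k \<epsilon> y)\<^sup>2"
proof -
  have "\<Gamma> $$ (a, a) = expectation (\<lambda>\<omega>. Z 1 a \<omega> * Z 1 a \<omega>)" using regressor_cov_eq[OF assms assms] by simp
  also have "\<dots> = expectation (\<lambda>\<omega>. y 1 (a mod k) \<omega> * y 1 (a mod k) \<omega>)"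
    using process_cov_shift[OF mod_k mod_k, of 1 "- int (Suc (a div k))" a 1 a]
    unfolding regressor_index[OF assms] by simp
  finally show ?thesis using second_moments_le_max_sd(2)[OF mod_k] by (simp add: power2_eq_square)
qed

lemma restricted_eigenvalue_le_diagonal:
  assumes re: "restricted_eigenvalue n G J \<mu>" and j: "j \<in> J" and J: "J \<subseteq> {..<n}"
  shows "\<mu> \<le> G j j"
proof -
  define d where "d l = (if l = j then 1 else 0 :: real)" for l
  have fJ: "finite J" using J finite_subset by blast
  have s: "(\<Sum>l\<in>J. \<bar>d l\<bar>) = 1" "(\<Sum>l\<in>J. (d l)\<^sup>2) = 1" "(\<Sum>l\<in>{..<n} - J. \<bar>d l\<bar>) = 0"
    using j fJ by (auto simp: d_def if_distrib[of abs] if_distrib[of "\<lambda>z. z\<^sup>2"] cong: if_cong)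
  have "d a * G a b * d b = (if b = j then (if a = j then G j j else 0) else 0)" for a b
    by (simp add: d_def)
  then have "qform n G d = G j j" unfolding qform_def using j J by auto
  then show ?thesis using re s unfolding restricted_eigenvalue_def by (auto dest!: spec[of _ d])
qed

end

section \<open>Sign recovery in finite samples\<close>

lemma lasso_imp_stationary:
  assumes X: "X \<in> carrier_mat T n" and T: "T > 0" and lam: "lam \<ge> 0"
    and model: "\<And>r. r < T \<Longrightarrow> v $ r = (\<Sum>a<n. X $$ (r, a) * bs a) + e r"
    and lasso: "is_lasso X v lam b"
  shows "penalised_stationary n (gram X) (score X e) lam (\<lambda>_. 1) {..<n} bs (\<lambda>j. b $ j)"
proof -
  have dim: "dim_row X = T" "dim_col X = n" using X by auto
  have P: "(\<lambda>\<gamma>. \<gamma> \<in> carrier_vec n) = (\<lambda>\<gamma> :: real vec. \<gamma> \<in> carrier_vec n \<and> support \<gamma> \<subseteq> {..<n})"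
    by (auto simp: support_def fun_eq_iff)
  show ?thesis
    using minimiser_imp_stationary[of X lam "{..<n}" "\<lambda>_. 1" v bs e b] T lam model lasso
    unfolding is_lasso_def l1_on_def dim P by simp
qed

lemma adaptive_lasso_imp_stationary:
  assumes X: "X \<in> carrier_mat T n" and T: "T > 0" and lam: "lam \<ge> 0"
    and model: "\<And>r. r < T \<Longrightarrow> v $ r = (\<Sum>a<n. X $$ (r, a) * bs a) + e r"
    and first: "dim_vec bh = n"
    and adaptive: "is_adaptive_lasso X v lam bh b"
  shows "penalised_stationary n (gram X) (score X e) lam (\<lambda>j. 1 / \<bar>bh $ j\<bar>) {j. j < n \<and> bh $ j \<noteq> 0} bs (\<lambda>j. b $ j)"
proof -
  have dim: "dim_row X = T" "dim_col X = n" using X by auto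
  have D: "support bh = {j. j < n \<and> bh $ j \<noteq> 0}" using first by (auto simp: support_def)
  show ?thesis
    using minimiser_imp_stationary[of X lam "support bh" "\<lambda>j. 1 / \<bar>bh $ j\<bar>" v bs e b] T lam model adaptive
    unfolding is_adaptive_lasso_def dim D by auto
qed

lemma finite_support [simp]: "finite (support v)"
  by (simp add: support_def)

lemma beta_min_le: "j \<in> support v \<Longrightarrow> beta_min v \<le> \<bar>v $ j\<bar>"
  unfolding beta_min_def by (intro Min_le) auto

lemma beta_min_pos: "support v \<noteq> {} \<Longrightarrow> beta_min v > 0"
  unfolding beta_min_def by (subst Min_gr_iff) (auto simp: support_def)

context gaussian_var
begin

lemma sign_recovery_on_good_event:
  fixes bh bt :: "real vec" and i T :: nat and c x lam \<nu> \<tau> :: real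
  defines "bs \<equiv> true_param k p \<Phi> i"
  defines "s \<equiv> real (card (support bs))" and "\<mu> \<equiv> c\<^sup>2 / 2"
  assumes T: "T \<ge> 1" and c: "c > 0" "c \<le> kappa \<Gamma> (card (support bs))" and s: "s \<ge> 1"
    and lam: "lam \<ge> 0" and x: "x \<ge> 0" "16 * x * s \<le> c\<^sup>2 / 2"
    and \<omega>: "\<omega> \<in> good_event T i x \<nu>"
    and model: "\<And>r. r < T \<Longrightarrow> response T y i \<omega> $ r
      = (\<Sum>a<N. design T k p y \<omega> $$ (r, a) * bs $ a) + \<epsilon> (sample_time T r) i \<omega>"
    and lasso: "is_lasso (design T k p y \<omega>) (response T y i \<omega>) lam bh"
    and adaptive: "is_adaptive_lasso (design T k p y \<omega>) (response T y i \<omega>) lam bh bt"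
    and \<tau>: "\<tau> \<ge> 0" "(max_sd M k \<epsilon> y)\<^sup>2 + c\<^sup>2 \<le> \<tau>\<^sup>2"
    and tuning: "(lam > 0 \<and> \<nu> \<le> lam / 2 \<and>
        6 * lam * s / \<mu> \<le> beta_min bs / 2 \<and>
        6 * lam * s / \<mu> * (2 / beta_min bs + 2) \<le> 3 \<and>
        lam * (1 / 2 + 2 / beta_min bs) * sqrt s / \<mu> < beta_min bs \<and>
        6 * lam * s / \<mu> * (1 / 2 + \<tau> * ((1 / 2 + 2 / beta_min bs) * sqrt s / sqrt \<mu>)) < 1)
      \<or> (N = 1 \<and> lam = 0 \<and> \<nu> < \<mu> * beta_min bs)"
  shows "map_vec sgn bt = map_vec sgn bs"
proof -
  let ?X = "design T k p y \<omega>" and ?J = "support bs"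
  define e where "e r = \<epsilon> (sample_time T r) i \<omega>" for r
  have X: "?X \<in> carrier_mat T N" by (simp add: design_def)
  have dbs: "dim_vec bs = N" by (simp add: bs_def true_param_def)
  have dbh: "dim_vec bh = N" and dbt: "dim_vec bt = N"
    using lasso adaptive X unfolding is_lasso_def is_adaptive_lasso_def is_arg_min_def by auto
  have J: "?J = {j. j < N \<and> bs $ j \<noteq> 0}" using dbs by (auto simp: support_def)
  have JN: "?J \<subseteq> {..<N}" using J by auto
  have \<mu>: "\<mu> > 0" using c by (simp add: \<mu>_def)
  have Jne: "?J \<noteq> {}" using s by (auto simp: s_def)
  have bmin: "beta_min bs > 0" using Jne by (rule beta_min_pos)
  have G: "\<bar>gram ?X a b - \<Gamma> $$ (a, b)\<bar> < x" if "a < N" "b < N" for a b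
    using \<omega> that unfolding good_event_def by auto
  have \<nu>: "\<bar>score ?X e a\<bar> < \<nu>" if "a < N" for a
    using \<omega> that unfolding good_event_def e_def by auto
  have reG: "restricted_eigenvalue N (\<lambda>a b. \<Gamma> $$ (a, b)) ?J (c\<^sup>2)"
    by (rule kappa_imp_restricted_eigenvalue[OF c JN order_refl])
  have re0: "restricted_eigenvalue N (gram ?X) ?J (c\<^sup>2 - 16 * x * card ?J)"
    by (rule restricted_eigenvalue_perturb[OF reG JN _ x(1)]) (use G in \<open>auto intro: less_imp_le\<close>)
  have re: "restricted_eigenvalue N (gram ?X) ?J \<mu>"
    unfolding restricted_eigenvalue_def
  proof (intro allI impI)
    fix d :: "nat \<Rightarrow> real" assume "(\<Sum>j\<in>{..<N} - ?J. \<bar>d j\<bar>) \<le> 3 * (\<Sum>j\<in>?J. \<bar>d j\<bar>)"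
    then have "(c\<^sup>2 - 16 * x * card ?J) * (\<Sum>j\<in>?J. (d j)\<^sup>2) \<le> qform N (gram ?X) d"
      using re0 unfolding restricted_eigenvalue_def by simp
    moreover have "\<mu> * (\<Sum>j\<in>?J. (d j)\<^sup>2) \<le> (c\<^sup>2 - 16 * x * card ?J) * (\<Sum>j\<in>?J. (d j)\<^sup>2)"
      using x(2) by (intro mult_right_mono sum_nonneg) (auto simp: \<mu>_def s_def)
    ultimately show "\<mu> * (\<Sum>j\<in>?J. (d j)\<^sup>2) \<le> qform N (gram ?X) d" by simp
  qed
  have st1: "penalised_stationary N (gram ?X) (score ?X e) lam (\<lambda>_. 1) {..<N} (\<lambda>j. bs $ j) (\<lambda>j. bh $ j)"
    by (rule lasso_imp_stationary[OF X _ lam _ lasso]) (use T model in \<open>auto simp: e_def\<close>)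
  have st2: "penalised_stationary N (gram ?X) (score ?X e) lam (\<lambda>j. 1 / \<bar>bh $ j\<bar>) {j. j < N \<and> bh $ j \<noteq> 0}
      (\<lambda>j. bs $ j) (\<lambda>j. bt $ j)"
    by (rule adaptive_lasso_imp_stationary[OF X _ lam _ dbh adaptive]) (use T model in \<open>auto simp: e_def\<close>)
  have "sgn (bt $ j) = sgn (bs $ j)" if j: "j < N" for j
    using tuning
  proof
    assume t: "lam > 0 \<and> \<nu> \<le> lam / 2 \<and>
        6 * lam * s / \<mu> \<le> beta_min bs / 2 \<and>
        6 * lam * s / \<mu> * (2 / beta_min bs + 2) \<le> 3 \<and>
        lam * (1 / 2 + 2 / beta_min bs) * sqrt s / \<mu> < beta_min bs \<and>
        6 * lam * s / \<mu> * (1 / 2 + \<tau> * ((1 / 2 + 2 / beta_min bs) * sqrt s / sqrt \<mu>)) < 1"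
    have diag: "gram ?X j j \<le> \<tau>\<^sup>2" if j: "j < N" for j
    proof -
      have "x \<le> c\<^sup>2"
      proof -
        have "x \<le> 16 * x * s" using x(1) s mult_left_mono[of 1 "16 * s" x] by simp
        then show ?thesis using x(2) zero_le_power2[of c] by linarith
      qed
      then show ?thesis using G[OF j j] regressor_variance_le[OF j] \<tau>(2) by linarith
    qed
    show ?thesis
    proof (rule adaptive_lasso_sign_recovery[OF st1 st2 _ _ _ \<mu> diag \<tau>(1) _ bmin _ _ _ _ _ j])
      show "lam > 0" using t by simp
      show "\<bar>score ?X e j\<bar> \<le> lam / 2" if "j < N" for j using \<nu>[OF that] t by linarith
      show "restricted_eigenvalue N (gram ?X) {j. j < N \<and> bs $ j \<noteq> 0} \<mu>" using re J by simp
      show "1 \<le> real (card {j. j < N \<and> bs $ j \<noteq> 0})" using s J by (simp add: s_def)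
      show "beta_min bs \<le> \<bar>bs $ j\<bar>" if "j \<in> {j. j < N \<and> bs $ j \<noteq> 0}" for j
        using beta_min_le that J by simp
    qed (use t in \<open>simp_all add: s_def J[symmetric]\<close>)
  next
    assume t: "N = 1 \<and> lam = 0 \<and> \<nu> < \<mu> * beta_min bs"
    then have N1: "N = 1" and lam0: "lam = 0" by auto
    have J1: "?J = {..<1}" using Jne JN N1 by auto
    have "\<bar>score ?X e 0\<bar> < \<mu> * \<bar>bs $ 0\<bar>"
    proof -
      have "\<bar>score ?X e 0\<bar> < \<nu>" using \<nu>[of 0] N1 by simp
      also have "\<nu> < \<mu> * beta_min bs" using t by simp
      also have "\<dots> \<le> \<mu> * \<bar>bs $ 0\<bar>" using beta_min_le[of 0 bs] J1 \<mu> by (intro mult_left_mono) auto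
      finally show ?thesis .
    qed
    then have "sgn (bt $ 0) = sgn (bs $ 0)"
      using single_regressor_sign_recovery[of "gram ?X" "score ?X e" "\<lambda>j. bs $ j" "\<lambda>j. bh $ j" "\<lambda>j. bt $ j" \<mu>]
        st1 st2 re \<mu> unfolding N1 lam0 J1 by simp
    then show ?thesis using j N1 by simp
  qed
  then show ?thesis using dbs dbt by (intro eq_vecI) auto
qed

text \<open>
  A relevant regressor has variance at least \<open>c\<^sup>2\<close>, because its unit vector is admissible for \<open>\<kappa>\<close>.
\<close>

lemma kappa_le_max_sd:
  assumes c: "c > 0" "c \<le> kappa \<Gamma> s" and J: "J \<subseteq> {..<N}" "J \<noteq> {}" "card J \<le> s"
  shows "c \<le> max_sd M k \<epsilon> y"
proof -
  obtain j where j: "j \<in> J" "j < N" using J by auto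
  have "c\<^sup>2 \<le> \<Gamma> $$ (j, j)"
    by (rule restricted_eigenvalue_le_diagonal[OF kappa_imp_restricted_eigenvalue[OF c J(1,3)] j(1) J(1)])
  then have "c\<^sup>2 \<le> (max_sd M k \<epsilon> y)\<^sup>2" using regressor_variance_le[OF j(2)] by linarith
  then show ?thesis using second_moments_le_max_sd(3)[OF mod_k] by (rule power2_le_imp_le)
qed

text \<open>
  The level \<open>c\<^sup>2 / (32 s)\<close> for the Gram matrix halves the restricted eigenvalue of \<open>\<Gamma>\<close>, whence \<open>\<mu>\<close>. The row sums of all
  covariance matrices involved are at most \<open>\<rho>\<close>: the term \<open>8K\<close> suffices for two regressors, while
  \<open>\<surd>\<parallel>\<Gamma>\<parallel> = \<parallel>\<Gamma>\<parallel>/\<surd>\<parallel>\<Gamma>\<parallel> \<le> \<parallel>\<Gamma>\<parallel>/c\<close> turns the bound for a regressor and an innovation into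
  \<open>2K + 2\<sigma>K/c + \<sigma>\<^sup>2\<close>. Adding \<open>c\<^sup>2\<close> admits the level of the Gram matrix.
\<close>

lemma sign_recovery_prob:
  fixes bh bt :: "'a \<Rightarrow> real vec" and i T :: nat and c K \<sigma> lam \<nu> :: real
  defines "bs \<equiv> true_param k p \<Phi> i"
  defines "s \<equiv> real (card (support bs))" and "\<mu> \<equiv> c\<^sup>2 / 2" and "\<tau> \<equiv> sqrt (\<sigma>\<^sup>2 + c\<^sup>2)"
    and "\<rho> \<equiv> 8 * K + 2 * (\<sigma> * K / c) + \<sigma>\<^sup>2 + c\<^sup>2 + 1"
  assumes T: "T \<ge> 1" and i: "i < k"
    and c: "c > 0" "c \<le> kappa \<Gamma> (card (support bs))" and s: "s \<ge> 1"
    and K: "spectral_norm \<Gamma> * lag_sum T \<le> K" and \<sigma>: "max_sd M k \<epsilon> y \<le> \<sigma>"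
    and lam: "lam \<ge> 0" and \<nu>: "0 \<le> \<nu>" "\<nu> \<le> \<rho>"
    and lasso: "\<And>\<omega>. \<omega> \<in> space M \<Longrightarrow> is_lasso (design T k p y \<omega>) (response T y i \<omega>) lam (bh \<omega>)"
    and adaptive: "\<And>\<omega>. \<omega> \<in> space M \<Longrightarrow> is_adaptive_lasso (design T k p y \<omega>) (response T y i \<omega>) lam (bh \<omega>) (bt \<omega>)"
    and meas: "\<And>j. j < N \<Longrightarrow> (\<lambda>\<omega>. bt \<omega> $ j) \<in> borel_measurable M"
    and tuning: "(lam > 0 \<and> \<nu> \<le> lam / 2 \<and>
        6 * lam * s / \<mu> \<le> beta_min bs / 2 \<and>
        6 * lam * s / \<mu> * (2 / beta_min bs + 2) \<le> 3 \<and>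
        lam * (1 / 2 + 2 / beta_min bs) * sqrt s / \<mu> < beta_min bs \<and>
        6 * lam * s / \<mu> * (1 / 2 + \<tau> * ((1 / 2 + 2 / beta_min bs) * sqrt s / sqrt \<mu>)) < 1)
      \<or> (N = 1 \<and> lam = 0 \<and> \<nu> < \<mu> * beta_min bs)"
  shows "1 - (4 * (real N)\<^sup>2 * exp (- real T * (c\<^sup>2 / (32 * s))\<^sup>2 / (4 * \<rho>\<^sup>2))
        + 4 * real N * exp (- real T * \<nu>\<^sup>2 / (4 * \<rho>\<^sup>2)))
      \<le> prob {\<omega> \<in> space M. map_vec sgn (bt \<omega>) = map_vec sgn bs}"
proof -
  let ?x = "c\<^sup>2 / (32 * s)" and ?J = "support bs"
  have dbs: "dim_vec bs = N" by (simp add: bs_def true_param_def)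
  have dbt: "dim_vec (bt \<omega>) = N" if "\<omega> \<in> space M" for \<omega>
    using adaptive[OF that] unfolding is_adaptive_lasso_def is_arg_min_def design_def by auto
  have JN: "?J \<subseteq> {..<N}" using dbs by (auto simp: support_def)
  have Jne: "?J \<noteq> {}" using s by (auto simp: s_def)
  then obtain j where j: "j \<in> ?J" by blast
  then have jN: "j < N" using JN by auto
  have reG: "restricted_eigenvalue N (\<lambda>a b. \<Gamma> $$ (a, b)) ?J (c\<^sup>2)"
    by (rule kappa_imp_restricted_eigenvalue[OF c JN order_refl])
  have "c\<^sup>2 \<le> \<Gamma> $$ (j, j)" by (rule restricted_eigenvalue_le_diagonal[OF reG j JN])
  also have "\<dots> \<le> spectral_norm \<Gamma>" using abs_mat_index_le[OF \<Gamma>_carrier jN jN] by simp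
  finally have g: "c\<^sup>2 \<le> spectral_norm \<Gamma>" .
  have g0: "spectral_norm \<Gamma> > 0" using g c(1) by (meson less_le_trans zero_less_power)
  have K0: "K \<ge> 0" using K lag_sum_nonneg[of T] g0 by (meson mult_nonneg_nonneg less_imp_le order_trans)
  have \<sigma>0: "\<sigma> \<ge> 0" using \<sigma> second_moments_le_max_sd(3)[OF i] by simp
  have msd: "(max_sd M k \<epsilon> y)\<^sup>2 \<le> \<sigma>\<^sup>2"
    using \<sigma> second_moments_le_max_sd(3)[OF i] by (intro power_mono)
  define \<sigma>e where "\<sigma>e = expectation (\<lambda>\<omega>. (\<epsilon> 1 i \<omega>)\<^sup>2)"
  have \<sigma>e: "\<sigma>e \<le> \<sigma>\<^sup>2" unfolding \<sigma>e_def using second_moments_le_max_sd(1)[OF i] msd by simp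
  have sq\<sigma>e: "sqrt \<sigma>e \<le> \<sigma>" using real_sqrt_le_mono[OF \<sigma>e] \<sigma>0 by simp
  have lagK: "sqrt (spectral_norm \<Gamma>) * lag_sum T \<le> K / c"
  proof -
    have "c \<le> sqrt (spectral_norm \<Gamma>)" using g c(1) by (simp add: real_le_rsqrt)
    then have "c * (sqrt (spectral_norm \<Gamma>) * lag_sum T) \<le> sqrt (spectral_norm \<Gamma>) * (sqrt (spectral_norm \<Gamma>) * lag_sum T)"
      using lag_sum_nonneg g0 by (intro mult_right_mono) auto
    also have "\<dots> = spectral_norm \<Gamma> * lag_sum T" using g0 by (simp add: mult.assoc[symmetric])
    finally show ?thesis using K c(1) by (simp add: pos_le_divide_eq mult.commute)
  qed
  have cK: "\<sigma> * K / c \<ge> 0" using \<sigma>0 K0 c(1) by simp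
  have \<rho>0: "\<rho> > 0" unfolding \<rho>_def using K0 cK by (simp add: add_nonneg_pos)
  have \<rho>1: "8 * (spectral_norm \<Gamma> * lag_sum T) \<le> \<rho>"
    unfolding \<rho>_def using K cK zero_le_power2[of c] zero_le_power2[of \<sigma>] by linarith
  have \<rho>2: "2 * (spectral_norm \<Gamma> * lag_sum T) + 2 * (sqrt \<sigma>e * sqrt (spectral_norm \<Gamma>) * lag_sum T) + \<sigma>e \<le> \<rho>"
  proof -
    have "sqrt \<sigma>e * (sqrt (spectral_norm \<Gamma>) * lag_sum T) \<le> \<sigma> * (K / c)"
      using sq\<sigma>e lagK \<sigma>0 lag_sum_nonneg g0 by (intro mult_mono) auto
    then have "sqrt \<sigma>e * sqrt (spectral_norm \<Gamma>) * lag_sum T \<le> \<sigma> * K / c" by (simp add: mult.assoc)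
    then show ?thesis unfolding \<rho>_def using K K0 \<sigma>e zero_le_power2[of c] by linarith
  qed
  have x0: "0 \<le> ?x" "16 * ?x * s \<le> c\<^sup>2 / 2" using s by (simp_all add: field_simps)
  have "?x \<le> c\<^sup>2" using s divide_left_mono[of 1 "32 * s" "c\<^sup>2"] by simp
  also have "c\<^sup>2 \<le> \<rho>" unfolding \<rho>_def using K0 cK zero_le_power2[of \<sigma>] by linarith
  finally have x\<rho>: "?x \<le> \<rho>" .
  note good = good_event_prob[OF T i g0 \<rho>1 \<rho>2[unfolded \<sigma>e_def] \<rho>0 x0(1) x\<rho> \<nu>]
  have \<tau>: "\<tau> \<ge> 0" "(max_sd M k \<epsilon> y)\<^sup>2 + c\<^sup>2 \<le> \<tau>\<^sup>2" using msd by (auto simp: \<tau>_def)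
  let ?S = "{\<omega> \<in> space M. map_vec sgn (bt \<omega>) = map_vec sgn bs}"
  have S_eq: "?S = {\<omega> \<in> space M. \<forall>j\<in>{..<N}. sgn (bt \<omega> $ j) = sgn (bs $ j)}"
  proof (intro Collect_cong conj_cong refl)
    fix \<omega> assume \<omega>: "\<omega> \<in> space M"
    show "(map_vec sgn (bt \<omega>) = map_vec sgn bs) = (\<forall>j\<in>{..<N}. sgn (bt \<omega> $ j) = sgn (bs $ j))"
    proof
      assume eq: "map_vec sgn (bt \<omega>) = map_vec sgn bs"
      show "\<forall>j\<in>{..<N}. sgn (bt \<omega> $ j) = sgn (bs $ j)"
      proof
        fix j assume "j \<in> {..<N}"
        then show "sgn (bt \<omega> $ j) = sgn (bs $ j)"
          using arg_cong[OF eq, of "\<lambda>v. v $ j"] dbs dbt[OF \<omega>] by simp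
      qed
    next
      assume "\<forall>j\<in>{..<N}. sgn (bt \<omega> $ j) = sgn (bs $ j)"
      then show "map_vec sgn (bt \<omega>) = map_vec sgn bs"
        using dbs dbt[OF \<omega>] by (intro eq_vecI) auto
    qed
  qed
  have S: "?S \<in> events"
  proof -
    have "{\<omega> \<in> space M. sgn (bt \<omega> $ j) = sgn (bs $ j)} \<in> events" if "j \<in> {..<N}" for j
    proof -
      have [measurable]: "(\<lambda>\<omega>. bt \<omega> $ j) \<in> borel_measurable M" using meas that by simp
      show ?thesis by measurable
    qed
    then show ?thesis unfolding S_eq by (intro sets.sets_Collect_finite_All) auto
  qed
  have "AE \<omega> in M. \<omega> \<in> good_event T i ?x \<nu> \<longrightarrow> \<omega> \<in> ?S"
    using sample_model[OF i, of T] AE_space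
  proof eventually_elim
    case (elim \<omega>)
    show ?case
    proof
      assume ge: "\<omega> \<in> good_event T i ?x \<nu>"
      have "map_vec sgn (bt \<omega>) = map_vec sgn bs"
        unfolding bs_def
      proof (rule sign_recovery_on_good_event[OF T c[unfolded bs_def] s[unfolded s_def bs_def] lam x0[unfolded s_def bs_def] ge[unfolded s_def bs_def] _ lasso[OF elim(2)] adaptive[OF elim(2)] \<tau> tuning[unfolded s_def \<mu>_def bs_def]])
        show "response T y i \<omega> $ r = (\<Sum>a<N. design T k p y \<omega> $$ (r, a) * true_param k p \<Phi> i $ a) + \<epsilon> (sample_time T r) i \<omega>"
          if "r < T" for r using elim(1) that by blast
      qed
      then show "\<omega> \<in> ?S" using elim(2) by simp
    qed
  qed
  then have "prob (good_event T i ?x \<nu>) \<le> prob ?S"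
    using S by (intro finite_measure_mono_AE) auto
  then show ?thesis using good(2) by linarith
qed

end

section \<open>Rates\<close>

lemma powr_mult_ln_powr_tendsto_0:
  assumes "e < 0"
  shows "(\<lambda>T::nat. real T powr e * ln (real T) powr r) \<longlonglongrightarrow> 0"
  using assms by real_asymp

lemma ln_ge_1: "3 \<le> x \<Longrightarrow> 1 \<le> ln (x::real)"
  using exp_le by (subst ln_ge_iff) auto

lemma sandwich_null:
  fixes f g :: "nat \<Rightarrow> real"
  assumes "eventually (\<lambda>T. 0 \<le> f T \<and> f T \<le> g T) sequentially" "g \<longlonglongrightarrow> 0"
  shows "f \<longlonglongrightarrow> 0"
  by (rule tendsto_sandwich[OF _ _ tendsto_const assms(2)])
    (use assms(1) in \<open>auto elim: eventually_mono\<close>)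

text \<open>
  The penalty is at most a multiple of \<open>P = T\<^bsup>7a/2 - 1/2\<^esup> ln(T)\<^bsup>5/2\<^esup>\<close>, and \<open>P T\<^bsup>3b/2\<^esup>\<close> tends to zero because
  \<open>15a + 4b < 1\<close>. The product of \<open>ln T\<close> and the first argument of the maximum is at least \<open>ln(T)\<^sup>2 P T\<^bsup>3b/2\<^esup>\<close>, and the square of
  the product of \<open>ln T\<close> and the second one equals \<open>ln(T)\<^sup>2 P T\<^bsup>b/2\<^esup>\<close>. Hence the last two sequences are of order \<open>ln(T)\<^bsup>-2\<^esup>\<close>.
\<close>

lemma tuning_limits:
  fixes lam s bm :: "nat \<Rightarrow> real" and a b C1 C2 c3 :: real
  assumes ab: "0 \<le> a" "0 \<le> b" "15 * a + 4 * b < 1" and C: "C1 > 0" "C2 > 0" "c3 > 0"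
    and lam: "\<forall>\<^sub>F T in sequentially. 0 \<le> lam T \<and>
      lam T \<le> C1 * (real T powr (7 / 2 * a - 1 / 2) * ln (real T) powr (5 / 2))"
    and s: "\<forall>\<^sub>F T in sequentially. 1 \<le> s T \<and> s T \<le> C2 * real T powr b"
    and bm: "\<forall>\<^sub>F T in sequentially. c3 * (ln (real T) *
        max (real T powr (2 * b) * real T powr (15 / 2 * a - 1 / 2) * ln (real T) powr (1 + 5 / 2))
          (real T powr (b / 4) * real T powr (7 / 4 * a - 1 / 4) * ln (real T) powr (5 / 4))) \<le> bm T"
  shows "(\<lambda>T. lam T * s T * sqrt (s T)) \<longlonglongrightarrow> 0"
    and "(\<lambda>T. lam T * s T * sqrt (s T) / bm T) \<longlonglongrightarrow> 0"
    and "(\<lambda>T. lam T * sqrt (s T) / (bm T)\<^sup>2) \<longlonglongrightarrow> 0"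
proof -
  define P where "P T = real T powr (7 / 2 * a - 1 / 2) * ln (real T) powr (5 / 2)" for T
  define A where "A T = ln (real T) * (real T powr (2 * b) * real T powr (15 / 2 * a - 1 / 2) * ln (real T) powr (1 + 5 / 2))" for T
  define B where "B T = ln (real T) * (real T powr (b / 4) * real T powr (7 / 4 * a - 1 / 4) * ln (real T) powr (5 / 4))" for T
  define D where "D = C1 * (C2 * sqrt C2)"
  have D: "D > 0" using C by (simp add: D_def)
  have ev: "\<forall>\<^sub>F T in sequentially. T \<ge> 3 \<and> 0 \<le> lam T \<and> lam T \<le> C1 * P T \<and> 1 \<le> s T \<and> s T \<le> C2 * real T powr b
      \<and> c3 * A T \<le> bm T \<and> c3 * B T \<le> bm T"
    using lam s bm eventually_ge_at_top[of 3]
  proof eventually_elim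
    case (elim T)
    have "ln (real T) \<ge> 0" using elim by simp
    then have "c3 * A T \<le> bm T" "c3 * B T \<le> bm T"
      using elim(3) C(3) order_trans[OF mult_left_mono[OF mult_left_mono[OF max.cobounded1]]]
        order_trans[OF mult_left_mono[OF mult_left_mono[OF max.cobounded2]]]
      unfolding A_def B_def by (meson less_imp_le mult_left_mono max.cobounded1 max.cobounded2 order_trans)+
    then show ?case using elim by (simp add: P_def)
  qed
  have bounds: "\<forall>\<^sub>F T in sequentially. T \<ge> 3 \<and> 0 \<le> lam T * sqrt (s T)
      \<and> lam T * s T * sqrt (s T) \<le> D * (real T powr (7 / 2 * a - 1 / 2 + 3 / 2 * b) * ln (real T) powr (5 / 2))
      \<and> lam T * sqrt (s T) \<le> C1 * sqrt C2 * (real T powr (7 / 2 * a - 1 / 2 + b / 2) * ln (real T) powr (5 / 2))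
      \<and> 1 \<le> s T \<and> c3 * A T \<le> bm T \<and> c3 * B T \<le> bm T"
    using ev
  proof eventually_elim
    case (elim T)
    have P0: "P T \<ge> 0" by (simp add: P_def)
    have sq: "sqrt (real T powr b) = real T powr (b / 2)"
      by (simp add: powr_half_sqrt[symmetric] powr_powr)
    have ss: "sqrt (s T) \<le> sqrt C2 * real T powr (b / 2)"
      using elim by (subst sq[symmetric], subst real_sqrt_mult[symmetric]) simp
    have "lam T * sqrt (s T) \<le> (C1 * P T) * (sqrt C2 * real T powr (b / 2))"
      using elim ss C P0 by (intro mult_mono) auto
    then have 1: "lam T * sqrt (s T) \<le> C1 * sqrt C2 * (real T powr (7 / 2 * a - 1 / 2 + b / 2) * ln (real T) powr (5 / 2))"
      unfolding P_def powr_add by (simp add: mult_ac)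
    have "lam T * sqrt (s T) * s T \<le> (C1 * sqrt C2 * (real T powr (7 / 2 * a - 1 / 2 + b / 2) * ln (real T) powr (5 / 2))) * (C2 * real T powr b)"
      by (rule mult_mono[OF 1]) (use elim C in auto)
    also have "\<dots> = D * (real T powr (7 / 2 * a - 1 / 2 + 3 / 2 * b) * ln (real T) powr (5 / 2))"
    proof -
      have "real T powr (7 / 2 * a - 1 / 2 + 3 / 2 * b) = real T powr (7 / 2 * a - 1 / 2 + b / 2) * real T powr b"
        unfolding powr_add[symmetric] by (simp add: field_simps)
      then show ?thesis by (simp add: D_def mult_ac)
    qed
    finally show ?case using 1 elim by (simp add: mult_ac)
  qed
  have "(\<lambda>T. D * (real T powr (7 / 2 * a - 1 / 2 + 3 / 2 * b) * ln (real T) powr (5 / 2))) \<longlonglongrightarrow> D * 0"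
    using ab by (intro tendsto_mult tendsto_const powr_mult_ln_powr_tendsto_0) (simp add: field_simps)
  moreover have "\<forall>\<^sub>F T in sequentially. 0 \<le> lam T * s T * sqrt (s T) \<and> lam T * s T * sqrt (s T)
      \<le> D * (real T powr (7 / 2 * a - 1 / 2 + 3 / 2 * b) * ln (real T) powr (5 / 2))"
    using bounds
  proof eventually_elim
    case (elim T)
    then show ?case using mult_nonneg_nonneg[of "lam T * sqrt (s T)" "s T"] by (simp add: mult_ac)
  qed
  ultimately show "(\<lambda>T. lam T * s T * sqrt (s T)) \<longlonglongrightarrow> 0"
    by (intro sandwich_null[of "\<lambda>T. lam T * s T * sqrt (s T)"]) simp_all
  have ln2: "(\<lambda>T::nat. ln (real T) powr (-2)) \<longlonglongrightarrow> 0" by real_asymp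
  have "(\<lambda>T. D / c3 * ln (real T) powr (-2)) \<longlonglongrightarrow> D / c3 * 0"
    by (intro tendsto_mult tendsto_const ln2)
  moreover have "\<forall>\<^sub>F T in sequentially. 0 \<le> lam T * s T * sqrt (s T) / bm T
      \<and> lam T * s T * sqrt (s T) / bm T \<le> D / c3 * ln (real T) powr (-2)"
    using bounds
  proof eventually_elim
    case (elim T)
    have L: "ln (real T) \<ge> 1" using elim by (intro ln_ge_1) simp
    have A0: "A T > 0" using L elim by (auto simp: A_def intro!: mult_pos_pos)
    have num0: "0 \<le> lam T * s T * sqrt (s T)"
      using elim mult_nonneg_nonneg[of "lam T * sqrt (s T)" "s T"] by (simp add: mult_ac)
    have key: "real T powr (7 / 2 * a - 1 / 2 + 3 / 2 * b) * ln (real T) powr (5 / 2) \<le> ln (real T) powr (-2) * A T"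
    proof -
      have "ln (real T) powr (-2) * A T = real T powr (2 * b + (15 / 2 * a - 1 / 2)) *
          (ln (real T) powr (-2) * ln (real T) powr 1 * ln (real T) powr (1 + 5 / 2))"
        using L by (simp add: A_def powr_add mult_ac)
      also have "ln (real T) powr (-2) * ln (real T) powr 1 * ln (real T) powr (1 + 5 / 2) = ln (real T) powr (5 / 2)"
        unfolding powr_add[symmetric] by simp
      finally have "ln (real T) powr (-2) * A T = real T powr (2 * b + (15 / 2 * a - 1 / 2)) * ln (real T) powr (5 / 2)" .
      moreover have "real T powr (7 / 2 * a - 1 / 2 + 3 / 2 * b) \<le> real T powr (2 * b + (15 / 2 * a - 1 / 2))"
        using elim ab by (intro powr_mono) auto
      ultimately show ?thesis by (simp add: mult_right_mono)
    qed
    have "lam T * s T * sqrt (s T) / bm T \<le> lam T * s T * sqrt (s T) / (c3 * A T)"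
      using elim num0 A0 C by (intro divide_left_mono) (auto intro: mult_pos_pos less_le_trans[of 0 "c3 * A T"])
    also have "\<dots> \<le> D * (ln (real T) powr (-2) * A T) / (c3 * A T)"
      using elim A0 C D key by (intro divide_right_mono) (auto intro: order_trans mult_left_mono)
    also have "\<dots> = D / c3 * ln (real T) powr (-2)" using A0 by simp
    finally have "lam T * s T * sqrt (s T) / bm T \<le> D / c3 * ln (real T) powr (-2)" .
    moreover have "bm T \<ge> 0" using elim A0 C mult_pos_pos[of c3 "A T"] by linarith
    ultimately show ?case using num0 by simp
  qed
  ultimately show "(\<lambda>T. lam T * s T * sqrt (s T) / bm T) \<longlonglongrightarrow> 0"
    by (intro sandwich_null[of "\<lambda>T. lam T * s T * sqrt (s T) / bm T"]) simp_all
  have "(\<lambda>T. C1 * sqrt C2 / c3\<^sup>2 * ln (real T) powr (-2)) \<longlonglongrightarrow> C1 * sqrt C2 / c3\<^sup>2 * 0"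
    by (intro tendsto_mult tendsto_const ln2)
  moreover have "\<forall>\<^sub>F T in sequentially. 0 \<le> lam T * sqrt (s T) / (bm T)\<^sup>2
      \<and> lam T * sqrt (s T) / (bm T)\<^sup>2 \<le> C1 * sqrt C2 / c3\<^sup>2 * ln (real T) powr (-2)"
    using bounds
  proof eventually_elim
    case (elim T)
    have L: "ln (real T) \<ge> 1" using elim by (intro ln_ge_1) simp
    have B0: "B T > 0" using L elim by (auto simp: B_def intro!: mult_pos_pos)
    have key: "real T powr (7 / 2 * a - 1 / 2 + b / 2) * ln (real T) powr (5 / 2) = ln (real T) powr (-2) * (B T)\<^sup>2"
    proof -
      have sq: "(z powr e)\<^sup>2 = z powr (2 * e)" for z e :: real
        by (simp add: power2_eq_square powr_add[symmetric])
      have ex: "(2::real) * 1 = 2" "2 * (b / 4) = b / 2" "2 * (7 / 4 * a - 1 / 4) = 7 / 2 * a - 1 / 2"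
        "(2::real) * (5 / 4) = 5 / 2" by (simp_all add: field_simps)
      have "(B T)\<^sup>2 = (ln (real T) powr 1)\<^sup>2 * ((real T powr (b / 4))\<^sup>2 * (real T powr (7 / 4 * a - 1 / 4))\<^sup>2 * (ln (real T) powr (5 / 4))\<^sup>2)"
        using L by (simp add: B_def power_mult_distrib)
      also have "\<dots> = ln (real T) powr 2 * (real T powr (b / 2) * real T powr (7 / 2 * a - 1 / 2) * ln (real T) powr (5 / 2))"
        unfolding sq ex ..
      also have "\<dots> = real T powr (7 / 2 * a - 1 / 2 + b / 2) * (ln (real T) powr 2 * ln (real T) powr (5 / 2))"
        by (simp add: powr_add mult_ac)
      finally have "ln (real T) powr (-2) * (B T)\<^sup>2 = real T powr (7 / 2 * a - 1 / 2 + b / 2) *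
         (ln (real T) powr (-2) * ln (real T) powr 2 * ln (real T) powr (5 / 2))" by (simp add: mult_ac)
      also have "ln (real T) powr (-2) * ln (real T) powr 2 * ln (real T) powr (5 / 2) = ln (real T) powr (5 / 2)"
        unfolding powr_add[symmetric] by simp
      finally show ?thesis by simp
    qed
    have cB: "(c3 * B T)\<^sup>2 \<le> (bm T)\<^sup>2" using elim B0 C by (intro power_mono) auto
    have "lam T * sqrt (s T) / (bm T)\<^sup>2 \<le> lam T * sqrt (s T) / (c3 * B T)\<^sup>2"
      using elim cB B0 C by (intro divide_left_mono) (auto intro!: mult_pos_pos less_le_trans[OF _ cB])
    also have "\<dots> \<le> C1 * sqrt C2 * (ln (real T) powr (-2) * (B T)\<^sup>2) / (c3 * B T)\<^sup>2"
      using elim unfolding key by (intro divide_right_mono) auto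
    also have "\<dots> = C1 * sqrt C2 / c3\<^sup>2 * ln (real T) powr (-2)" using B0 by (simp add: power_mult_distrib)
    finally show ?case using elim by simp
  qed
  ultimately show "(\<lambda>T. lam T * sqrt (s T) / (bm T)\<^sup>2) \<longlonglongrightarrow> 0"
    by (intro sandwich_null[of "\<lambda>T. lam T * sqrt (s T) / (bm T)\<^sup>2"]) simp_all
qed

text \<open>
  Each condition, divided by \<open>bm\<close> where it appears on the right-hand side, is controlled by a linear combination of the
  three null sequences, because \<open>s \<ge> 1\<close> bounds \<open>lam s\<close> and \<open>lam s\<^sup>1\<^sup>/\<^sup>2\<close> by \<open>lam s\<^sup>3\<^sup>/\<^sup>2\<close>.
\<close>

lemma tuning_conditions:
  fixes lam s bm :: "nat \<Rightarrow> real" and \<mu> \<tau> :: real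
  assumes \<mu>: "\<mu> > 0" and \<tau>: "\<tau> \<ge> 0"
    and q1: "(\<lambda>T. lam T * s T * sqrt (s T)) \<longlonglongrightarrow> 0"
    and q2: "(\<lambda>T. lam T * s T * sqrt (s T) / bm T) \<longlonglongrightarrow> 0"
    and q3: "(\<lambda>T. lam T * sqrt (s T) / (bm T)\<^sup>2) \<longlonglongrightarrow> 0"
    and basic: "\<forall>\<^sub>F T in sequentially. 0 \<le> lam T \<and> 1 \<le> s T \<and> 0 < bm T"
  shows "\<forall>\<^sub>F T in sequentially.
        6 * lam T * s T / \<mu> \<le> bm T / 2 \<and>
        6 * lam T * s T / \<mu> * (2 / bm T + 2) \<le> 3 \<and>
        lam T * (1 / 2 + 2 / bm T) * sqrt (s T) / \<mu> < bm T \<and>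
        6 * lam T * s T / \<mu> * (1 / 2 + \<tau> * ((1 / 2 + 2 / bm T) * sqrt (s T) / sqrt \<mu>)) < 1"
proof -
  \<comment> \<open>the second value is chosen for the last inequality only\<close>
  define \<eta> where "\<eta> = min (\<mu> / 12) (\<mu> * sqrt \<mu> / (60 * (\<tau> + 1)))"
  have \<eta>: "\<eta> > 0" "\<eta> \<le> \<mu> / 12" "\<eta> \<le> \<mu> * sqrt \<mu> / (60 * (\<tau> + 1))"
  proof -
    show "\<eta> > 0" using \<mu> \<tau> by (simp add: \<eta>_def)
  qed (unfold \<eta>_def, rule min.cobounded1, rule min.cobounded2)
  show ?thesis
    using order_tendstoD(2)[OF q1 \<eta>(1)] order_tendstoD(2)[OF q2 \<eta>(1)] order_tendstoD(2)[OF q3 \<eta>(1)] basic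
  proof eventually_elim
    case (elim T)
    define u where "u = 1 / bm T"
    define A where "A = lam T * s T"
    define w where "w = sqrt (s T)"
    have u: "u > 0" "bm T * u = 1" using elim by (auto simp: u_def)
    have w: "w \<ge> 1" "w * w = s T" using elim by (auto simp: w_def)
    have A0: "A \<ge> 0" using elim by (simp add: A_def)
    have lw: "lam T * w \<ge> 0" "lam T * w \<le> A * w"
      using elim w A0 mult_right_mono[of 1 "s T" "lam T * w"] by (auto simp: A_def mult_ac)
    have AAw: "A \<le> A * w" using A0 w mult_left_mono[of 1 w A] by simp
    have e: "A * w < \<eta>" "A * w * u < \<eta>" "lam T * w * u\<^sup>2 < \<eta>"
      using elim by (simp_all add: A_def w_def u_def power_divide)
    have Au: "A * u \<le> A * w * u" using AAw u by (simp add: mult_right_mono)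
    have lwu: "lam T * w * u \<le> A * w * u" using lw u by (simp add: mult_right_mono)
    have c1: "6 * A \<le> \<mu> * (bm T / 2)"
    proof -
      have "6 * (A * u) \<le> \<mu> / 2" using Au e \<eta> by linarith
      then have "6 * (A * u) * bm T \<le> \<mu> / 2 * bm T" using elim by (intro mult_right_mono) auto
      moreover have "6 * (A * u) * bm T = 6 * (A * (bm T * u))" by simp
      ultimately show ?thesis unfolding u(2) by simp
    qed
    have c2: "6 * A * (2 * u + 2) \<le> 3 * \<mu>"
    proof -
      have "12 * (A * u) + 12 * A \<le> 3 * \<mu>" using Au AAw e \<eta> by linarith
      then show ?thesis by (simp add: algebra_simps)
    qed
    have c3: "lam T * (1 / 2 + 2 * u) * w < \<mu> * bm T"
    proof -
      have "lam T * w * u / 2 + 2 * (lam T * w * u\<^sup>2) < \<mu>" using lwu e \<eta> \<mu> by linarith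
      then have "(lam T * w * u / 2 + 2 * (lam T * w * u\<^sup>2)) * bm T < \<mu> * bm T" using elim by simp
      moreover have "(lam T * w * u / 2 + 2 * (lam T * w * u\<^sup>2)) * bm T = lam T * (1 / 2 + 2 * u) * w * (bm T * u)"
        by (simp add: power2_eq_square algebra_simps)
      ultimately show ?thesis using u by simp
    qed
    have c4: "6 * A / \<mu> * (1 / 2 + \<tau> * ((1 / 2 + 2 * u) * w / sqrt \<mu>)) < 1"
    proof -
      have "6 * A / \<mu> * (1 / 2 + \<tau> * ((1 / 2 + 2 * u) * w / sqrt \<mu>))
        = 3 * A / \<mu> + \<tau> * (3 * (A * w) + 12 * (A * w * u)) / (\<mu> * sqrt \<mu>)"
        using \<mu> by (simp add: field_simps)
      also have "\<dots> \<le> 3 * \<eta> / \<mu> + \<tau> * (15 * \<eta>) / (\<mu> * sqrt \<mu>)"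
        using e AAw \<mu> \<tau> by (intro add_mono divide_right_mono mult_left_mono) auto
      also have "\<dots> \<le> 1 / 4 + 1 / 4"
      proof (rule add_mono)
        show "3 * \<eta> / \<mu> \<le> 1 / 4" using \<eta> \<mu> by (simp add: field_simps)
        have "\<tau> * (15 * \<eta>) \<le> (\<tau> + 1) * (15 * \<eta>)" using \<eta> by (intro mult_right_mono) auto
        also have "\<dots> \<le> (\<tau> + 1) * (15 * (\<mu> * sqrt \<mu> / (60 * (\<tau> + 1))))"
          using \<eta> \<tau> by (intro mult_left_mono) auto
        also have "\<dots> = \<mu> * sqrt \<mu> / 4" using \<tau> by (simp add: field_simps)
        finally show "\<tau> * (15 * \<eta>) / (\<mu> * sqrt \<mu>) \<le> 1 / 4" using \<mu> by (simp add: pos_divide_le_eq)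
      qed
      finally show ?thesis by simp
    qed
    have d: "6 * lam T * s T = 6 * A" "2 / bm T = 2 * u" "sqrt (s T) = w" by (simp_all add: A_def u_def w_def)
    show ?case unfolding d
    proof (intro conjI)
      show "6 * A / \<mu> \<le> bm T / 2" using c1 \<mu> by (simp add: pos_divide_le_eq mult.commute)
      show "6 * A / \<mu> * (2 * u + 2) \<le> 3" using c2 \<mu> by (simp add: pos_divide_le_eq mult.commute)
      show "lam T * (1 / 2 + 2 * u) * w / \<mu> < bm T" using c3 \<mu> by (simp add: pos_divide_less_eq mult.commute)
      show "6 * A / \<mu> * (1 / 2 + \<tau> * ((1 / 2 + 2 * u) * w / sqrt \<mu>)) < 1" by (rule c4)
    qed
  qed
qed

text \<open>
  Chosen such that \<open>T\<close> times its square is \<open>ln T (1 + ln n)\<close>, which outweighs the \<open>ln n\<close> of a union bound over \<open>n\<close>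
  events by an unbounded factor.
\<close>

definition score_level :: "nat \<Rightarrow> real \<Rightarrow> real" where
  "score_level T n = sqrt (ln (real T) * (1 + ln n) / real T)"

lemma score_level_tendsto_0:
  assumes a: "0 \<le> a" "a < 1" and n: "\<forall>\<^sub>F T in sequentially. 1 \<le> n T \<and> n T \<le> C * exp (2 * real T powr a)" and C: "C \<ge> 1"
  shows "(\<lambda>T. score_level T (n T)) \<longlonglongrightarrow> 0"
proof -
  have "(\<lambda>T::nat. (1 + ln C) * (real T powr (-1) * ln (real T) powr 1) + 2 * (real T powr (a - 1) * ln (real T) powr 1)) \<longlonglongrightarrow> (1 + ln C) * 0 + 2 * 0"
    using a by (intro tendsto_intros powr_mult_ln_powr_tendsto_0) auto
  moreover have "\<forall>\<^sub>F T in sequentially. 0 \<le> ln (real T) * (1 + ln (n T)) / real T \<and>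
      ln (real T) * (1 + ln (n T)) / real T \<le> (1 + ln C) * (real T powr (-1) * ln (real T) powr 1) + 2 * (real T powr (a - 1) * ln (real T) powr 1)"
    using n eventually_ge_at_top[of 3]
  proof eventually_elim
    case (elim T)
    have L: "ln (real T) \<ge> 1" using elim by (intro ln_ge_1) simp
    have "ln (n T) \<le> ln (C * exp (2 * real T powr a))" using elim C by (subst ln_le_cancel_iff) auto
    also have "\<dots> = ln C + 2 * real T powr a" using C by (simp add: ln_mult)
    finally have "ln (real T) * (1 + ln (n T)) / real T \<le> ln (real T) * (1 + (ln C + 2 * real T powr a)) / real T"
      using L by (intro divide_right_mono mult_left_mono) auto
    also have "\<dots> = (1 + ln C) * (real T powr (-1) * ln (real T) powr 1) + 2 * (real T powr (a - 1) * ln (real T) powr 1)"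
      using L elim by (simp add: powr_diff powr_minus divide_simps algebra_simps)
    finally show ?case using L elim by simp
  qed
  ultimately have "(\<lambda>T. ln (real T) * (1 + ln (n T)) / real T) \<longlonglongrightarrow> 0"
    by (intro sandwich_null[of "\<lambda>T. ln (real T) * (1 + ln (n T)) / real T"]) simp_all
  from tendsto_real_sqrt[OF this] show ?thesis unfolding score_level_def by simp
qed

text \<open>
  Once \<open>A = ln T / (4\<rho>\<^sup>2) \<ge> 1\<close>, the exponent \<open>ln n - A(1 + ln n)\<close> is at most \<open>-A\<close>.
\<close>

lemma score_error_tendsto_0:
  assumes \<rho>: "\<rho> > 0" and n: "\<forall>\<^sub>F T in sequentially. 1 \<le> n T"
  shows "(\<lambda>T. 4 * n T * exp (- real T * (score_level T (n T))\<^sup>2 / (4 * \<rho>\<^sup>2))) \<longlonglongrightarrow> 0"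
proof (rule sandwich_null)
  show "(\<lambda>T::nat. 4 * exp (- ln (real T) / (4 * \<rho>\<^sup>2))) \<longlonglongrightarrow> 0"
    using \<rho> by real_asymp
  have "\<forall>\<^sub>F T::nat in sequentially. 4 * \<rho>\<^sup>2 \<le> ln (real T)" by real_asymp
  then show "\<forall>\<^sub>F T in sequentially. 0 \<le> 4 * n T * exp (- real T * (score_level T (n T))\<^sup>2 / (4 * \<rho>\<^sup>2)) \<and>
      4 * n T * exp (- real T * (score_level T (n T))\<^sup>2 / (4 * \<rho>\<^sup>2)) \<le> 4 * exp (- ln (real T) / (4 * \<rho>\<^sup>2))"
    using n eventually_ge_at_top[of 3]
  proof eventually_elim
    case (elim T)
    define A where "A = ln (real T) / (4 * \<rho>\<^sup>2)"
    have A: "A \<ge> 1" using elim \<rho> by (simp add: A_def pos_le_divide_eq)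
    have L: "ln (real T) \<ge> 1" using elim by (intro ln_ge_1) simp
    have ln0: "ln (n T) \<ge> 0" using elim by simp
    have "real T * (score_level T (n T))\<^sup>2 = ln (real T) * (1 + ln (n T))"
      using elim L ln0 by (simp add: score_level_def)
    then have e: "- real T * (score_level T (n T))\<^sup>2 / (4 * \<rho>\<^sup>2) = - (A * (1 + ln (n T)))"
      by (simp add: A_def)
    have "ln (n T) + - (A * (1 + ln (n T))) \<le> - A"
      using mult_right_mono[OF A ln0] by (simp add: algebra_simps)
    then have "exp (ln (n T)) * exp (- (A * (1 + ln (n T)))) \<le> exp (- A)"
      unfolding exp_add[symmetric] by simp
    then show ?case unfolding e using elim by (simp add: A_def)
  qed
qed

text \<open>
  The exponent is at most \<open>4T\<^sup>a - D T\<^bsup>1 - 2b\<^esup>\<close> with a constant \<open>D > 0\<close>, and \<open>a < 1 - 2b\<close>.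
\<close>

lemma gram_error_tendsto_0:
  assumes \<rho>: "\<rho> > 0" and c: "c > 0" and ab: "0 \<le> a" "0 \<le> b" "a + 2 * b < 1" and C: "C2 > 0" "C > 0"
    and n: "\<forall>\<^sub>F T in sequentially. 1 \<le> n T \<and> n T \<le> C * exp (2 * real T powr a)"
    and s: "\<forall>\<^sub>F T in sequentially. 1 \<le> s T \<and> s T \<le> C2 * real T powr b"
  shows "(\<lambda>T. 4 * (n T)\<^sup>2 * exp (- real T * (c\<^sup>2 / (32 * s T))\<^sup>2 / (4 * \<rho>\<^sup>2))) \<longlonglongrightarrow> 0"
proof (rule sandwich_null)
  define D where "D = (c\<^sup>2 / (32 * C2))\<^sup>2 / (4 * \<rho>\<^sup>2)"
  have D: "D > 0" using c C \<rho> by (simp add: D_def)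
  have "a < 1 - 2 * b" using ab by simp
  then have "(\<lambda>T::nat. exp (4 * real T powr a - D * real T powr (1 - 2 * b))) \<longlonglongrightarrow> 0"
    using ab(1) D by real_asymp
  then show "(\<lambda>T::nat. 4 * C\<^sup>2 * exp (4 * real T powr a - D * real T powr (1 - 2 * b))) \<longlonglongrightarrow> 0"
    by (rule tendsto_mult_right_zero)
  show "\<forall>\<^sub>F T in sequentially. 0 \<le> 4 * (n T)\<^sup>2 * exp (- real T * (c\<^sup>2 / (32 * s T))\<^sup>2 / (4 * \<rho>\<^sup>2)) \<and>
      4 * (n T)\<^sup>2 * exp (- real T * (c\<^sup>2 / (32 * s T))\<^sup>2 / (4 * \<rho>\<^sup>2))
      \<le> 4 * C\<^sup>2 * exp (4 * real T powr a - D * real T powr (1 - 2 * b))"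
    using n s eventually_ge_at_top[of 3]
  proof eventually_elim
    case (elim T)
    have "c\<^sup>2 / (32 * (C2 * real T powr b)) \<le> c\<^sup>2 / (32 * s T)"
      using elim c C by (intro divide_left_mono mult_left_mono) auto
    then have "(c\<^sup>2 / (32 * (C2 * real T powr b)))\<^sup>2 \<le> (c\<^sup>2 / (32 * s T))\<^sup>2"
      using C by (intro power_mono) auto
    then have "real T * (c\<^sup>2 / (32 * (C2 * real T powr b)))\<^sup>2 / (4 * \<rho>\<^sup>2) \<le> real T * (c\<^sup>2 / (32 * s T))\<^sup>2 / (4 * \<rho>\<^sup>2)"
      by (intro divide_right_mono mult_left_mono) auto
    moreover have "real T * (c\<^sup>2 / (32 * (C2 * real T powr b)))\<^sup>2 / (4 * \<rho>\<^sup>2) = D * real T powr (1 - 2 * b)"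
    proof -
      have "real T powr (1 - 2 * b) = real T / (real T powr b)\<^sup>2"
        using elim by (simp add: powr_diff power2_eq_square powr_add[symmetric])
      then show ?thesis by (simp add: D_def power_divide power_mult_distrib mult_ac)
    qed
    ultimately have e: "exp (- real T * (c\<^sup>2 / (32 * s T))\<^sup>2 / (4 * \<rho>\<^sup>2)) \<le> exp (- (D * real T powr (1 - 2 * b)))"
      by simp
    have "(n T)\<^sup>2 \<le> (C * exp (2 * real T powr a))\<^sup>2" using elim by (intro power_mono) auto
    also have "\<dots> = C\<^sup>2 * exp (4 * real T powr a)"
      by (simp add: power_mult_distrib power2_eq_square exp_add[symmetric])
    finally have "(n T)\<^sup>2 * exp (- real T * (c\<^sup>2 / (32 * s T))\<^sup>2 / (4 * \<rho>\<^sup>2))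
      \<le> C\<^sup>2 * exp (4 * real T powr a) * exp (- (D * real T powr (1 - 2 * b)))"
      using e by (intro mult_mono) auto
    also have "\<dots> = C\<^sup>2 * exp (4 * real T powr a - D * real T powr (1 - 2 * b))"
      by (simp add: exp_diff exp_minus divide_inverse)
    finally show ?case by simp
  qed
qed

section \<open>Sign consistency\<close>

lemma log_growth:
  fixes k :: "nat \<Rightarrow> nat"
  assumes k: "\<forall>\<^sub>F T in sequentially. real (k T) \<le> C * exp (real T powr a)" and C: "C > 0" and a: "a \<ge> 0"
  shows "\<forall>\<^sub>F T in sequentially. ln (1 + real (k T)) \<le> (1 + ln (1 + C)) * real T powr a"
  using k eventually_ge_at_top[of 1]
proof eventually_elim
  case (elim T)
  have t: "real T powr a \<ge> 1" using elim a by (intro ge_one_powr_ge_zero) auto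
  have "1 \<le> exp (real T powr a)" by simp
  then have "1 + real (k T) \<le> (1 + C) * exp (real T powr a)"
    using elim(1) unfolding distrib_right by linarith
  then have "ln (1 + real (k T)) \<le> ln ((1 + C) * exp (real T powr a))"
    using C by (subst ln_le_cancel_iff) auto
  also have "\<dots> = ln (1 + C) + real T powr a" using C by (simp add: ln_mult)
  also have "\<dots> \<le> ln (1 + C) * real T powr a + real T powr a"
    using t C mult_left_mono[of 1 "real T powr a" "ln (1 + C)"] by simp
  finally show ?case by (simp add: algebra_simps)
qed

definition penalty_level :: "nat \<Rightarrow> nat \<Rightarrow> nat \<Rightarrow> real \<Rightarrow> real" where
  "penalty_level T k p \<sigma> = sqrt (8 * ln (1 + real T) ^ 5 * ln (1 + real k) ^ 4 *
            ln (1 + real p) ^ 2 * ln (real k ^ 2 * real p) * \<sigma> ^ 4 / real T)"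

lemma ln_dimension_nonneg: "k \<ge> 1 \<Longrightarrow> p \<ge> 1 \<Longrightarrow> ln (real k ^ 2 * real p) \<ge> 0"
  by (simp add: ln_mult ln_realpow)

lemma penalty_level_nonneg: "k \<ge> 1 \<Longrightarrow> p \<ge> 1 \<Longrightarrow> penalty_level T k p \<sigma> \<ge> 0"
  unfolding penalty_level_def using ln_dimension_nonneg[of k p]
  by (intro real_sqrt_ge_zero divide_nonneg_nonneg mult_nonneg_nonneg) auto

text \<open>
  The seven logarithmic factors in \<open>k\<close> and \<open>p\<close> are each at most of order \<open>T\<^sup>a\<close>.
\<close>

lemma penalty_level_le:
  assumes T: "T \<ge> 3" and kp: "k \<ge> 1" "p \<ge> 1" and a: "a \<ge> 0" and D: "D > 0"
    and k: "ln (1 + real k) \<le> D * real T powr a" and p: "ln (1 + real p) \<le> D * real T powr a"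
    and \<sigma>: "0 \<le> \<sigma>" "\<sigma> \<le> \<sigma>m"
  shows "penalty_level T k p \<sigma> \<le> sqrt (768 * D ^ 7 * \<sigma>m ^ 4) *
    (real T powr (7 / 2 * a - 1 / 2) * ln (real T) powr (5 / 2))"
proof -
  define t where "t = real T powr a"
  define L where "L = ln (real T)"
  have L: "L \<ge> 1" unfolding L_def using T by (intro ln_ge_1) simp
  have t: "t > 0" using T by (simp add: t_def)
  have lnT: "ln (1 + real T) \<le> 2 * L"
  proof -
    have "3 * real T \<le> real T * real T" using T by (intro mult_right_mono) auto
    moreover have "3 \<le> real T" using T by simp
    ultimately have "1 + real T \<le> real T * real T" by linarith
    then have "ln (1 + real T) \<le> ln (real T * real T)" using T by (subst ln_le_cancel_iff) auto
    then show ?thesis using T by (simp add: L_def ln_mult)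
  qed
  have lnkp: "ln (real k ^ 2 * real p) \<le> 3 * (D * t)"
  proof -
    have "ln (real k) \<le> ln (1 + real k)" "ln (real p) \<le> ln (1 + real p)" using kp by auto
    moreover have "ln (real k ^ 2 * real p) = 2 * ln (real k) + ln (real p)"
      using kp by (simp add: ln_mult ln_realpow)
    ultimately show ?thesis using k p unfolding t_def by linarith
  qed
  have "8 * ln (1 + real T) ^ 5 * ln (1 + real k) ^ 4 * ln (1 + real p) ^ 2 * ln (real k ^ 2 * real p) * \<sigma> ^ 4 / real T
    \<le> 8 * (2 * L) ^ 5 * (D * t) ^ 4 * (D * t) ^ 2 * (3 * (D * t)) * \<sigma>m ^ 4 / real T"
    using L t D \<sigma> lnT lnkp k p ln_dimension_nonneg[OF kp] unfolding t_def[symmetric]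
    by (intro divide_right_mono mult_mono power_mono) (auto intro!: mult_nonneg_nonneg)
  also have "\<dots> = (768 * D ^ 7 * \<sigma>m ^ 4) * (t ^ 7 / real T * L ^ 5)"
    by (simp add: power_mult_distrib numeral_eq_Suc mult_ac)
  also have "t ^ 7 / real T * L ^ 5 = (real T powr (7 / 2 * a - 1 / 2) * L powr (5 / 2))\<^sup>2"
  proof -
    have sq: "(z powr e)\<^sup>2 = z powr (2 * e)" for z e :: real
      by (simp add: power2_eq_square powr_add[symmetric])
    have "t ^ 7 = real T powr (7 * a)" unfolding t_def using T by (simp add: powr_power mult.commute)
    moreover have "L ^ 5 = L powr 5" using L by (simp add: powr_numeral)
    moreover have "real T powr (7 * a) / real T = real T powr (7 * a - 1)" using T by (simp add: powr_diff)
    moreover have "2 * (7 / 2 * a - 1 / 2) = 7 * a - 1" "(2::real) * (5 / 2) = 5" by (simp_all add: field_simps)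
    ultimately show ?thesis unfolding power_mult_distrib sq by simp
  qed
  finally have "penalty_level T k p \<sigma> \<le> sqrt ((768 * D ^ 7 * \<sigma>m ^ 4) * (real T powr (7 / 2 * a - 1 / 2) * L powr (5 / 2))\<^sup>2)"
    unfolding penalty_level_def by (rule real_sqrt_le_mono)
  then show ?thesis by (simp add: real_sqrt_mult L_def)
qed

text \<open>
  With at least two regressors, \<open>ln (k\<^sup>2p)\<close> dominates \<open>1 + ln (kp)\<close> up to the factor 3, and the surplus \<open>ln(T)\<^sup>4\<close> absorbs all
  constants.
\<close>

lemma score_level_le_penalty_level:
  assumes T: "T \<ge> 3" and kp: "k \<ge> 1" "p \<ge> 1" "k * p \<ge> 2" and c: "0 < c" "c \<le> \<sigma>"
    and large: "3 \<le> 2 * ln 2 ^ 6 * c ^ 4 * ln (real T) ^ 4"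
  shows "score_level T (real (k * p)) \<le> penalty_level T k p \<sigma> / 2" and "penalty_level T k p \<sigma> > 0"
proof -
  define L where "L = ln (real T)"
  define l where "l = ln (real k ^ 2 * real p)"
  have L: "L \<ge> 1" unfolding L_def using T by (intro ln_ge_1) simp
  have "(2::real) \<le> real (k * p)" using kp(3) by (metis of_nat_le_iff of_nat_numeral)
  then have ln2: "ln 2 \<le> ln (real (k * p))" by (subst ln_le_cancel_iff) auto
  have lN: "ln (real (k * p)) \<le> l"
    unfolding l_def using kp by (simp add: ln_mult ln_realpow)
  have dim: "1 + ln (real (k * p)) \<le> 3 * l" using ln2 lN ln2_ge_two_thirds by linarith
  have l0: "l > 0" using ln2 lN ln2_ge_two_thirds by linarith
  have "L * (1 + ln (real (k * p))) \<le> L * (3 * l)" using dim L by (intro mult_left_mono) auto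
  also have "\<dots> \<le> L * (2 * ln 2 ^ 6 * c ^ 4 * L ^ 4 * l)"
    using large L l0 unfolding L_def[symmetric] by (intro mult_left_mono mult_right_mono) auto
  also have "\<dots> = 2 * L ^ 5 * ln 2 ^ 4 * ln 2 ^ 2 * l * c ^ 4" by (simp add: numeral_eq_Suc mult_ac)
  also have "\<dots> \<le> 2 * ln (1 + real T) ^ 5 * ln (1 + real k) ^ 4 * ln (1 + real p) ^ 2 * l * \<sigma> ^ 4"
    using L l0 c kp T by (intro mult_mono power_mono) (auto simp: L_def)
  finally have main: "L * (1 + ln (real (k * p))) \<le> 2 * ln (1 + real T) ^ 5 * ln (1 + real k) ^ 4 * ln (1 + real p) ^ 2 * l * \<sigma> ^ 4" .
  have "score_level T (real (k * p)) \<le> sqrt (2 * ln (1 + real T) ^ 5 * ln (1 + real k) ^ 4 * ln (1 + real p) ^ 2 * l * \<sigma> ^ 4 / real T)"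
    unfolding score_level_def L_def[symmetric] using main by (intro real_sqrt_le_mono divide_right_mono) auto
  also have "\<dots> = sqrt (8 * ln (1 + real T) ^ 5 * ln (1 + real k) ^ 4 * ln (1 + real p) ^ 2 * l * \<sigma> ^ 4 / real T / 2\<^sup>2)"
    by (simp add: mult_ac)
  also have "\<dots> = penalty_level T k p \<sigma> / 2"
    unfolding penalty_level_def l_def by (subst real_sqrt_divide) simp
  finally show le: "score_level T (real (k * p)) \<le> penalty_level T k p \<sigma> / 2" .
  have "score_level T (real (k * p)) > 0"
    unfolding score_level_def L_def[symmetric] using L T ln2 ln2_ge_two_thirds
    by (intro real_sqrt_gt_zero divide_pos_pos mult_pos_pos) auto
  then show "penalty_level T k p \<sigma> > 0" using le by linarith
qed

text \<open>
  The score is of order \<open>T\<^bsup>-1/2\<^esup>\<close> up to logarithms, whereas the bound on \<open>\<beta>\<^sub>m\<^sub>i\<^sub>n\<close> is at least of order \<open>T\<^bsup>-1/4\<^esup>\<close>.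
\<close>

lemma single_regressor_score_level:
  assumes "a \<ge> 0" "b \<ge> 0" "\<mu> > 0" "c3 > 0"
  shows "\<forall>\<^sub>F T in sequentially. score_level T 1 < \<mu> * (c3 * (ln (real T) *
    (real T powr (b / 4) * real T powr (7 / 4 * a - 1 / 4) * ln (real T) powr (5 / 4))))"
proof -
  have "(\<lambda>T::nat. real T powr (- 1 / 4) * ln (real T) powr (1 / 2)) \<longlonglongrightarrow> 0"
    by (rule powr_mult_ln_powr_tendsto_0) simp
  then have "\<forall>\<^sub>F T::nat in sequentially. real T powr (- 1 / 4) * ln (real T) powr (1 / 2) < \<mu> * c3"
    using assms by (intro order_tendstoD(2)) auto
  then show ?thesis
    using eventually_ge_at_top[of 3]
  proof eventually_elim
    case (elim T)
    have L: "ln (real T) \<ge> 1" using elim by (intro ln_ge_1) simp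
    have T1: "real T powr (- 1 / 4) > 0" using elim by simp
    have "score_level T 1 = sqrt (ln (real T)) / sqrt (real T)" by (simp add: score_level_def real_sqrt_divide)
    also have "\<dots> = real T powr (- 1 / 4) * ln (real T) powr (1 / 2) * real T powr (- 1 / 4)"
    proof -
      have "real T powr (- 1 / 4) * real T powr (- 1 / 4) = real T powr (- (1 / 2))"
        unfolding powr_add[symmetric] by simp
      also have "\<dots> = 1 / sqrt (real T)" using elim by (simp add: powr_minus powr_half_sqrt inverse_eq_divide)
      finally have "real T powr (- 1 / 4) * real T powr (- 1 / 4) = 1 / sqrt (real T)" .
      then show ?thesis using L by (simp add: powr_half_sqrt mult_ac)
    qed
    also have "\<dots> < \<mu> * c3 * real T powr (- 1 / 4)" using elim(1) T1 by (rule mult_strict_right_mono)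
    also have "\<dots> \<le> \<mu> * c3 * (ln (real T) * (real T powr (b / 4) * real T powr (7 / 4 * a - 1 / 4) * ln (real T) powr (5 / 4)))"
    proof (rule mult_left_mono)
      have "1 * (1 * real T powr (- 1 / 4) * 1) \<le> ln (real T) * (real T powr (b / 4) * real T powr (7 / 4 * a - 1 / 4) * ln (real T) powr (5 / 4))"
      proof (intro mult_mono)
        show "1 \<le> real T powr (b / 4)" using elim assms by (intro ge_one_powr_ge_zero) auto
        show "1 \<le> ln (real T) powr (5 / 4)" using L by (intro ge_one_powr_ge_zero) auto
        show "real T powr (- 1 / 4) \<le> real T powr (7 / 4 * a - 1 / 4)" using elim assms by (intro powr_mono) auto
      qed (use L in auto)
      then show "real T powr (- 1 / 4) \<le> ln (real T) * (real T powr (b / 4) * real T powr (7 / 4 * a - 1 / 4) * ln (real T) powr (5 / 4))" by simp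
    qed (use assms in simp)
    finally show ?case by (simp add: mult.assoc)
  qed
qed

theorem theorem7:
  fixes M :: "nat \<Rightarrow> 'a measure"
    and k p i :: "nat \<Rightarrow> nat"
    and \<Phi> :: "nat \<Rightarrow> nat \<Rightarrow> real mat"
    and S :: "nat \<Rightarrow> real mat"
    and \<epsilon> y :: "nat \<Rightarrow> int \<Rightarrow> nat \<Rightarrow> 'a \<Rightarrow> real"
    and \<Gamma> F :: "nat \<Rightarrow> real mat"
    and \<sigma> lam \<beta>min a_T b_T :: "nat \<Rightarrow> real"
    and s :: "nat \<Rightarrow> nat"
    and \<beta>star :: "nat \<Rightarrow> real vec"
    and \<beta>hat \<beta>tilde :: "nat \<Rightarrow> 'a \<Rightarrow> real vec"
    and c a b :: real
  defines "\<Gamma> \<equiv> \<lambda>T. regressor_cov (M T) (k T) (p T) (y T)"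
    and "F \<equiv> \<lambda>T. companion (k T) (p T) (\<Phi> T)"
    and "\<sigma> \<equiv> \<lambda>T. max_sd (M T) (k T) (\<epsilon> T) (y T)"
    and "\<beta>star \<equiv> \<lambda>T. true_param (k T) (p T) (\<Phi> T) (i T)"
    and "s \<equiv> \<lambda>T. card (support (\<beta>star T))"
    and "\<beta>min \<equiv> \<lambda>T. beta_min (\<beta>star T)"
    and "lam \<equiv> \<lambda>T. sqrt (8 * ln (1 + real T) ^ 5 * ln (1 + real (k T)) ^ 4 *
            ln (1 + real (p T)) ^ 2 * ln (real (k T) ^ 2 * real (p T)) * \<sigma> T ^ 4 / real T)"
    and "a_T \<equiv> \<lambda>T. real T powr (2 * b) * real T powr (15 / 2 * a - 1 / 2) *
            ln (real T) powr (1 + 5 / 2)"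
    and "b_T \<equiv> \<lambda>T. real T powr (b / 4) * real T powr (7 / 4 * a - 1 / 4) *
            ln (real T) powr (5 / 4)"
  assumes var: "\<And>T. T \<ge> 1 \<Longrightarrow> gaussian_var (M T) (k T) (p T) (\<Phi> T) (S T) (\<epsilon> T) (y T)"
    and i: "\<And>T. T \<ge> 1 \<Longrightarrow> i T < k T"
    and s_pos: "\<And>T. T \<ge> 1 \<Longrightarrow> s T \<ge> 1"
    and c_pos: "c > 0"
    and kappa: "\<And>T. T \<ge> 1 \<Longrightarrow> kappa (\<Gamma> T) (s T) \<ge> c"
    and sigma_bdd: "bdd_above (\<sigma> ` {1..})"
    and Gamma_F_bdd:
      "bdd_above ((\<lambda>T. spectral_norm (\<Gamma> T) * (\<Sum>j=0..T. spectral_norm (F T ^\<^sub>m j))) ` {1..})"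
    and ab: "a \<ge> 0" "b \<ge> 0" "15 * a + 4 * b < 1"
    and k_growth: "(\<lambda>T. real (k T)) \<in> O(\<lambda>T. exp (real T powr a))"
    and p_growth: "(\<lambda>T. real (p T)) \<in> O(\<lambda>T. exp (real T powr a))"
    and s_growth: "(\<lambda>T. real (s T)) \<in> O(\<lambda>T. real T powr b)"
    and beta_min: "\<beta>min \<in> \<Omega>(\<lambda>T. ln (real T) * max (a_T T) (b_T T))"
    and lasso: "\<And>T \<omega>. T \<ge> 1 \<Longrightarrow> \<omega> \<in> space (M T) \<Longrightarrow>
      is_lasso (design T (k T) (p T) (y T) \<omega>) (response T (y T) (i T) \<omega>) (lam T) (\<beta>hat T \<omega>)"
    and adaptive_lasso: "\<And>T \<omega>. T \<ge> 1 \<Longrightarrow> \<omega> \<in> space (M T) \<Longrightarrow>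
      is_adaptive_lasso (design T (k T) (p T) (y T) \<omega>) (response T (y T) (i T) \<omega>) (lam T)
        (\<beta>hat T \<omega>) (\<beta>tilde T \<omega>)"
    and tilde_measurable: "\<And>T j. T \<ge> 1 \<Longrightarrow> j < k T * p T \<Longrightarrow>
      (\<lambda>\<omega>. \<beta>tilde T \<omega> $ j) \<in> borel_measurable (M T)"
  shows "(\<lambda>T. \<P>(\<omega> in M T. map_vec sgn (\<beta>tilde T \<omega>) = map_vec sgn (\<beta>star T))) \<longlonglongrightarrow> 1"
proof -
  have k1: "k T \<ge> 1" and p1: "p T \<ge> 1" if "T \<ge> 1" for T
    using gaussian_var.k_pos[OF var[OF that]] gaussian_var.p_pos[OF var[OF that]] by auto
  have lam_eq: "lam T = penalty_level T (k T) (p T) (\<sigma> T)" for T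
    by (simp add: lam_def penalty_level_def)
  obtain \<sigma>m where \<sigma>m: "\<sigma> T \<le> \<sigma>m" if "T \<ge> 1" for T
    using sigma_bdd unfolding bdd_above_def by auto
  obtain K where K: "spectral_norm (\<Gamma> T) * (\<Sum>j=0..T. spectral_norm (F T ^\<^sub>m j)) \<le> K" if "T \<ge> 1" for T
    using Gamma_F_bdd unfolding bdd_above_def by auto
  have s_ne: "support (\<beta>star T) \<noteq> {}" if "T \<ge> 1" for T
    using s_pos[OF that] unfolding s_def by auto
  have bmin_pos: "\<beta>min T > 0" if "T \<ge> 1" for T
    unfolding \<beta>min_def using s_ne[OF that] by (rule beta_min_pos)
  have c_le_\<sigma>: "c \<le> \<sigma> T" if T: "T \<ge> 1" for T
    unfolding \<sigma>_def
  proof (rule gaussian_var.kappa_le_max_sd[OF var[OF T] c_pos])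
    show "c \<le> kappa (regressor_cov (M T) (k T) (p T) (y T)) (s T)" using kappa[OF T] by (simp add: \<Gamma>_def)
    show "support (\<beta>star T) \<subseteq> {..<k T * p T}" by (auto simp: support_def \<beta>star_def true_param_def)
  qed (use s_ne[OF T] in \<open>simp_all add: s_def\<close>)
  have \<sigma>m0: "\<sigma>m > 0" using c_le_\<sigma>[of 1] \<sigma>m[of 1] c_pos by simp
  obtain Ck where Ck: "Ck > 0" "\<forall>\<^sub>F T in sequentially. real (k T) \<le> Ck * exp (real T powr a)"
    using k_growth by (elim landau_o.bigE) auto
  obtain Cp where Cp: "Cp > 0" "\<forall>\<^sub>F T in sequentially. real (p T) \<le> Cp * exp (real T powr a)"
    using p_growth by (elim landau_o.bigE) auto
  obtain Cs where Cs: "Cs > 0" "\<forall>\<^sub>F T in sequentially. real (s T) \<le> Cs * real T powr b"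
    using s_growth by (elim landau_o.bigE) auto
  obtain c3 where c3: "c3 > 0"
    "\<forall>\<^sub>F T in sequentially. c3 * norm (ln (real T) * max (a_T T) (b_T T)) \<le> norm (\<beta>min T)"
    using beta_min by (elim landau_omega.bigE) auto
  have bm: "\<forall>\<^sub>F T in sequentially. c3 * (ln (real T) * max (a_T T) (b_T T)) \<le> \<beta>min T"
    using c3(2) eventually_ge_at_top[of 1]
  proof eventually_elim
    case (elim T)
    have "c3 * (ln (real T) * max (a_T T) (b_T T)) \<le> c3 * norm (ln (real T) * max (a_T T) (b_T T))"
      using c3(1) by (intro mult_left_mono) auto
    then show ?case using elim bmin_pos[of T] by simp
  qed
  have s_ev: "\<forall>\<^sub>F T in sequentially. 1 \<le> real (s T) \<and> real (s T) \<le> Cs * real T powr b"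
    using Cs(2) eventually_ge_at_top[of 1] by eventually_elim (use s_pos in auto)
  define n where "n T = real (k T * p T)" for T
  define C where "C = max 1 (Ck * Cp)"
  have n_ev: "\<forall>\<^sub>F T in sequentially. 1 \<le> n T \<and> n T \<le> C * exp (2 * real T powr a)"
    using Ck(2) Cp(2) eventually_ge_at_top[of 1]
  proof eventually_elim
    case (elim T)
    have "n T \<le> (Ck * exp (real T powr a)) * (Cp * exp (real T powr a))"
      unfolding n_def of_nat_mult using elim Ck(1) by (intro mult_mono) auto
    also have "\<dots> = Ck * Cp * exp (2 * real T powr a)" by (simp add: exp_add[symmetric] mult_ac)
    also have "\<dots> \<le> C * exp (2 * real T powr a)" by (intro mult_right_mono) (auto simp: C_def)
    finally have "n T \<le> C * exp (2 * real T powr a)" .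
    moreover have "1 \<le> k T * p T" using k1[of T] p1[of T] elim by (metis mult_le_mono mult_1)
    then have "1 \<le> n T" unfolding n_def by (metis of_nat_1 of_nat_le_iff)
    ultimately show ?case by simp
  qed
  \<comment> \<open>bounds that hold for all \<open>T\<close> at once, so that the error is explicit in \<open>T\<close>, \<open>k\<close>, \<open>p\<close> and \<open>s\<close>\<close>
  define \<mu> where "\<mu> = c\<^sup>2 / 2"
  define \<tau> where "\<tau> = sqrt (\<sigma>m\<^sup>2 + c\<^sup>2)"
  define \<rho> where "\<rho> = 8 * K + 2 * (\<sigma>m * K / c) + \<sigma>m\<^sup>2 + c\<^sup>2 + 1"
  define \<nu> where "\<nu> T = score_level T (n T)" for T
  define err where "err T = 4 * (n T)\<^sup>2 * exp (- real T * (c\<^sup>2 / (32 * real (s T)))\<^sup>2 / (4 * \<rho>\<^sup>2))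
        + 4 * n T * exp (- real T * (\<nu> T)\<^sup>2 / (4 * \<rho>\<^sup>2))" for T
  have \<mu>: "\<mu> > 0" using c_pos by (simp add: \<mu>_def)
  have K0: "K \<ge> 0"
  proof -
    have "0 \<le> spectral_norm (\<Gamma> 1) * (\<Sum>j=0..1. spectral_norm (F 1 ^\<^sub>m j))"
      by (intro mult_nonneg_nonneg sum_nonneg spectral_norm_nonneg)
    also have "\<dots> \<le> K" by (rule K) simp
    finally show ?thesis .
  qed
  have \<rho>: "\<rho> > 0" unfolding \<rho>_def using K0 \<sigma>m0 c_pos by (intro add_nonneg_pos add_nonneg_nonneg) auto
  have err_lim: "err \<longlonglongrightarrow> 0"
  proof -
    have "(\<lambda>T. 4 * (n T)\<^sup>2 * exp (- real T * (c\<^sup>2 / (32 * real (s T)))\<^sup>2 / (4 * \<rho>\<^sup>2))) \<longlonglongrightarrow> 0"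
      by (rule gram_error_tendsto_0[OF \<rho> c_pos ab(1,2) _ Cs(1) _ n_ev s_ev]) (use ab in \<open>auto simp: C_def\<close>)
    moreover have "(\<lambda>T. 4 * n T * exp (- real T * (\<nu> T)\<^sup>2 / (4 * \<rho>\<^sup>2))) \<longlonglongrightarrow> 0"
      unfolding \<nu>_def by (rule score_error_tendsto_0[OF \<rho>]) (use n_ev in \<open>auto elim: eventually_mono\<close>)
    ultimately have "(\<lambda>T. 4 * (n T)\<^sup>2 * exp (- real T * (c\<^sup>2 / (32 * real (s T)))\<^sup>2 / (4 * \<rho>\<^sup>2))
        + 4 * n T * exp (- real T * (\<nu> T)\<^sup>2 / (4 * \<rho>\<^sup>2))) \<longlonglongrightarrow> 0 + 0" by (rule tendsto_add)
    then show ?thesis unfolding err_def by simp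
  qed
  have \<nu>_lim: "\<nu> \<longlonglongrightarrow> 0"
    using score_level_tendsto_0[OF ab(1) _ n_ev] ab unfolding \<nu>_def by (auto simp: C_def)
  have \<nu>_le: "\<forall>\<^sub>F T in sequentially. \<nu> T < \<rho>" using \<nu>_lim \<rho> by (rule order_tendstoD(2))
  have lam0: "lam T \<ge> 0" if "T \<ge> 1" for T
    unfolding lam_eq using k1[OF that] p1[OF that] by (rule penalty_level_nonneg)
  define D where "D = max (1 + ln (1 + Ck)) (1 + ln (1 + Cp))"
  have D: "D > 0" using Ck(1) unfolding D_def by (simp add: less_max_iff_disj add_pos_nonneg)
  have lam_ev: "\<forall>\<^sub>F T in sequentially. 0 \<le> lam T \<and>
      lam T \<le> sqrt (768 * D ^ 7 * \<sigma>m ^ 4) * (real T powr (7 / 2 * a - 1 / 2) * ln (real T) powr (5 / 2))"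
    using log_growth[OF Ck(2,1) ab(1)] log_growth[OF Cp(2,1) ab(1)] eventually_ge_at_top[of 3]
  proof eventually_elim
    case (elim T)
    have T1: "T \<ge> 1" using elim by simp
    have "ln (1 + real (k T)) \<le> D * real T powr a"
      by (rule order_trans[OF elim(1)]) (auto simp: D_def intro!: mult_right_mono)
    moreover have "ln (1 + real (p T)) \<le> D * real T powr a"
      by (rule order_trans[OF elim(2)]) (auto simp: D_def intro!: mult_right_mono)
    ultimately show ?case unfolding lam_eq
      using penalty_level_nonneg[OF k1[OF T1] p1[OF T1]] c_le_\<sigma>[OF T1] \<sigma>m[OF T1] c_pos
      by (intro conjI penalty_level_le[OF elim(3) k1[OF T1] p1[OF T1] ab(1) D]) auto
  qed
  have C1: "sqrt (768 * D ^ 7 * \<sigma>m ^ 4) > 0" using D \<sigma>m0 by simp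
  note lims = tuning_limits[OF ab C1 Cs(1) c3(1) lam_ev s_ev bm[unfolded a_T_def b_T_def]]
  have basic: "\<forall>\<^sub>F T in sequentially. 0 \<le> lam T \<and> 1 \<le> real (s T) \<and> 0 < \<beta>min T"
    using eventually_ge_at_top[of 1] by eventually_elim (use lam0 s_pos bmin_pos in auto)
  have tuning: "\<forall>\<^sub>F T in sequentially.
        6 * lam T * real (s T) / \<mu> \<le> \<beta>min T / 2 \<and>
        6 * lam T * real (s T) / \<mu> * (2 / \<beta>min T + 2) \<le> 3 \<and>
        lam T * (1 / 2 + 2 / \<beta>min T) * sqrt (real (s T)) / \<mu> < \<beta>min T \<and>
        6 * lam T * real (s T) / \<mu> * (1 / 2 + \<tau> * ((1 / 2 + 2 / \<beta>min T) * sqrt (real (s T)) / sqrt \<mu>)) < 1"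
    by (rule tuning_conditions[OF \<mu> _ lims basic]) (simp add: \<tau>_def)
  have large: "\<forall>\<^sub>F T::nat in sequentially. 3 \<le> 2 * ln 2 ^ 6 * c ^ 4 * ln (real T) ^ 4"
  proof -
    have "2 * ln 2 ^ 6 * c ^ 4 > 0" using c_pos by simp
    then show ?thesis by real_asymp
  qed
  have lower: "\<forall>\<^sub>F T in sequentially. 1 - err T \<le>
      \<P>(\<omega> in M T. map_vec sgn (\<beta>tilde T \<omega>) = map_vec sgn (\<beta>star T))"
    using tuning large \<nu>_le bm single_regressor_score_level[OF ab(1,2) \<mu> c3(1)] n_ev eventually_ge_at_top[of 3]
  proof eventually_elim
    case (elim T)
    have T1: "T \<ge> 1" using elim by simp
    interpret V: gaussian_var "M T" "k T" "p T" "\<Phi> T" "S T" "\<epsilon> T" "y T" by (rule var[OF T1])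
    \<comment> \<open>the penalty vanishes exactly for \<open>k = p = 1\<close>\<close>
    have alternatives: "(lam T > 0 \<and> \<nu> T \<le> lam T / 2 \<and>
        6 * lam T * real (s T) / \<mu> \<le> \<beta>min T / 2 \<and>
        6 * lam T * real (s T) / \<mu> * (2 / \<beta>min T + 2) \<le> 3 \<and>
        lam T * (1 / 2 + 2 / \<beta>min T) * sqrt (real (s T)) / \<mu> < \<beta>min T \<and>
        6 * lam T * real (s T) / \<mu> * (1 / 2 + \<tau> * ((1 / 2 + 2 / \<beta>min T) * sqrt (real (s T)) / sqrt \<mu>)) < 1)
      \<or> (k T * p T = 1 \<and> lam T = 0 \<and> \<nu> T < \<mu> * \<beta>min T)"
    proof (cases "k T * p T \<ge> 2")
      case True
      then show ?thesis
        using elim(1) score_level_le_penalty_level[OF elim(7) k1[OF T1] p1[OF T1] True c_pos c_le_\<sigma>[OF T1] elim(2)]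
        unfolding lam_eq \<nu>_def n_def by simp
    next
      case False
      then have "k T * p T < 2" by simp
      moreover have "k T \<le> k T * p T" "p T \<le> k T * p T" using k1[OF T1] p1[OF T1] by auto
      ultimately have "k T = 1" "p T = 1" using k1[OF T1] p1[OF T1] by linarith+
      moreover have "\<mu> * (c3 * (ln (real T) * b_T T)) \<le> \<mu> * \<beta>min T"
      proof (rule mult_left_mono)
        have "c3 * (ln (real T) * b_T T) \<le> c3 * (ln (real T) * max (a_T T) (b_T T))"
          using c3(1) T1 by (intro mult_left_mono) auto
        then show "c3 * (ln (real T) * b_T T) \<le> \<beta>min T" using elim(4) by simp
      qed (use \<mu> in simp)
      ultimately show ?thesis
        using elim(5) by (simp add: lam_eq penalty_level_def \<nu>_def n_def b_T_def)
    qed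
    have lag: "spectral_norm (regressor_cov (M T) (k T) (p T) (y T)) * V.lag_sum T \<le> K"
      using K[OF T1] unfolding V.lag_sum_def \<Gamma>_def F_def .
    show ?case
      unfolding err_def n_def \<rho>_def \<beta>star_def s_def
    proof (rule V.sign_recovery_prob[where lam="lam T" and \<nu>="\<nu> T" and bh="\<beta>hat T"
          and bt="\<beta>tilde T" and \<sigma>=\<sigma>m, OF T1 i[OF T1] c_pos _ _ lag])
      show "c \<le> kappa (regressor_cov (M T) (k T) (p T) (y T)) (card (support (true_param (k T) (p T) (\<Phi> T) (i T))))"
        using kappa[OF T1] by (simp add: \<Gamma>_def s_def \<beta>star_def)
      show "1 \<le> real (card (support (true_param (k T) (p T) (\<Phi> T) (i T))))"
        using s_pos[OF T1] by (simp add: s_def \<beta>star_def)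
      show "max_sd (M T) (k T) (\<epsilon> T) (y T) \<le> \<sigma>m" using \<sigma>m[OF T1] by (simp add: \<sigma>_def)
      show "0 \<le> \<nu> T"
        using elim(6,7) unfolding \<nu>_def score_level_def
        by (intro real_sqrt_ge_zero divide_nonneg_nonneg mult_nonneg_nonneg add_nonneg_nonneg) auto
      show "\<nu> T \<le> 8 * K + 2 * (\<sigma>m * K / c) + \<sigma>m\<^sup>2 + c\<^sup>2 + 1" using elim(3) by (simp add: \<rho>_def)
      show "0 \<le> lam T" using lam0[OF T1] .
    qed (use lasso[OF T1] adaptive_lasso[OF T1] tilde_measurable[OF T1]
        alternatives[unfolded \<mu>_def \<tau>_def \<beta>min_def s_def \<beta>star_def] in \<open>simp_all only:\<close>)
  qed
  show ?thesis
  proof (rule tendsto_sandwich[OF lower _ _ tendsto_const])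
    show "\<forall>\<^sub>F T in sequentially. \<P>(\<omega> in M T. map_vec sgn (\<beta>tilde T \<omega>) = map_vec sgn (\<beta>star T)) \<le> 1"
      using eventually_ge_at_top[of 1]
    proof eventually_elim
      case (elim T)
      interpret V: gaussian_var "M T" "k T" "p T" "\<Phi> T" "S T" "\<epsilon> T" "y T" by (rule var[OF elim])
      show ?case by (rule V.prob_le_1)
    qed
    show "(\<lambda>T. 1 - err T) \<longlonglongrightarrow> 1" using tendsto_diff[OF tendsto_const err_lim, of 1] by simp
  qed
qed

end
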